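(* The two properads $\mathsf{uDPois}^!$ and $\mathsf{uBIB}^!$ are isomorphic.
   Context: Ground field $\Bbbk$ of characteristic $0$; graded modules, Koszul sign rule. A $\Sigma$-bimodule $\mathsf{E}$ is a collection of $(\Sigma_m,\Sigma_n)$-bimodules $\mathsf{E}(m,n)$ ($m$ outputs, $n$ inputs) with $\mathsf{E}(0,n)=0$. A properad is an algebra over the monad $\mathcal{G}$ of connected directed graphs (without directed cycles) with vertices decorated by $\mathsf{E}$; $\mathcal{G}(\mathsf{E})$ is the free properad. Elements are written as composites of operations: $f\circ g$ means that $g$ is applied first, $f\otimes g=(f\otimes\mathrm{id})\circ(\mathrm{id}\otimes g)$, and $\tau$ is the symmetry exchanging two strands (degree $0$; it only permutes labels). $\mathsf{uBIB}^!$ is the unital extension of the Koszul dual properad $\mathsf{BIB}^!$ of the properad of balanced infinitesimal bialgebras with coproduct of degree $-1$: it is generated by $u$ of arity $(1,0)$ and degree $1$, $m$ of arity $(1,2)$ and degree $-1$, and $\Delta$ of arity $(2,1)$ and degree $0$ ($m$ and $\Delta$ each generating a free $\Sigma_2$-module), with relations generated by $m(\mathrm{id}\otimes m)+m(m\otimes \mathrm{id})$; $(\mathrm{id}\otimes\Delta)\Delta-(\Delta\otimes\mathrm{id})\Delta$; $-\Delta m+(m\otimes \mathrm{id})(\mathrm{id}\otimes\Delta)$; $-\Delta m+(\mathrm{id}\otimes m)(\Delta\otimes\mathrm{id})$; $B+\tau B\tau$; $B+D\tau$; $m\Delta$; $m\tau\Delta$, where $B=(\mathrm{id}\otimes m)(\tau\otimes\mathrm{id})(\mathrm{id}\otimes\Delta)$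 and $D=(m\otimes\mathrm{id})(\mathrm{id}\otimes\tau)(\Delta\otimes\mathrm{id})$ (the relations of $\mathsf{BIB}^!$), together with the unit relations $m(u\otimes\mathrm{id})=-\mathrm{id}$ and $m(\mathrm{id}\otimes u)=\mathrm{id}$. $\mathsf{uDPois}^!$ is the unital extension of the Koszul dual properad $\mathsf{DPois}^!$ of the properad of double Poisson gebras: it is generated by $u$ of arity $(1,0)$ and degree $1$; $m$ of arity $(1,2)$ and degree $-1$ (free $\Sigma_2$-module); $w$ of arity $(2,2)$ and degree $-1$ with $\tau w\tau=-w$; with relations $m(\mathrm{id}\otimes m)+m(m\otimes\mathrm{id})=0$; $m(u\otimes \mathrm{id})=-\mathrm{id}$, $m(\mathrm{id}\otimes u)=\mathrm{id}$; $(m\otimes\mathrm{id})(\mathrm{id}\otimes w)+w(\mathrm{id}\otimes m)(\tau\otimes\mathrm{id})=0$; $(m\otimes\mathrm{id})(\mathrm{id}\otimes\tau)(w\otimes\mathrm{id})+w(m\otimes\mathrm{id})(\mathrm{id}\otimes\tau)=0$; $(w\otimes\mathrm{id})(\mathrm{id}\otimes w)=c^{-1}(w\otimes\mathrm{id})(\mathrm{id}\otimes w)c$ where $c$ is the cyclic permutation of three strands; $m w=0$; $w w=0$ (both outputs of the first $w$ plugged into the two inputs of the next operation). *)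

theory Defs
  imports Complex_Main "HOL-Library.Poly_Mapping" "HOL-Library.Set_Algebras"
begin

section \<open>Directed graphs with decorated vertices\<close>

text \<open>
  A graph with labelled inputs and outputs is given by naming its edges by natural numbers: a
  vertex is a triple of its decoration, the list of the edges leaving it and the list of the edges
  entering it, and the two last components of a graph list its global outputs and inputs.  The
  order of the edge lists is the numbering of the legs.  The order of the list of vertices is the
  order of the factors in the tensor product of the decorations, which matters for Koszul signs.
\<close>

datatype 'x dgraph =
  DGraph (vertices: "('x \<times> nat list \<times> nat list) list") (outs: "nat list") (ins: "nat list")

definition edge_sources :: "'x dgraph \<Rightarrow> nat list" where
  "edge_sources G = ins G @ concat (map (\<lambda>(x, vo, vi). vo) (vertices G))"

definition edge_targets :: "'x dgraph \<Rightarrow> nat list" where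
  "edge_targets G = outs G @ concat (map (\<lambda>(x, vo, vi). vi) (vertices G))"

definition edges :: "'x dgraph \<Rightarrow> nat set" where
  "edges G = set (edge_sources G) \<union> set (edge_targets G)"

text \<open>Every edge comes from exactly one place and goes to exactly one place.\<close>

definition wf_dgraph :: "'x dgraph \<Rightarrow> bool" where
  "wf_dgraph G \<longleftrightarrow> distinct (edge_sources G) \<and> distinct (edge_targets G)
     \<and> set (edge_sources G) = set (edge_targets G)"

definition flow :: "'x dgraph \<Rightarrow> (nat \<times> nat) set" where
  "flow G = {(e, e'). \<exists>(x, vo, vi) \<in> set (vertices G). e \<in> set vi \<and> e' \<in> set vo}"

definition adjacent :: "'x dgraph \<Rightarrow> (nat \<times> nat) set" where
  "adjacent G = {(e, e'). \<exists>(x, vo, vi) \<in> set (vertices G). e \<in> set vo \<union> set vi \<and> e' \<in> set vo \<union> set vi}"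

text \<open>
  Connected graphs without directed cycles.  There are no operations without outputs, so every
  vertex has an outgoing edge; this is why connectedness can be expressed through the edges.  The
  graph without vertices \<open>DGraph [] [e] [e]\<close> is admitted, the empty graph is not.
\<close>

definition connected_dag :: "'x dgraph \<Rightarrow> bool" where
  "connected_dag G \<longleftrightarrow> wf_dgraph G
     \<and> (\<forall>(x, vo, vi) \<in> set (vertices G). vo \<noteq> [])
     \<and> acyclic (flow G)
     \<and> edges G \<noteq> {} \<and> (\<forall>e \<in> edges G. \<forall>e' \<in> edges G. (e, e') \<in> (adjacent G)\<^sup>*)"

definition rename :: "(nat \<Rightarrow> nat) \<Rightarrow> 'x dgraph \<Rightarrow> 'x dgraph" where
  "rename f G = DGraph (map (\<lambda>(x, vo, vi). (x, map f vo, map f vi)) (vertices G))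
     (map f (outs G)) (map f (ins G))"

text \<open>
  Multiplication of the monad of graphs: \<open>H\<close> arises from the graph of graphs \<open>\<Gamma>\<close> by inserting at
  its \<open>i\<close>-th vertex the graph decorating it.  The maps \<open>f\<close> and \<open>h i\<close> send the edges of \<open>\<Gamma>\<close>, resp. of
  the \<open>i\<close>-th inserted graph, to edges of \<open>H\<close>, and glue the legs of that graph to the edges at the
  vertex.  They need not be injective (inserting the graph without vertices glues two edges of
  \<open>\<Gamma>\<close>), but since \<open>H\<close> is well-formed nothing else is identified.  So \<open>H\<close> is unique up to renaming.
\<close>

definition is_flattening :: "'x dgraph dgraph \<Rightarrow> 'x dgraph \<Rightarrow> bool" where
  "is_flattening \<Gamma> H \<longleftrightarrow> wf_dgraph H \<and> (\<exists>f h.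
     outs H = map f (outs \<Gamma>) \<and> ins H = map f (ins \<Gamma>) \<and>
     vertices H = concat (map (\<lambda>i. vertices (rename (h i) (fst (vertices \<Gamma> ! i))))
                              [0..<length (vertices \<Gamma>)]) \<and>
     (\<forall>i < length (vertices \<Gamma>). case vertices \<Gamma> ! i of (G, vo, vi) \<Rightarrow>
        map (h i) (outs G) = map f vo \<and> map (h i) (ins G) = map f vi))"

definition flatten :: "'x dgraph dgraph \<Rightarrow> 'x dgraph" where
  "flatten \<Gamma> = (SOME H. is_flattening \<Gamma> H)"


section \<open>Properads and their isomorphisms\<close>

text \<open>
  The structure of an algebra over the monad of connected directed graphs: for \<open>m\<close> outputs and
  \<open>n\<close> inputs a graded vector space \<open>pspace P m n\<close>, with homogeneous parts \<open>phom P m n d\<close>, and a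
  composite \<open>pcomp P \<Gamma>\<close> for each connected graph \<open>\<Gamma>\<close> decorated by elements.  The identity
  is the composite of the graph without vertices, and the actions of the symmetric groups are the
  composites of the graphs with one vertex.
\<close>

record ('a, 'k) properad =
  pspace :: "nat \<Rightarrow> nat \<Rightarrow> 'a set"
  phom :: "nat \<Rightarrow> nat \<Rightarrow> int \<Rightarrow> 'a set"
  padd :: "'a \<Rightarrow> 'a \<Rightarrow> 'a"
  psmult :: "'k \<Rightarrow> 'a \<Rightarrow> 'a"
  pcomp :: "'a dgraph \<Rightarrow> 'a"

definition decorated_by :: "(nat \<Rightarrow> nat \<Rightarrow> 'a set) \<Rightarrow> 'a dgraph \<Rightarrow> bool" where
  "decorated_by V \<Gamma> \<longleftrightarrow> connected_dag \<Gamma>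
     \<and> (\<forall>(x, vo, vi) \<in> set (vertices \<Gamma>). x \<in> V (length vo) (length vi))"

definition map_decoration :: "(nat \<Rightarrow> nat \<Rightarrow> 'a \<Rightarrow> 'b) \<Rightarrow> 'a dgraph \<Rightarrow> 'b dgraph" where
  "map_decoration \<phi> \<Gamma> = DGraph
     (map (\<lambda>(x, vo, vi). (\<phi> (length vo) (length vi) x, vo, vi)) (vertices \<Gamma>)) (outs \<Gamma>) (ins \<Gamma>)"

definition properad_iso ::
  "('a, 'k) properad \<Rightarrow> ('b, 'k) properad \<Rightarrow> (nat \<Rightarrow> nat \<Rightarrow> 'a \<Rightarrow> 'b) \<Rightarrow> bool" where
  "properad_iso P Q \<phi> \<longleftrightarrow>
     (\<forall>m n. bij_betw (\<phi> m n) (pspace P m n) (pspace Q m n)) \<and>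
     (\<forall>m n d. \<phi> m n ` phom P m n d = phom Q m n d) \<and>
     (\<forall>m n. \<forall>x \<in> pspace P m n. \<forall>y \<in> pspace P m n.
        \<phi> m n (padd P x y) = padd Q (\<phi> m n x) (\<phi> m n y)) \<and>
     (\<forall>m n c. \<forall>x \<in> pspace P m n. \<phi> m n (psmult P c x) = psmult Q c (\<phi> m n x)) \<and>
     (\<forall>\<Gamma>. decorated_by (pspace P) \<Gamma> \<longrightarrow>
        \<phi> (length (outs \<Gamma>)) (length (ins \<Gamma>)) (pcomp P \<Gamma>) = pcomp Q (map_decoration \<phi> \<Gamma>))"

definition properads_isomorphic :: "('a, 'k) properad \<Rightarrow> ('b, 'k) properad \<Rightarrow> bool" where
  "properads_isomorphic P Q \<longleftrightarrow> (\<exists>\<phi>. properad_iso P Q \<phi>)"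


section \<open>Properads given by generators and relations\<close>

record 'g signature =
  out_arity :: "'g \<Rightarrow> nat"
  in_arity :: "'g \<Rightarrow> nat"
  degree :: "'g \<Rightarrow> int"

text \<open>
  Each generator spans a free bimodule over the symmetric groups.  The legs at a vertex are numbered,
  so graphs decorated by the generators themselves account for all decorations by that bimodule.
\<close>

definition graph_degree :: "'g signature \<Rightarrow> 'g dgraph \<Rightarrow> int" where
  "graph_degree S G = (\<Sum>(g, vo, vi) \<leftarrow> vertices G. degree S g)"

definition monomials :: "'g signature \<Rightarrow> nat \<Rightarrow> nat \<Rightarrow> 'g dgraph set" where
  "monomials S m n = {G. connected_dag G
     \<and> (\<forall>(g, vo, vi) \<in> set (vertices G). length vo = out_arity S g \<and> length vi = in_arity S g)
     \<and> length (outs G) = m \<and> length (ins G) = n}"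

type_synonym ('g, 'k) lincomb = "'g dgraph \<Rightarrow>\<^sub>0 'k"

definition scale :: "'k::comm_ring_1 \<Rightarrow> ('g, 'k) lincomb \<Rightarrow> ('g, 'k) lincomb" where
  "scale c p = Poly_Mapping.map ((*) c) p"

abbreviation bvec :: "'g dgraph \<Rightarrow> ('g, 'k::comm_ring_1) lincomb" where
  "bvec G \<equiv> Poly_Mapping.single G 1"

definition lincombs :: "'g signature \<Rightarrow> nat \<Rightarrow> nat \<Rightarrow> ('g, 'k::comm_ring_1) lincomb set" where
  "lincombs S m n = {p. Poly_Mapping.keys p \<subseteq> monomials S m n}"

definition hom_lincombs ::
  "'g signature \<Rightarrow> nat \<Rightarrow> nat \<Rightarrow> int \<Rightarrow> ('g, 'k::comm_ring_1) lincomb set" where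
  "hom_lincombs S m n d =
     {p. Poly_Mapping.keys p \<subseteq> {G \<in> monomials S m n. graph_degree S G = d}}"

text \<open>
  The multilinear extension of \<^const>\<open>flatten\<close>.  The sum is over the graphs \<open>\<Delta>\<close> of graphs that have
  the shape of \<open>\<Gamma>\<close> and at each vertex a graph occurring in the linear combination decorating \<open>\<Gamma>\<close>.
\<close>

definition graph_subst :: "('g, 'k::comm_ring_1) lincomb dgraph \<Rightarrow> ('g, 'k) lincomb" where
  "graph_subst \<Gamma> =
     (\<Sum>\<Delta> \<in> {\<Delta>. rel_dgraph (\<lambda>G p. G \<in> Poly_Mapping.keys p) \<Delta> \<Gamma>}.
        Poly_Mapping.single (flatten \<Delta>)
          (\<Prod>((p, _), (G, _)) \<leftarrow> zip (vertices \<Gamma>) (vertices \<Delta>). Poly_Mapping.lookup p G))"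

definition koszul_sign :: "int \<Rightarrow> int \<Rightarrow> 'k::comm_ring_1" where
  "koszul_sign d d' = (if odd (d * d') then -1 else 1)"

text \<open>
  The free properad is the quotient of the linear combinations of graphs by the identification of
  isomorphic graphs (rules \<open>rename\<close> and \<open>swap\<close>), and the presented properad is the quotient of the
  free properad by the ideal generated by \<open>R\<close> (rules \<open>rel\<close> and \<open>comp\<close>).  Both are taken at once, and
  for all arities at once.
\<close>

inductive_set relation_ideal ::
  "'g signature \<Rightarrow> ('g, 'k::comm_ring_1) lincomb set \<Rightarrow> ('g, 'k) lincomb set"
  for S :: "'g signature" and R :: "('g, 'k) lincomb set" where
  zero: "0 \<in> relation_ideal S R"
| add: "p \<in> relation_ideal S R \<Longrightarrow> q \<in> relation_ideal S R \<Longrightarrow> p + q \<in> relation_ideal S R"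
| scale: "p \<in> relation_ideal S R \<Longrightarrow> scale c p \<in> relation_ideal S R"
| rename: "G \<in> monomials S m n \<Longrightarrow> inj_on f (edges G) \<Longrightarrow>
    bvec G - bvec (rename f G) \<in> relation_ideal S R"
| swap: "DGraph (vs @ (g, vo, vi) # (g', vo', vi') # ws) bs as \<in> monomials S m n \<Longrightarrow>
    bvec (DGraph (vs @ (g, vo, vi) # (g', vo', vi') # ws) bs as)
      - scale (koszul_sign (degree S g) (degree S g'))
          (bvec (DGraph (vs @ (g', vo', vi') # (g, vo, vi) # ws) bs as)) \<in> relation_ideal S R"
| rel: "r \<in> R \<Longrightarrow> r \<in> relation_ideal S R"
| comp: "decorated_by (lincombs S) \<Gamma> \<Longrightarrow> (p, vo, vi) \<in> set (vertices \<Gamma>) \<Longrightarrow>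
    p \<in> relation_ideal S R \<Longrightarrow> graph_subst \<Gamma> \<in> relation_ideal S R"

text \<open>
  The elements are cosets \<open>p +o relation_ideal S R\<close>; composites are computed on representatives.
\<close>

definition presented_properad ::
  "'g signature \<Rightarrow> ('g, 'k::comm_ring_1) lincomb set \<Rightarrow> (('g, 'k) lincomb set, 'k) properad" where
  "presented_properad S R = \<lparr>
     pspace = (\<lambda>m n. (\<lambda>p. p +o relation_ideal S R) ` lincombs S m n),
     phom = (\<lambda>m n d. (\<lambda>p. p +o relation_ideal S R) ` hom_lincombs S m n d),
     padd = (\<lambda>A B. A + B),
     psmult = (\<lambda>c A. scale c ` A + relation_ideal S R),
     pcomp = (\<lambda>\<Gamma>. \<Union>\<Gamma>' \<in> {\<Gamma>'. rel_dgraph (\<in>) \<Gamma>' \<Gamma> \<and> decorated_by (lincombs S) \<Gamma>'}.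
                      graph_subst \<Gamma>' +o relation_ideal S R) \<rparr>"


section \<open>Composites of operations\<close>

text \<open>
  Sequential composition (\<open>g\<close> is applied first) and juxtaposition of graphs.  Edges of the first
  graph are renamed to even numbers and those of the second graph to odd numbers, except that in
  \<open>f \<odot> g\<close> the inputs of \<open>f\<close> become the outputs of \<open>g\<close>.  In both cases the vertices of \<open>f\<close> come
  first, in accordance with \<open>f \<otimes> g = (f \<otimes> id) \<circ> (id \<otimes> g)\<close>.
\<close>

definition seq_comp :: "'g dgraph \<Rightarrow> 'g dgraph \<Rightarrow> 'g dgraph"  (infixl \<open>\<odot>\<close> 70) where
  "f \<odot> g =
    (let g' = rename (\<lambda>e. 2 * e + 1) g;
         f' = rename (\<lambda>e. case map_of (zip (ins f) (outs g')) e of None \<Rightarrow> 2 * e | Some e' \<Rightarrow> e') f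
     in DGraph (vertices f' @ vertices g') (outs f') (ins g'))"

definition par_comp :: "'g dgraph \<Rightarrow> 'g dgraph \<Rightarrow> 'g dgraph"  (infixl \<open>\<otimes>\<close> 75) where
  "f \<otimes> g =
    (let f' = rename (\<lambda>e. 2 * e) f; g' = rename (\<lambda>e. 2 * e + 1) g
     in DGraph (vertices f' @ vertices g') (outs f' @ outs g') (ins f' @ ins g'))"

definition strand :: "'g dgraph"  (\<open>\<one>\<close>) where
  "\<one> = DGraph [] [0] [0]"

definition twist :: "'g dgraph"  (\<open>\<tau>\<close>) where
  "\<tau> = DGraph [] [1, 0] [0, 1]"

definition cycle3 :: "'g dgraph" where
  "cycle3 = DGraph [] [1, 2, 0] [0, 1, 2]"

definition cycle3_inv :: "'g dgraph" where
  "cycle3_inv = DGraph [] [2, 0, 1] [0, 1, 2]"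

definition corolla :: "'g signature \<Rightarrow> 'g \<Rightarrow> 'g dgraph" where
  "corolla S g =
    (let b = [0..<out_arity S g]; a = [out_arity S g..<out_arity S g + in_arity S g]
     in DGraph [(g, b, a)] b a)"


section \<open>The properad \<open>uBIB\<^sup>!\<close>\<close>

datatype bib_gen = Unit_BIB | Mult_BIB | Comult_BIB

definition bib_sig :: "bib_gen signature" where
  "bib_sig = \<lparr>
     out_arity = (\<lambda>g. case g of Unit_BIB \<Rightarrow> 1 | Mult_BIB \<Rightarrow> 1 | Comult_BIB \<Rightarrow> 2),
     in_arity = (\<lambda>g. case g of Unit_BIB \<Rightarrow> 0 | Mult_BIB \<Rightarrow> 2 | Comult_BIB \<Rightarrow> 1),
     degree = (\<lambda>g. case g of Unit_BIB \<Rightarrow> 1 | Mult_BIB \<Rightarrow> -1 | Comult_BIB \<Rightarrow> 0) \<rparr>"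

definition bib_rels :: "(bib_gen, 'k::comm_ring_1) lincomb set" where
  "bib_rels =
    (let u = corolla bib_sig Unit_BIB; m = corolla bib_sig Mult_BIB;
         \<Delta> = corolla bib_sig Comult_BIB;
         B = (\<one> \<otimes> m) \<odot> (\<tau> \<otimes> \<one>) \<odot> (\<one> \<otimes> \<Delta>);
         D = (m \<otimes> \<one>) \<odot> (\<one> \<otimes> \<tau>) \<odot> (\<Delta> \<otimes> \<one>)
     in {bvec (m \<odot> (\<one> \<otimes> m)) + bvec (m \<odot> (m \<otimes> \<one>)),
         bvec ((\<one> \<otimes> \<Delta>) \<odot> \<Delta>) - bvec ((\<Delta> \<otimes> \<one>) \<odot> \<Delta>),
         - bvec (\<Delta> \<odot> m) + bvec ((m \<otimes> \<one>) \<odot> (\<one> \<otimes> \<Delta>)),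
         - bvec (\<Delta> \<odot> m) + bvec ((\<one> \<otimes> m) \<odot> (\<Delta> \<otimes> \<one>)),
         bvec B + bvec (\<tau> \<odot> B \<odot> \<tau>),
         bvec B + bvec (D \<odot> \<tau>),
         bvec (m \<odot> \<Delta>),
         bvec (m \<odot> \<tau> \<odot> \<Delta>),
         bvec (m \<odot> (u \<otimes> \<one>)) + bvec \<one>,
         bvec (m \<odot> (\<one> \<otimes> u)) - bvec \<one>})"

definition uBIB :: "((bib_gen, 'k::field_char_0) lincomb set, 'k) properad" where
  "uBIB = presented_properad bib_sig bib_rels"


section \<open>The properad \<open>uDPois\<^sup>!\<close>\<close>

text \<open>
  The bimodule generated by \<open>w\<close> is the quotient of the free one by \<open>\<tau> w \<tau> = - w\<close>; this equation is
  the first relation.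
\<close>

datatype dpois_gen = Unit_DPois | Mult_DPois | Bracket_DPois

definition dpois_sig :: "dpois_gen signature" where
  "dpois_sig = \<lparr>
     out_arity = (\<lambda>g. case g of Unit_DPois \<Rightarrow> 1 | Mult_DPois \<Rightarrow> 1 | Bracket_DPois \<Rightarrow> 2),
     in_arity = (\<lambda>g. case g of Unit_DPois \<Rightarrow> 0 | Mult_DPois \<Rightarrow> 2 | Bracket_DPois \<Rightarrow> 2),
     degree = (\<lambda>g. case g of Unit_DPois \<Rightarrow> 1 | Mult_DPois \<Rightarrow> -1 | Bracket_DPois \<Rightarrow> -1) \<rparr>"

definition dpois_rels :: "(dpois_gen, 'k::comm_ring_1) lincomb set" where
  "dpois_rels =
    (let u = corolla dpois_sig Unit_DPois; m = corolla dpois_sig Mult_DPois;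
         w = corolla dpois_sig Bracket_DPois
     in {bvec (\<tau> \<odot> w \<odot> \<tau>) + bvec w,
         bvec (m \<odot> (\<one> \<otimes> m)) + bvec (m \<odot> (m \<otimes> \<one>)),
         bvec (m \<odot> (u \<otimes> \<one>)) + bvec \<one>,
         bvec (m \<odot> (\<one> \<otimes> u)) - bvec \<one>,
         bvec ((m \<otimes> \<one>) \<odot> (\<one> \<otimes> w)) + bvec (w \<odot> (\<one> \<otimes> m) \<odot> (\<tau> \<otimes> \<one>)),
         bvec ((m \<otimes> \<one>) \<odot> (\<one> \<otimes> \<tau>) \<odot> (w \<otimes> \<one>)) + bvec (w \<odot> (m \<otimes> \<one>) \<odot> (\<one> \<otimes> \<tau>)),
         bvec ((w \<otimes> \<one>) \<odot> (\<one> \<otimes> w)) - bvec (cycle3_inv \<odot> ((w \<otimes> \<one>) \<odot> (\<one> \<otimes> w)) \<odot> cycle3),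
         bvec (m \<odot> w),
         bvec (w \<odot> w)})"

definition uDPois :: "((dpois_gen, 'k::field_char_0) lincomb set, 'k) properad" where
  "uDPois = presented_properad dpois_sig dpois_rels"

end

theory Submission
  imports Defs "HOL-Library.Nat_Bijection" "HOL-Library.Multiset" "HOL-Library.Code_Binary_Nat"
begin

text \<open>
  The isomorphism sends \<open>u\<close> and \<open>m\<close> to themselves and the bracket \<open>w\<close> to
  \<open>B = (id \<otimes> m)(\<tau> \<otimes> id)(id \<otimes> \<Delta>)\<close>; its inverse sends \<open>\<Delta>\<close> to \<open>- w(u \<otimes> id)\<close>.  Up to Koszul signs
  the idea is this.  In \<open>uDPois\<^sup>!\<close> the two relations between \<open>w\<close> and \<open>m\<close> say that \<open>w\<close> is linear for
  suitable multiplications in each of its arguments, so the units determine it by the element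
  \<open>w(u, u) = \<theta>' \<otimes> \<theta>''\<close>, namely \<open>w(a, b) = b \<theta>' a \<otimes> \<theta>''\<close>, and by antisymmetry also
  \<open>w(a, b) = \<theta>' \<otimes> a \<theta>'' b\<close>.  In \<open>uBIB\<^sup>!\<close> the coproduct is linear, so \<open>\<Delta>(b) = b \<theta>' \<otimes> \<theta>'' = \<theta>' \<otimes> \<theta>'' b\<close>
  with \<open>\<theta> = \<Delta>(u)\<close>, and \<open>B(a, b) = \<theta>' \<otimes> a \<theta>'' b\<close>.  So both properads describe a unital associative
  product together with such an element \<open>\<theta>\<close>: the antisymmetry of \<open>w\<close> is the one of \<open>B\<close>, coassociativity
  is the cyclic relation, and \<open>m w = 0\<close>, \<open>w w = 0\<close> say, like \<open>m \<Delta> = 0\<close> and \<open>m \<tau> \<Delta> = 0\<close>, that the two legs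
  of \<open>\<theta>\<close> annihilate each other.

  All relations equate a graph with a multiple of another one, or with zero.  Hence the image of
  each relation can be proved by rewriting one graph.  Once the images of \<open>B\<close> and \<open>D \<tau>\<close> under the
  inverse are known to be \<open>w\<close> up to sign (\<open>dpois_derived_valid\<close>), at most four steps are needed for each
  relation (\<open>bib_carries\<close> and \<open>dpois_carries\<close>).  The rewriting, with its Koszul signs, is a function
  on explicit graphs that is evaluated by the simplifier and proved sound once
  (\<open>rewrite_front_sound\<close>, \<open>proves_eq_sound\<close>).

  The general part explains why checking generators and relations is enough
  (\<open>presented_properads_isomorphic\<close>).  It rests on properties of the composition of graphs.  When
  graphs are inserted at the vertices of a graph, the edges are glued along chains that pass from the
  outer graph into an inserted graph and back; since there are no directed cycles, each chain starts
  at one source and ends at one target.  Therefore the composite exists (\<open>flattening_exists\<close>), has the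
  universal property of a gluing (\<open>glue_universal\<close>), hence is unique up to renaming, and is again
  connected and acyclic (\<open>flattening_connected\<close>).  The universal property makes composition associative
  (\<open>flattening_assoc\<close>), and by multilinearity a map of generators extends to a linear map that
  commutes with composition modulo the relations (\<open>induced_graph_subst\<close>).
\<close>

section \<open>Renaming edges\<close>

lemma rename_simps [simp]:
  "vertices (rename f G) = map (\<lambda>(x, vo, vi). (x, map f vo, map f vi)) (vertices G)"
  "outs (rename f G) = map f (outs G)" "ins (rename f G) = map f (ins G)"
  by (simp_all add: rename_def)

lemma rename_rename: "rename f (rename g G) = rename (f \<circ> g) G"
  by (simp add: rename_def case_prod_beta')

lemma edge_sources_rename [simp]: "edge_sources (rename f G) = map f (edge_sources G)"
  by (simp add: edge_sources_def map_concat case_prod_beta' comp_def)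

lemma edge_targets_rename [simp]: "edge_targets (rename f G) = map f (edge_targets G)"
  by (simp add: edge_targets_def map_concat case_prod_beta' comp_def)

lemma edges_rename [simp]: "edges (rename f G) = f ` edges G"
  by (auto simp: edges_def)

lemma edges_wf: "wf_dgraph G \<Longrightarrow> edges G = set (edge_sources G)"
  "wf_dgraph G \<Longrightarrow> edges G = set (edge_targets G)"
  by (auto simp: wf_dgraph_def edges_def)

lemma finite_edges [simp]: "finite (edges G)"
  by (simp add: edges_def)

lemma edges_outs: "set (outs G) \<subseteq> edges G" and edges_ins: "set (ins G) \<subseteq> edges G"
  by (auto simp: edges_def edge_sources_def edge_targets_def)

lemma edges_vertex:
  assumes "(x, vo, vi) \<in> set (vertices G)"
  shows "set vo \<subseteq> edges G" "set vi \<subseteq> edges G"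
  using assms by (force simp: edges_def edge_sources_def edge_targets_def)+

lemma rename_cong: "(\<And>e. e \<in> edges G \<Longrightarrow> f e = g e) \<Longrightarrow> rename f G = rename g G"
  using edges_outs[of G] edges_ins[of G] edges_vertex[of _ _ _ G]
  by (fastforce simp: rename_def)

lemma rename_id: "(\<And>e. e \<in> edges G \<Longrightarrow> f e = e) \<Longrightarrow> rename f G = G"
  by (subst rename_cong[of _ _ id]) (simp_all add: rename_def case_prod_beta')

text \<open>
  Whether a renaming is injective can be read off from its result; this is how all injectivity
  conditions on renamings are obtained below.
\<close>

lemma wf_rename_iff: "wf_dgraph G \<Longrightarrow> wf_dgraph (rename f G) \<longleftrightarrow> inj_on f (edges G)"
  by (auto simp: wf_dgraph_def distinct_map edges_def)

lemma Collect_Bex_times: "{(e, e'). \<exists>v\<in>S. e \<in> A v \<and> e' \<in> B v} = (\<Union>v\<in>S. A v \<times> B v)"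
  by auto

lemma flow_rename: "flow (rename g G) = map_prod g g ` flow G"
proof -
  have "flow G = (\<Union>v\<in>set (vertices G). set (snd (snd v)) \<times> set (fst (snd v)))" for G :: "'a dgraph"
  proof -
    have "flow G = {(e, e'). \<exists>v\<in>set (vertices G). e \<in> set (snd (snd v)) \<and> e' \<in> set (fst (snd v))}"
      by (simp add: flow_def case_prod_beta')
    then show ?thesis unfolding Collect_Bex_times .
  qed
  then show ?thesis by (simp add: image_UN map_prod_surj_on[OF refl refl] case_prod_beta')
qed

lemma adjacent_rename: "adjacent (rename g G) = map_prod g g ` adjacent G"
proof -
  let ?l = "\<lambda>v. set (fst (snd v)) \<union> set (snd (snd v))"
  have "adjacent G = (\<Union>v\<in>set (vertices G). ?l v \<times> ?l v)" for G :: "'a dgraph"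
  proof -
    have "adjacent G = {(e, e'). \<exists>v\<in>set (vertices G). e \<in> ?l v \<and> e' \<in> ?l v}"
      by (simp add: adjacent_def case_prod_beta')
    then show ?thesis unfolding Collect_Bex_times .
  qed
  then show ?thesis by (simp add: image_UN map_prod_surj_on[OF refl refl] case_prod_beta' image_Un)
qed

lemma finite_flow: "finite (flow G)"
proof (rule finite_subset)
  show "flow G \<subseteq> edges G \<times> edges G"
    using edges_vertex[of _ _ _ G] by (fastforce simp: flow_def)
qed simp

section \<open>Acyclic partial injections\<close>

lemma finite_acyclic_rank:
  assumes "finite r" "acyclic r"
  obtains \<rho> :: "'a \<Rightarrow> nat" where "\<And>a b. (a, b) \<in> r \<Longrightarrow> \<rho> a < \<rho> b"
proof
  fix a b assume ab: "(a, b) \<in> r"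
  have fin: "finite {x. (x, b) \<in> r\<^sup>+}"
  proof (rule finite_subset)
    show "{x. (x, b) \<in> r\<^sup>+} \<subseteq> fst ` (r\<^sup>+)" by force
  qed (use assms(1) in simp)
  have "{x. (x, a) \<in> r\<^sup>+} \<subset> {x. (x, b) \<in> r\<^sup>+}"
    using ab assms(2) by (auto simp: acyclic_def intro: trancl_into_trancl)
  then show "card {x. (x, a) \<in> r\<^sup>+} < card {x. (x, b) \<in> r\<^sup>+}"
    by (rule psubset_card_mono[OF fin])
qed

text \<open>
  A finite relation that is functional in both directions and acyclic decomposes its field into
  chains, so going to the end of a chain is well defined, and so is going to its beginning.
\<close>

lemma partial_injection_chains:
  fixes B :: "('a \<times> 'a) set"
  assumes fin: "finite B" and ac: "acyclic B" and sv: "single_valued B" and svi: "single_valued (B\<inverse>)"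
  shows "\<exists>s. (x, s) \<in> B\<^sup>* \<and> s \<notin> Domain B"
    and "\<exists>t. (t, x) \<in> B\<^sup>* \<and> t \<notin> Range B"
    and "\<lbrakk>(x, s) \<in> B\<^sup>*; (x, s') \<in> B\<^sup>*; s \<notin> Domain B; s' \<notin> Domain B\<rbrakk> \<Longrightarrow> s = s'"
    and "\<lbrakk>(x, s) \<in> B\<^sup>*; (y, s) \<in> B\<^sup>*; x \<notin> Range B; y \<notin> Range B\<rbrakk> \<Longrightarrow> x = y"
proof -
  have ex: "\<exists>s. (x, s) \<in> C\<^sup>* \<and> s \<notin> Domain C" if "wf (C\<inverse>)" for C :: "('a \<times> 'a) set" and x
    using that
  proof (induction x rule: wf_induct_rule)
    case (less x)
    show ?case
    proof (cases "x \<in> Domain C")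
      case True
      then obtain y where "(x, y) \<in> C" by auto
      with less[of y] show ?thesis by (meson converse_iff converse_rtrancl_into_rtrancl)
    qed auto
  qed
  show "\<exists>s. (x, s) \<in> B\<^sup>* \<and> s \<notin> Domain B"
    by (rule ex) (rule finite_acyclic_wf_converse[OF fin ac])
  have "\<exists>s. (x, s) \<in> (B\<inverse>)\<^sup>* \<and> s \<notin> Domain (B\<inverse>)"
    by (rule ex) (simp add: finite_acyclic_wf[OF fin ac])
  then show "\<exists>t. (t, x) \<in> B\<^sup>* \<and> t \<notin> Range B"
    by (simp add: rtrancl_converse)
  have comp: "s = s'" if "single_valued C" "(x, s) \<in> C\<^sup>*" "(x, s') \<in> C\<^sup>*" "s \<notin> Domain C" "s' \<notin> Domain C"
    for C :: "('a \<times> 'a) set" and x s s'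
    using single_valued_confluent[OF that(1-3)] that(4,5)
    by (auto elim: converse_rtranclE)
  show "\<lbrakk>(x, s) \<in> B\<^sup>*; (x, s') \<in> B\<^sup>*; s \<notin> Domain B; s' \<notin> Domain B\<rbrakk> \<Longrightarrow> s = s'"
    by (rule comp[OF sv])
  show "\<lbrakk>(x, s) \<in> B\<^sup>*; (y, s) \<in> B\<^sup>*; x \<notin> Range B; y \<notin> Range B\<rbrakk> \<Longrightarrow> x = y"
    using comp[OF svi, of s x y] by (simp add: rtrancl_converse)
qed

section \<open>Gluing the edges of a graph of graphs\<close>

definition inserts :: "(nat \<Rightarrow> nat) \<Rightarrow> 'x dgraph \<times> nat list \<times> nat list \<Rightarrow> ('x \<times> nat list \<times> nat list) list \<Rightarrow> bool" where
  "inserts f = (\<lambda>(G, vo, vi) b. \<exists>h. b = vertices (rename h G) \<and> map h (outs G) = map f vo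
     \<and> map h (ins G) = map f vi)"

text \<open>
  One list of inserted vertices for each vertex replaces the indexed family of renamings.  In this
  form blocks of vertices can be concatenated, split and permuted.
\<close>

lemma is_flattening_iff_inserts:
  "is_flattening \<Gamma> H \<longleftrightarrow> wf_dgraph H \<and> (\<exists>f bs. outs H = map f (outs \<Gamma>) \<and> ins H = map f (ins \<Gamma>)
     \<and> vertices H = concat bs \<and> list_all2 (inserts f) (vertices \<Gamma>) bs)"
proof
  assume "is_flattening \<Gamma> H"
  then obtain f h where *: "wf_dgraph H" "outs H = map f (outs \<Gamma>)" "ins H = map f (ins \<Gamma>)"
    "vertices H = concat (map (\<lambda>i. vertices (rename (h i) (fst (vertices \<Gamma> ! i)))) [0..<length (vertices \<Gamma>)])"
    "\<forall>i < length (vertices \<Gamma>). case vertices \<Gamma> ! i of (G, vo, vi) \<Rightarrow>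
        map (h i) (outs G) = map f vo \<and> map (h i) (ins G) = map f vi"
    unfolding is_flattening_def by blast
  have "list_all2 (inserts f) (vertices \<Gamma>) (map (\<lambda>i. vertices (rename (h i) (fst (vertices \<Gamma> ! i)))) [0..<length (vertices \<Gamma>)])"
    using *(5) by (fastforce simp: list_all2_conv_all_nth inserts_def split: prod.splits)
  with * show "wf_dgraph H \<and> (\<exists>f bs. outs H = map f (outs \<Gamma>) \<and> ins H = map f (ins \<Gamma>)
     \<and> vertices H = concat bs \<and> list_all2 (inserts f) (vertices \<Gamma>) bs)" by blast
next
  assume "wf_dgraph H \<and> (\<exists>f bs. outs H = map f (outs \<Gamma>) \<and> ins H = map f (ins \<Gamma>)
     \<and> vertices H = concat bs \<and> list_all2 (inserts f) (vertices \<Gamma>) bs)"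
  then obtain f bs where *: "wf_dgraph H" "outs H = map f (outs \<Gamma>)" "ins H = map f (ins \<Gamma>)"
    "vertices H = concat bs" "list_all2 (inserts f) (vertices \<Gamma>) bs"
    by blast
  let ?n = "length (vertices \<Gamma>)"
  define P where "P i h \<longleftrightarrow> (case vertices \<Gamma> ! i of (G, vo, vi) \<Rightarrow> bs ! i = vertices (rename h G) \<and>
      map h (outs G) = map f vo \<and> map h (ins G) = map f vi)" for i h
  have "\<exists>h. P i h" if "i < ?n" for i
    using list_all2_nthD[OF *(5) that] by (auto simp: inserts_def P_def split: prod.splits)
  then have "\<forall>i\<in>{..<?n}. \<exists>h. P i h" by simp
  from bchoice[OF this] obtain h where h: "\<And>i. i < ?n \<Longrightarrow> P i (h i)" by auto
  have "bs = map (\<lambda>i. vertices (rename (h i) (fst (vertices \<Gamma> ! i)))) [0..<?n]"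
  proof (rule nth_equalityI)
    show len: "length bs = length (map (\<lambda>i. vertices (rename (h i) (fst (vertices \<Gamma> ! i)))) [0..<?n])"
      using *(5) by (simp add: list_all2_lengthD)
    fix i assume "i < length bs"
    with len h[of i] show "bs ! i = map (\<lambda>i. vertices (rename (h i) (fst (vertices \<Gamma> ! i)))) [0..<?n] ! i"
      by (auto simp: P_def split: prod.splits)
  qed
  moreover have "\<forall>i < ?n. case vertices \<Gamma> ! i of (G, vo, vi) \<Rightarrow>
        map (h i) (outs G) = map f vo \<and> map (h i) (ins G) = map f vi"
    using h by (fastforce simp: P_def split: prod.splits)
  ultimately show "is_flattening \<Gamma> H"
    unfolding is_flattening_def using * by blast
qed

text \<open>
  Connectedness enters only in the extension of this locale below.  An outgoing edge at every vertex
  is what makes the minimum in \<open>level\<close> meaningful.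
\<close>

locale gluing =
  fixes \<Gamma> :: "'x dgraph dgraph"
  assumes wf: "wf_dgraph \<Gamma>" and acyclic_flow: "acyclic (flow \<Gamma>)"
    and pieces: "\<And>G vo vi. (G, vo, vi) \<in> set (vertices \<Gamma>) \<Longrightarrow>
      wf_dgraph G \<and> vo \<noteq> [] \<and> length (outs G) = length vo \<and> length (ins G) = length vi"
begin

definition size :: nat where "size = length (vertices \<Gamma>)"
definition piece :: "nat \<Rightarrow> 'x dgraph" where "piece i = fst (vertices \<Gamma> ! i)"
definition vout :: "nat \<Rightarrow> nat list" where "vout i = fst (snd (vertices \<Gamma> ! i))"
definition vin :: "nat \<Rightarrow> nat list" where "vin i = snd (snd (vertices \<Gamma> ! i))"

lemma vertex_eq: "vertices \<Gamma> ! i = (piece i, vout i, vin i)"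
  by (simp add: piece_def vout_def vin_def)

lemma vertex_in: "i < size \<Longrightarrow> (piece i, vout i, vin i) \<in> set (vertices \<Gamma>)"
  using vertex_eq[of i] nth_mem[of i "vertices \<Gamma>"] by (simp add: size_def)

lemma vertices_eq: "vertices \<Gamma> = map (\<lambda>i. (piece i, vout i, vin i)) [0..<size]"
  by (rule nth_equalityI) (simp_all add: size_def vertex_eq)

lemma vertex_mem: "v \<in> set (vertices \<Gamma>) \<longleftrightarrow> (\<exists>i<size. v = (piece i, vout i, vin i))"
  by (subst vertices_eq) auto

lemma piece_wf: "i < size \<Longrightarrow> wf_dgraph (piece i)"
  and vout_ne: "i < size \<Longrightarrow> vout i \<noteq> []"
  and length_outs: "i < size \<Longrightarrow> length (outs (piece i)) = length (vout i)"
  and length_ins: "i < size \<Longrightarrow> length (ins (piece i)) = length (vin i)"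
  using pieces vertex_in by blast+

text \<open>
  The disjoint union of the edges of \<open>\<Gamma>\<close>, tagged by \<open>0\<close>, and of the edges of the \<open>i\<close>-th inserted graph,
  tagged by \<open>Suc i\<close>.
\<close>

definition ends :: "(nat \<times> nat) set" where
  "ends = {0} \<times> edges \<Gamma> \<union> (\<Union>i<size. {Suc i} \<times> edges (piece i))"

text \<open>
  The pairs to be identified, directed against the flow: an edge leaving the \<open>i\<close>-th vertex of \<open>\<Gamma>\<close> comes
  from an output of the inserted graph, and an input of that graph comes from an edge entering the
  vertex.
\<close>

definition upstream :: "((nat \<times> nat) \<times> (nat \<times> nat)) set" where
  "upstream = {((0, vout i ! k), (Suc i, outs (piece i) ! k)) | i k. i < size \<and> k < length (vout i)}
     \<union> {((Suc i, ins (piece i) ! k), (0, vin i ! k)) | i k. i < size \<and> k < length (vin i)}"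

definition inner_outs :: "nat \<Rightarrow> nat list" where
  "inner_outs i = concat (map (\<lambda>(x, vo, vi). vo) (vertices (piece i)))"

definition inner_ins :: "nat \<Rightarrow> nat list" where
  "inner_ins i = concat (map (\<lambda>(x, vo, vi). vi) (vertices (piece i)))"

text \<open>
  The places at which an edge of the composite can start: the inputs of \<open>\<Gamma>\<close> and the outgoing edges
  of the inserted vertices.  They are listed in the order in which \<^const>\<open>edge_sources\<close> lists the edges
  of the composite.
\<close>

definition sources :: "(nat \<times> nat) list" where
  "sources = map (Pair 0) (ins \<Gamma>) @ concat (map (\<lambda>i. map (Pair (Suc i)) (inner_outs i)) [0..<size])"

definition targets :: "(nat \<times> nat) list" where
  "targets = map (Pair 0) (outs \<Gamma>) @ concat (map (\<lambda>i. map (Pair (Suc i)) (inner_ins i)) [0..<size])"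

lemma edge_sources_eq: "edge_sources \<Gamma> = ins \<Gamma> @ concat (map vout [0..<size])"
  unfolding edge_sources_def by (subst vertices_eq) (simp add: comp_def)

lemma edge_targets_eq: "edge_targets \<Gamma> = outs \<Gamma> @ concat (map vin [0..<size])"
  unfolding edge_targets_def by (subst vertices_eq) (simp add: comp_def)

lemma piece_sources: "edge_sources (piece i) = ins (piece i) @ inner_outs i"
  by (simp add: edge_sources_def inner_outs_def)

lemma piece_targets: "edge_targets (piece i) = outs (piece i) @ inner_ins i"
  by (simp add: edge_targets_def inner_ins_def)

text \<open>
  An entry of a list of lists without repetitions determines its position.  Equal rows at
  different positions must be empty.
\<close>

lemma distinct_concat_unique:
  assumes "distinct (concat (map g [0..<n]))" "i < n" "j < n" "k < length (g i)" "l < length (g j)"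
    "g i ! k = g j ! l"
  shows "i = j \<and> k = l"
proof -
  have "i = j"
  proof (rule ccontr)
    assume "i \<noteq> j"
    have "set (g i) \<inter> set (g j) = {}"
    proof (cases "g i = g j")
      case True
      have "distinct (removeAll [] (map g [0..<n]))" using assms(1) by (simp add: distinct_concat_iff)
      have "filter (\<lambda>x. x \<noteq> []) (map g [0..<n]) = map g (filter (\<lambda>i. g i \<noteq> []) [0..<n])"
        by (simp add: filter_map comp_def)
      moreover have "distinct (filter (\<lambda>x. x \<noteq> []) (map g [0..<n]))"
        using assms(1) by (simp add: distinct_concat_iff removeAll_filter_not_eq)
          (metis (mono_tags, lifting) filter_cong)
      ultimately have "inj_on g (set (filter (\<lambda>i. g i \<noteq> []) [0..<n]))" by (simp only: distinct_map)
      with \<open>i \<noteq> j\<close> True assms show ?thesis by (auto simp: inj_on_def)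
    next
      case False
      with assms show ?thesis by (auto simp: distinct_concat_iff)
    qed
    with assms show False using nth_mem by fastforce
  qed
  moreover have "distinct (g i)"
    using assms by (auto simp: distinct_concat_iff)
  ultimately show ?thesis using assms by (simp add: nth_eq_iff_index_eq)
qed

lemma vout_unique: "\<lbrakk>i < size; j < size; k < length (vout i); l < length (vout j); vout i ! k = vout j ! l\<rbrakk>
    \<Longrightarrow> i = j \<and> k = l"
  using wf by (intro distinct_concat_unique) (simp_all add: wf_dgraph_def edge_sources_eq)

lemma vin_unique: "\<lbrakk>i < size; j < size; k < length (vin i); l < length (vin j); vin i ! k = vin j ! l\<rbrakk>
    \<Longrightarrow> i = j \<and> k = l"
  using wf by (intro distinct_concat_unique) (simp_all add: wf_dgraph_def edge_targets_eq)

lemma outs_unique: "\<lbrakk>i < size; k < length (vout i); l < length (vout i); outs (piece i) ! k = outs (piece i) ! l\<rbrakk> \<Longrightarrow> k = l"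
  using piece_wf[of i] length_outs[of i] by (simp add: wf_dgraph_def piece_targets nth_eq_iff_index_eq)

lemma ins_unique: "\<lbrakk>i < size; k < length (vin i); l < length (vin i); ins (piece i) ! k = ins (piece i) ! l\<rbrakk> \<Longrightarrow> k = l"
  using piece_wf[of i] length_ins[of i] by (simp add: wf_dgraph_def piece_sources nth_eq_iff_index_eq)

lemma single_valued_upstream: "single_valued upstream"
  by (rule single_valuedI) (auto simp: upstream_def dest: vout_unique ins_unique)

lemma single_valued_upstream_converse: "single_valued (upstream\<inverse>)"
  by (rule single_valuedI) (auto simp: upstream_def dest: vin_unique outs_unique)

lemma finite_ends: "finite ends"
  by (simp add: ends_def)

lemma vout_edges: "i < size \<Longrightarrow> set (vout i) \<subseteq> edges \<Gamma>"
  and vin_edges: "i < size \<Longrightarrow> set (vin i) \<subseteq> edges \<Gamma>"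
  using edges_vertex[OF vertex_in] by simp_all

lemma upstream_ends: "upstream \<subseteq> ends \<times> ends"
proof -
  have "outs (piece i) ! k \<in> edges (piece i)" if "i < size" "k < length (vout i)" for i k
    using edges_outs[of "piece i"] length_outs[of i] that by (auto simp: nth_mem)
  moreover have "ins (piece i) ! k \<in> edges (piece i)" if "i < size" "k < length (vin i)" for i k
    using edges_ins[of "piece i"] length_ins[of i] that by (auto simp: nth_mem)
  moreover have "vout i ! k \<in> edges \<Gamma>" if "i < size" "k < length (vout i)" for i k
    using vout_edges[of i] that by (auto simp: nth_mem)
  moreover have "vin i ! k \<in> edges \<Gamma>" if "i < size" "k < length (vin i)" for i k
    using vin_edges[of i] that by (auto simp: nth_mem)
  ultimately show ?thesis by (auto simp: upstream_def ends_def)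
qed

lemma finite_upstream: "finite upstream"
  using upstream_ends finite_ends by (meson finite_SigmaI finite_subset)

lemma Domain_upstream:
  "(0, e) \<in> Domain upstream \<longleftrightarrow> (\<exists>i<size. e \<in> set (vout i))"
  "(Suc i, x) \<in> Domain upstream \<longleftrightarrow> i < size \<and> x \<in> set (ins (piece i))"
  using length_ins by (auto simp: upstream_def in_set_conv_nth Domain_iff)

lemma Range_upstream:
  "(0, e) \<in> Range upstream \<longleftrightarrow> (\<exists>i<size. e \<in> set (vin i))"
  "(Suc i, x) \<in> Range upstream \<longleftrightarrow> i < size \<and> x \<in> set (outs (piece i))"
  using length_outs by (auto simp: upstream_def in_set_conv_nth Range_iff)

text \<open>
  A chain ends exactly at a source: an edge of a well-formed graph starts either at an input or at a
  vertex.
\<close>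

lemma set_sources: "set sources = ends - Domain upstream"
proof -
  have *: "(a, e) \<in> set sources \<longleftrightarrow> (a, e) \<in> ends \<and> (a, e) \<notin> Domain upstream" for a e
  proof (cases a)
    case 0
    have "(0, e) \<in> set sources \<longleftrightarrow> e \<in> set (ins \<Gamma>)" "(0, e) \<in> ends \<longleftrightarrow> e \<in> edges \<Gamma>"
      by (auto simp: sources_def ends_def)
    moreover have "set (ins \<Gamma>) \<inter> (\<Union>i<size. set (vout i)) = {}"
      "edges \<Gamma> = set (ins \<Gamma>) \<union> (\<Union>i<size. set (vout i))"
      using wf edges_wf(1)[OF wf] by (auto simp: wf_dgraph_def edge_sources_eq atLeast0LessThan)
    ultimately show ?thesis using 0 by (auto simp: Domain_upstream)
  next
    case (Suc i)
    then show ?thesis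
      using piece_wf[of i] edges_wf(1)[of "piece i"]
      by (auto simp: Domain_upstream image_iff wf_dgraph_def piece_sources sources_def ends_def)
  qed
  then show ?thesis by auto
qed

lemma set_targets: "set targets = ends - Range upstream"
proof -
  have *: "(a, e) \<in> set targets \<longleftrightarrow> (a, e) \<in> ends \<and> (a, e) \<notin> Range upstream" for a e
  proof (cases a)
    case 0
    have "(0, e) \<in> set targets \<longleftrightarrow> e \<in> set (outs \<Gamma>)" "(0, e) \<in> ends \<longleftrightarrow> e \<in> edges \<Gamma>"
      by (auto simp: targets_def ends_def)
    moreover have "set (outs \<Gamma>) \<inter> (\<Union>i<size. set (vin i)) = {}"
      "edges \<Gamma> = set (outs \<Gamma>) \<union> (\<Union>i<size. set (vin i))"
      using wf edges_wf(2)[OF wf] by (auto simp: wf_dgraph_def edge_targets_eq atLeast0LessThan)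
    ultimately show ?thesis using 0 by (auto simp: Range_upstream)
  next
    case (Suc i)
    then show ?thesis
      using piece_wf[of i] edges_wf(2)[of "piece i"]
      by (auto simp: Range_upstream image_iff wf_dgraph_def piece_targets targets_def ends_def)
  qed
  then show ?thesis by auto
qed

lemma distinct_concat_tagged:
  "(\<And>i. i \<in> set is \<Longrightarrow> distinct (g i)) \<Longrightarrow> distinct is \<Longrightarrow>
    distinct (concat (map (\<lambda>i. map (Pair (Suc i)) (g i)) is))"
  by (induction "is") (auto simp: distinct_map inj_on_def)

lemma distinct_sources: "distinct sources"
  unfolding sources_def distinct_append
proof (intro conjI)
  show "distinct (concat (map (\<lambda>i. map (Pair (Suc i)) (inner_outs i)) [0..<size]))"
    using piece_wf by (intro distinct_concat_tagged) (auto simp: wf_dgraph_def piece_sources)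
qed (use wf in \<open>auto simp: wf_dgraph_def edge_sources_eq distinct_map inj_on_def\<close>)

lemma distinct_targets: "distinct targets"
  unfolding targets_def distinct_append
proof (intro conjI)
  show "distinct (concat (map (\<lambda>i. map (Pair (Suc i)) (inner_ins i)) [0..<size]))"
    using piece_wf by (intro distinct_concat_tagged) (auto simp: wf_dgraph_def piece_targets)
qed (use wf in \<open>auto simp: wf_dgraph_def edge_targets_eq distinct_map inj_on_def\<close>)

text \<open>
  A rank function \<open>\<rho>\<close> of \<open>\<Gamma>\<close> extended to the inserted graphs: all their edges get the smallest rank of an
  edge leaving the vertex, which is larger than that of every edge entering it.
\<close>

definition level :: "(nat \<Rightarrow> nat) \<Rightarrow> nat \<times> nat \<Rightarrow> nat" where
  "level \<rho> = (\<lambda>(a, e). case a of 0 \<Rightarrow> \<rho> e | Suc i \<Rightarrow> Min (\<rho> ` set (vout i)))"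

lemma level_upstream:
  assumes \<rho>: "\<And>e e'. (e, e') \<in> flow \<Gamma> \<Longrightarrow> \<rho> e < \<rho> e'" and "(x, y) \<in> upstream"
  shows "level \<rho> y \<le> level \<rho> x" "fst x \<noteq> 0 \<Longrightarrow> level \<rho> y < level \<rho> x"
proof -
  have *: "\<rho> e < \<rho> e'" if "i < size" "e \<in> set (vin i)" "e' \<in> set (vout i)" for i e e'
    using \<rho>[of e e'] that vertex_in[of i] by (fastforce simp: flow_def)
  have "\<rho> e < Min (\<rho> ` set (vout i))" if "i < size" "e \<in> set (vin i)" for i e
    using that vout_ne * by simp
  then have "level \<rho> y \<le> level \<rho> x \<and> (fst x \<noteq> 0 \<longrightarrow> level \<rho> y < level \<rho> x)"
    using assms(2) vout_ne by (auto simp: upstream_def level_def intro: less_imp_le)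
  then show "level \<rho> y \<le> level \<rho> x" "fst x \<noteq> 0 \<Longrightarrow> level \<rho> y < level \<rho> x" by auto
qed

lemma obtain_rank: obtains \<rho> :: "nat \<Rightarrow> nat" where "\<And>e e'. (e, e') \<in> flow \<Gamma> \<Longrightarrow> \<rho> e < \<rho> e'"
  using finite_acyclic_rank[OF finite_flow acyclic_flow] by blast

lemma acyclic_upstream: "acyclic upstream"
proof -
  obtain \<rho> :: "nat \<Rightarrow> nat" where \<rho>: "\<And>e e'. (e, e') \<in> flow \<Gamma> \<Longrightarrow> \<rho> e < \<rho> e'"
    by (rule obtain_rank) blast
  \<comment> \<open>The step from an edge of the outer graph into an inserted graph may preserve the level; the parity makes it decrease.\<close>
  let ?m = "\<lambda>x. 2 * level \<rho> x + (if fst x = 0 then 1 else 0)"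
  have "(x, y) \<in> (measure ?m)\<inverse>" if xy: "(x, y) \<in> upstream" for x y
  proof -
    have "fst x = 0 \<longrightarrow> fst y \<noteq> 0" using xy by (auto simp: upstream_def)
    then show ?thesis using level_upstream(1)[of \<rho> x y] level_upstream(2)[of \<rho> x y] \<rho> xy by auto
  qed
  then have "upstream \<subseteq> (measure ?m)\<inverse>" by auto
  moreover have "acyclic ((measure ?m)\<inverse>)"
    by (simp add: wf_acyclic)
  ultimately show ?thesis using acyclic_subset by blast
qed

lemmas chains = partial_injection_chains[OF finite_upstream acyclic_upstream single_valued_upstream single_valued_upstream_converse]

text \<open>
  Representatives of the classes of glued edges.
\<close>

definition origin :: "nat \<times> nat \<Rightarrow> nat \<times> nat" where
  "origin x = (THE s. (x, s) \<in> upstream\<^sup>* \<and> s \<notin> Domain upstream)"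

lemma origin: "(x, origin x) \<in> upstream\<^sup>*" "origin x \<notin> Domain upstream"
proof -
  have "\<exists>!s. (x, s) \<in> upstream\<^sup>* \<and> s \<notin> Domain upstream"
    using chains(1)[of x] chains(3)[of x] by blast
  from theI'[OF this] show "(x, origin x) \<in> upstream\<^sup>*" "origin x \<notin> Domain upstream"
    by (auto simp: origin_def)
qed

lemma origin_eqI: "(x, s) \<in> upstream\<^sup>* \<Longrightarrow> s \<notin> Domain upstream \<Longrightarrow> origin x = s"
  using chains(3) origin by blast

lemma origin_upstream: "(x, y) \<in> upstream \<Longrightarrow> origin x = origin y"
  by (rule origin_eqI) (use origin[of y] in \<open>auto intro: converse_rtrancl_into_rtrancl\<close>)

lemma rtrancl_upstream_ends: "(x, y) \<in> upstream\<^sup>* \<Longrightarrow> x \<in> ends \<longleftrightarrow> y \<in> ends"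
  by (induction rule: rtrancl_induct) (use upstream_ends in auto)

lemma origin_in_sources: "x \<in> ends \<Longrightarrow> origin x \<in> set sources"
  using origin[of x] rtrancl_upstream_ends by (auto simp: set_sources)

lemma origin_source: "x \<in> set sources \<Longrightarrow> origin x = x"
  by (rule origin_eqI) (auto simp: set_sources)

lemma inj_on_origin_targets: "inj_on origin (set targets)"
proof (rule inj_onI)
  fix x y assume "x \<in> set targets" "y \<in> set targets" "origin x = origin y"
  then show "x = y"
    using chains(4)[of x "origin y" y] origin(1)[of x] origin(1)[of y] by (simp add: set_targets)
qed

text \<open>
  Every chain has a beginning, and only one.  So the composite has as many targets as sources and
  its edges can be numbered by either.
\<close>

lemma origin_targets: "origin ` set targets = set sources"
proof (intro equalityI subsetI)
  fix s assume s: "s \<in> set sources"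
  obtain t where t: "(t, s) \<in> upstream\<^sup>*" "t \<notin> Range upstream" using chains(2)[of s] by blast
  have "origin t = s" using t s by (intro origin_eqI) (auto simp: set_sources)
  moreover have "t \<in> set targets" using t s rtrancl_upstream_ends[of t s] by (auto simp: set_targets set_sources)
  ultimately show "s \<in> origin ` set targets" by blast
qed (auto intro: origin_in_sources simp: set_targets)

section \<open>Existence and universal property of composites\<close>

definition glued :: "(nat \<Rightarrow> nat) \<Rightarrow> (nat \<Rightarrow> nat \<Rightarrow> nat) \<Rightarrow> nat \<times> nat \<Rightarrow> nat" where
  "glued f h = (\<lambda>(a, e). case a of 0 \<Rightarrow> f e | Suc i \<Rightarrow> h i e)"

definition compatible :: "(nat \<Rightarrow> nat) \<Rightarrow> (nat \<Rightarrow> nat \<Rightarrow> nat) \<Rightarrow> bool" where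
  "compatible f h \<longleftrightarrow> (\<forall>i<size. map (h i) (outs (piece i)) = map f (vout i)
     \<and> map (h i) (ins (piece i)) = map f (vin i))"

definition glue :: "(nat \<Rightarrow> nat) \<Rightarrow> (nat \<Rightarrow> nat \<Rightarrow> nat) \<Rightarrow> 'x dgraph" where
  "glue f h = DGraph (concat (map (\<lambda>i. vertices (rename (h i) (piece i))) [0..<size]))
     (map f (outs \<Gamma>)) (map f (ins \<Gamma>))"

text \<open>
  A composite is determined by its compatible pair of renamings; it remains to see which pairs give a
  well-formed graph.
\<close>

lemma is_flattening_iff_glue:
  "is_flattening \<Gamma> H \<longleftrightarrow> (\<exists>f h. compatible f h \<and> H = glue f h \<and> wf_dgraph H)"
proof -
  have *: "H = glue f h \<longleftrightarrow> outs H = map f (outs \<Gamma>) \<and> ins H = map f (ins \<Gamma>) \<and>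
    vertices H = concat (map (\<lambda>i. vertices (rename (h i) (piece i))) [0..<size])" for f h
    by (cases H) (auto simp: glue_def)
  show ?thesis unfolding is_flattening_def *
    by (auto simp: compatible_def vertex_eq simp flip: piece_def size_def)
qed

lemma compatible_upstream: "compatible f h \<Longrightarrow> (x, y) \<in> upstream \<Longrightarrow> glued f h x = glued f h y"
  using length_outs length_ins
  by (auto simp: upstream_def glued_def compatible_def list_eq_iff_nth_eq)

lemma compatible_origin: "compatible f h \<Longrightarrow> glued f h (origin x) = glued f h x"
proof -
  assume c: "compatible f h"
  have "(x, y) \<in> upstream\<^sup>* \<Longrightarrow> glued f h y = glued f h x" for y
    by (induction rule: rtrancl_induct) (use compatible_upstream[OF c] in auto)
  with origin(1) show ?thesis by blast
qed

lemma edge_sources_glue: "edge_sources (glue f h) = map (glued f h) sources"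
proof -
  have *: "concat (map (\<lambda>(x, vo, vi). vo) (concat (map (\<lambda>i. vertices (rename (h i) (piece i))) is)))
    = map (glued f h) (concat (map (\<lambda>i. map (Pair (Suc i)) (inner_outs i)) is))" for "is"
    by (induction "is") (simp_all add: inner_outs_def glued_def map_concat comp_def case_prod_beta')
  show ?thesis
    by (simp add: edge_sources_def glue_def sources_def * del: rename_simps) (simp add: glued_def)
qed

lemma edge_targets_glue: "edge_targets (glue f h) = map (glued f h) targets"
proof -
  have *: "concat (map (\<lambda>(x, vo, vi). vi) (concat (map (\<lambda>i. vertices (rename (h i) (piece i))) is)))
    = map (glued f h) (concat (map (\<lambda>i. map (Pair (Suc i)) (inner_ins i)) is))" for "is"
    by (induction "is") (simp_all add: inner_ins_def glued_def map_concat comp_def case_prod_beta')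
  show ?thesis
    by (simp add: edge_targets_def glue_def targets_def * del: rename_simps) (simp add: glued_def)
qed

text \<open>
  Name each edge after the source of its chain.  Sources then get distinct names, and so do targets
  because a chain has only one.
\<close>

theorem flattening_exists: "\<exists>H. is_flattening \<Gamma> H"
proof -
  define f where "f e = prod_encode (origin (0, e))" for e
  define h where "h i e = prod_encode (origin (Suc i, e))" for i e
  have glued: "glued f h x = prod_encode (origin x)" for x
    by (cases x) (auto simp: glued_def f_def h_def split: nat.splits)
  have "compatible f h"
    unfolding compatible_def
  proof (intro allI impI conjI)
    fix i assume i: "i < size"
    show "map (h i) (outs (piece i)) = map f (vout i)"
    proof (rule nth_equalityI)
      fix k assume k: "k < length (map (h i) (outs (piece i)))"
      then have "((0, vout i ! k), (Suc i, outs (piece i) ! k)) \<in> upstream"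
        using i length_outs[OF i] by (auto simp: upstream_def)
      from origin_upstream[OF this] k show "map (h i) (outs (piece i)) ! k = map f (vout i) ! k"
        using length_outs[OF i] by (simp add: f_def h_def)
    qed (simp add: length_outs[OF i])
    show "map (h i) (ins (piece i)) = map f (vin i)"
    proof (rule nth_equalityI)
      fix k assume k: "k < length (map (h i) (ins (piece i)))"
      then have "((Suc i, ins (piece i) ! k), (0, vin i ! k)) \<in> upstream"
        using i length_ins[OF i] by (auto simp: upstream_def)
      from origin_upstream[OF this] k show "map (h i) (ins (piece i)) ! k = map f (vin i) ! k"
        using length_ins[OF i] by (simp add: f_def h_def)
    qed (simp add: length_ins[OF i])
  qed
  moreover have "wf_dgraph (glue f h)"
  proof -
    have "inj_on (glued f h) (set sources)"
      unfolding glued by (auto simp: inj_on_def origin_source)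
    moreover have "inj_on (glued f h) (set targets)"
      unfolding glued using inj_on_origin_targets by (auto simp: inj_on_def)
    moreover have "glued f h ` set sources = glued f h ` set targets"
      unfolding glued using origin_targets origin_source by (metis (no_types, lifting) image_cong image_image)
    ultimately show ?thesis
      using distinct_sources distinct_targets
      by (simp add: wf_dgraph_def edge_sources_glue edge_targets_glue distinct_map)
  qed
  ultimately show ?thesis using is_flattening_iff_glue by blast
qed

lemma glued_inj_on_sources: "wf_dgraph (glue f h) \<Longrightarrow> inj_on (glued f h) (set sources)"
  by (simp add: wf_dgraph_def edge_sources_glue distinct_map)

lemma edges_glue:
  assumes "compatible f h" "wf_dgraph (glue f h)"
  shows "edges (glue f h) = glued f h ` ends"
proof -
  have "edges (glue f h) = glued f h ` set sources"
    using edges_wf(1)[OF assms(2)] by (simp add: edge_sources_glue)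
  also have "\<dots> = glued f h ` ends"
  proof
    show "glued f h ` set sources \<subseteq> glued f h ` ends" by (auto simp: set_sources)
    show "glued f h ` ends \<subseteq> glued f h ` set sources"
    proof
      fix e assume "e \<in> glued f h ` ends"
      then obtain x where "x \<in> ends" "e = glued f h (origin x)"
        using compatible_origin[OF assms(1)] by auto
      then show "e \<in> glued f h ` set sources" using origin_in_sources by auto
    qed
  qed
  finally show ?thesis .
qed

text \<open>
  In a well-formed composite different sources are different edges.  So an edge of the composite
  determines the source of the chain, and any other compatible pair is constant along that chain.
\<close>

theorem glue_universal:
  assumes c: "compatible f h" and wf_glue: "wf_dgraph (glue f h)" and c': "compatible f' h'"
  obtains k where "\<And>x. x \<in> ends \<Longrightarrow> glued f' h' x = k (glued f h x)"
proof
  fix x assume x: "x \<in> ends"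
  let ?k = "\<lambda>e. glued f' h' (the_inv_into (set sources) (glued f h) e)"
  have "?k (glued f h x) = ?k (glued f h (origin x))"
    using compatible_origin[OF c] by simp
  also have "\<dots> = glued f' h' (origin x)"
    using the_inv_into_f_f[OF glued_inj_on_sources[OF wf_glue] origin_in_sources[OF x]] by simp
  also have "\<dots> = glued f' h' x"
    using compatible_origin[OF c'] by simp
  finally show "glued f' h' x = ?k (glued f h x)" by simp
qed

lemma rename_glue:
  assumes "\<And>x. x \<in> ends \<Longrightarrow> glued f' h' x = k (glued f h x)"
  shows "rename k (glue f h) = glue f' h'"
proof -
  have f: "f' e = k (f e)" if "e \<in> edges \<Gamma>" for e
    using assms[of "(0, e)"] that by (simp add: ends_def glued_def)
  have h: "h' i e = k (h i e)" if "i < size" "e \<in> edges (piece i)" for i e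
    using assms[of "(Suc i, e)"] that by (simp add: ends_def glued_def)
  have 1: "map f' (outs \<Gamma>) = map (k \<circ> f) (outs \<Gamma>)" "map f' (ins \<Gamma>) = map (k \<circ> f) (ins \<Gamma>)"
    using f edges_outs[of \<Gamma>] edges_ins[of \<Gamma>] by (auto simp: subset_iff)
  have 2: "rename (h' i) (piece i) = rename k (rename (h i) (piece i))" if "i < size" for i
    unfolding rename_rename using h[OF that] by (intro rename_cong) simp
  have 3: "map (\<lambda>i. vertices (rename k (rename (h i) (piece i)))) [0..<size]
      = map (\<lambda>i. vertices (rename (h' i) (piece i))) [0..<size]"
    using 2 by (intro map_cong) auto
  have 4: "rename k (DGraph (concat (map (\<lambda>i. vertices (rename (h i) (piece i))) is)) os as)
      = DGraph (concat (map (\<lambda>i. vertices (rename k (rename (h i) (piece i)))) is)) (map k os) (map k as)"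
    for "is" os as
    by (simp add: rename_def map_concat comp_def)
  show ?thesis
    unfolding glue_def 4 3 by (simp add: 1)
qed

text \<open>
  The comparison map of the universal property is automatically injective because the target of the
  comparison is well-formed.
\<close>

theorem flattening_unique:
  assumes "is_flattening \<Gamma> H" "is_flattening \<Gamma> H'"
  shows "\<exists>k. inj_on k (edges H) \<and> H' = rename k H"
proof -
  obtain f h f' h' where *: "compatible f h" "H = glue f h" "wf_dgraph H"
    "compatible f' h'" "H' = glue f' h'" "wf_dgraph H'"
    using assms unfolding is_flattening_iff_glue by blast
  have "wf_dgraph (glue f h)" using * by simp
  from glue_universal[OF *(1) this *(4)]
  obtain k where k: "\<And>x. x \<in> ends \<Longrightarrow> glued f' h' x = k (glued f h x)" by blast
  have "H' = rename k H" using rename_glue[of f' h' k f h] k * by simp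
  then show ?thesis using wf_rename_iff[of H k] * by auto
qed

end

locale connected_gluing = gluing +
  assumes connected: "connected_dag \<Gamma>"
    and connected_pieces: "\<And>G vo vi. (G, vo, vi) \<in> set (vertices \<Gamma>) \<Longrightarrow> connected_dag G"
begin

lemma piece_connected: "i < size \<Longrightarrow> connected_dag (piece i)"
  using connected_pieces vertex_in by blast

lemma flow_glue:
  "flow (glue f h) = (\<Union>i<size. map_prod (h i) (h i) ` flow (piece i))"
proof -
  have "(e, e') \<in> flow (glue f h) \<longleftrightarrow> (\<exists>i<size. (e, e') \<in> flow (rename (h i) (piece i)))" for e e'
    by (simp add: flow_def glue_def atLeast0LessThan Bex_def del: rename_simps) blast
  then show ?thesis by (simp add: set_eq_iff flow_rename lessThan_def)
qed

lemma adjacent_glue: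
  "adjacent (glue f h) = (\<Union>i<size. map_prod (h i) (h i) ` adjacent (piece i))"
proof -
  have "(e, e') \<in> adjacent (glue f h) \<longleftrightarrow> (\<exists>i<size. (e, e') \<in> adjacent (rename (h i) (piece i)))" for e e'
    by (simp add: adjacent_def glue_def atLeast0LessThan Bex_def del: rename_simps) blast
  then show ?thesis by (simp add: set_eq_iff adjacent_rename lessThan_def)
qed

text \<open>
  Along a flow step inside an inserted graph, the pair of the level and of the rank inside that graph
  increases lexicographically when edges are measured at their sources.  If the edge entering the
  vertex comes from outside the inserted graph, its chain continues upstream to a lower level; if not,
  the level stays the same and the inner rank increases.
\<close>

lemma acyclic_glue:
  assumes c: "compatible f h" and wf_glue: "wf_dgraph (glue f h)"
  shows "acyclic (flow (glue f h))"
proof -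
  obtain \<rho> :: "nat \<Rightarrow> nat" where \<rho>: "\<And>e e'. (e, e') \<in> flow \<Gamma> \<Longrightarrow> \<rho> e < \<rho> e'"
    by (rule obtain_rank) blast
  have "\<exists>\<sigma>::nat \<Rightarrow> nat. \<forall>e e'. (e, e') \<in> flow (piece i) \<longrightarrow> \<sigma> e < \<sigma> e'" if "i < size" for i
  proof -
    have "acyclic (flow (piece i))" using piece_connected[OF that] by (simp add: connected_dag_def)
    from finite_acyclic_rank[OF finite_flow this] show ?thesis by metis
  qed
  then obtain \<sigma> :: "nat \<Rightarrow> nat \<Rightarrow> nat" where
    \<sigma>: "\<And>i e e'. i < size \<Longrightarrow> (e, e') \<in> flow (piece i) \<Longrightarrow> \<sigma> i e < \<sigma> i e'"
    by metis
  \<comment> \<open>The source of an edge of the composite; well-formedness makes it unique.\<close>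
  define start where "start e = the_inv_into (set sources) (glued f h) e" for e
  have start: "start (glued f h x) = origin x" if "x \<in> ends" for x
    using the_inv_into_f_f[OF glued_inj_on_sources[OF wf_glue] origin_in_sources[OF that]]
      compatible_origin[OF c, of x] by (simp add: start_def)
  define rank where "rank s = (level \<rho> s, case fst s of 0 \<Rightarrow> 0 | Suc i \<Rightarrow> \<sigma> i (snd s))" for s
  have level_mono: "(x, y) \<in> upstream\<^sup>* \<Longrightarrow> level \<rho> y \<le> level \<rho> x" for x y
    by (induction rule: rtrancl_induct) (use level_upstream(1)[of \<rho>] \<rho> in force)+
  have step: "(rank (start e), rank (start e')) \<in> less_than <*lex*> less_than"
    if ee': "(e, e') \<in> flow (glue f h)" for e e'
  proof -
    obtain i a b where i: "i < size" and ab: "(a, b) \<in> flow (piece i)" "e = h i a" "e' = h i b"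
      using ee' unfolding flow_glue by auto
    from ab(1) obtain x vo vi where v: "(x, vo, vi) \<in> set (vertices (piece i))" "a \<in> set vi" "b \<in> set vo"
      by (auto simp: flow_def)
    have ends: "(Suc i, a) \<in> ends" "(Suc i, b) \<in> ends"
      using i v edges_vertex[OF v(1)] by (auto simp: ends_def)
    have "b \<in> set (inner_outs i)" using v by (auto simp: inner_outs_def)
    then have "(Suc i, b) \<in> set sources" using i by (auto simp: sources_def)
    then have b: "start e' = (Suc i, b)"
      using start[OF ends(2)] by (simp add: ab glued_def origin_source)
    have a: "start e = origin (Suc i, a)"
      using start[OF ends(1)] by (simp add: ab glued_def)
    show ?thesis
    proof (cases "(Suc i, a) \<in> Domain upstream")
      case False
      then have "origin (Suc i, a) = (Suc i, a)" by (intro origin_eqI) auto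
      then show ?thesis using \<sigma>[OF i ab(1)] a b by (simp add: rank_def level_def)
    next
      case True
      then obtain y where y: "((Suc i, a), y) \<in> upstream" by auto
      have "level \<rho> (origin y) \<le> level \<rho> y" by (rule level_mono[OF origin(1)])
      also have "\<dots> < level \<rho> (Suc i, a)" using level_upstream(2)[of \<rho>, OF \<rho> y] by simp
      also have "level \<rho> (Suc i, a) = level \<rho> (Suc i, b)" by (simp add: level_def)
      finally show ?thesis using a b origin_upstream[OF y] by (simp add: rank_def)
    qed
  qed
  have "flow (glue f h) \<subseteq> inv_image (less_than <*lex*> less_than) (\<lambda>e. rank (start e))"
    using step by auto
  moreover have "wf (inv_image (less_than <*lex*> less_than) (\<lambda>e. rank (start e)))"
    by (intro wf_inv_image wf_lex_prod wf_less_than)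
  ultimately show ?thesis using wf_subset wf_acyclic by blast
qed

text \<open>
  Any two edges of one inserted graph are connected inside it.  Two adjacent edges of \<open>\<Gamma>\<close> are legs of a
  common inserted graph.  An inserted graph meets the edges of \<open>\<Gamma>\<close> because its vertex has an outgoing
  edge.
\<close>

theorem flattening_connected:
  assumes "is_flattening \<Gamma> H"
  shows "connected_dag H"
proof -
  obtain f h where c: "compatible f h" and H: "H = glue f h" and wf_H: "wf_dgraph (glue f h)"
    using assms unfolding is_flattening_iff_glue by auto
  have E: "edges H = glued f h ` ends" using edges_glue[OF c wf_H] H by simp
  have inside: "(h i a, h i b) \<in> (adjacent H)\<^sup>*" if i: "i < size" and ab: "a \<in> edges (piece i)" "b \<in> edges (piece i)" for i a b
  proof -
    have "(a, b) \<in> (adjacent (piece i))\<^sup>*" using piece_connected[OF i] ab by (simp add: connected_dag_def)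
    then show ?thesis
    proof (induction rule: rtrancl_induct)
      case (step y z)
      then have "(h i y, h i z) \<in> adjacent H" using i H by (force simp: adjacent_glue)
      with step show ?case by auto
    qed auto
  qed
  have leg: "\<exists>x\<in>edges (piece i). h i x = f e" if i: "i < size" and e: "e \<in> set (vout i) \<union> set (vin i)" for i e
  proof -
    have "f e \<in> set (map (h i) (outs (piece i))) \<union> set (map (h i) (ins (piece i)))"
      using c i e by (auto simp: compatible_def)
    then show ?thesis using edges_outs[of "piece i"] edges_ins[of "piece i"] by auto
  qed
  have outer: "(f a, f b) \<in> (adjacent H)\<^sup>*" if "a \<in> edges \<Gamma>" "b \<in> edges \<Gamma>" for a b
  proof -
    have "(a, b) \<in> (adjacent \<Gamma>)\<^sup>*" using connected that by (simp add: connected_dag_def)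
    then show ?thesis
    proof (induction rule: rtrancl_induct)
      case (step y z)
      then obtain i where i: "i < size" "y \<in> set (vout i) \<union> set (vin i)" "z \<in> set (vout i) \<union> set (vin i)"
        by (auto simp: adjacent_def vertex_mem)
      obtain y' z' where "y' \<in> edges (piece i)" "h i y' = f y" "z' \<in> edges (piece i)" "h i z' = f z"
        using leg[OF i(1,2)] leg[OF i(1,3)] by blast
      then have "(f y, f z) \<in> (adjacent H)\<^sup>*" using inside[OF i(1), of y' z'] by simp
      with step show ?case by auto
    qed auto
  qed
  have to_outer: "\<exists>a\<in>edges \<Gamma>. (e, f a) \<in> (adjacent H)\<^sup>* \<and> (f a, e) \<in> (adjacent H)\<^sup>*" if "e \<in> edges H" for e
  proof -
    obtain x where x: "x \<in> ends" "e = glued f h x" using \<open>e \<in> edges H\<close> E by auto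
    show ?thesis
    proof (cases "fst x")
      case 0
      with x show ?thesis by (auto simp: ends_def glued_def)
    next
      case (Suc i)
      with x have i: "i < size" and "snd x \<in> edges (piece i)" "e = h i (snd x)"
        by (auto simp: ends_def glued_def)
      moreover obtain a where "a \<in> set (vout i)" using vout_ne[OF i] by (cases "vout i") auto
      ultimately show ?thesis using leg[of i a] inside[of i] vout_edges[OF i] by (metis UnI1 subset_iff)
    qed
  qed
  have "(e, e') \<in> (adjacent H)\<^sup>*" if "e \<in> edges H" "e' \<in> edges H" for e e'
    using to_outer[OF that(1)] to_outer[OF that(2)] outer by (meson rtrancl_trans)
  moreover have "edges H \<noteq> {}"
    using connected E by (auto simp: connected_dag_def ends_def)
  moreover have "\<forall>(x, vo, vi) \<in> set (vertices H). vo \<noteq> []"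
    using piece_connected by (fastforce simp: H glue_def connected_dag_def)
  ultimately show ?thesis
    using acyclic_glue[OF c wf_H] wf_H by (simp add: connected_dag_def H)
qed

end

section \<open>Composites of monomials and associativity\<close>

lemma map_dgraph_simps [simp]:
  "vertices (map_dgraph f G) = map (\<lambda>(x, vo, vi). (f x, vo, vi)) (vertices G)"
  "outs (map_dgraph f G) = outs G" "ins (map_dgraph f G) = ins G"
  by (cases G; simp add: case_prod_beta' map_prod_def)+

lemma edge_sources_map_dgraph [simp]: "edge_sources (map_dgraph f G) = edge_sources G"
  by (simp add: edge_sources_def case_prod_beta' comp_def)

lemma edge_targets_map_dgraph [simp]: "edge_targets (map_dgraph f G) = edge_targets G"
  by (simp add: edge_targets_def case_prod_beta' comp_def)

lemma edges_map_dgraph [simp]: "edges (map_dgraph f G) = edges G"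
  by (simp add: edges_def)

lemma wf_map_dgraph [simp]: "wf_dgraph (map_dgraph f G) = wf_dgraph G"
  by (simp add: wf_dgraph_def)

lemma flow_map_dgraph [simp]: "flow (map_dgraph f G) = flow G"
  by (simp add: flow_def case_prod_beta')

lemma adjacent_map_dgraph [simp]: "adjacent (map_dgraph f G) = adjacent G"
  by (simp add: adjacent_def case_prod_beta')

lemma connected_dag_map_dgraph [simp]: "connected_dag (map_dgraph f G) = connected_dag G"
  by (auto simp: connected_dag_def)

lemma gluing_dagI:
  assumes "connected_dag \<Gamma>" "\<And>G vo vi. (G, vo, vi) \<in> set (vertices \<Gamma>) \<Longrightarrow>
    connected_dag G \<and> length (outs G) = length vo \<and> length (ins G) = length vi"
  shows "connected_gluing \<Gamma>"
  using assms by unfold_locales (auto simp: connected_dag_def)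

lemma connected_gluing_monomials:
  "decorated_by (monomials S) \<Gamma> \<Longrightarrow> connected_gluing \<Gamma>"
  by (rule gluing_dagI) (auto simp: decorated_by_def monomials_def)

lemma flatten_is_flattening:
  assumes "decorated_by (monomials S) \<Gamma>"
  shows "is_flattening \<Gamma> (flatten \<Gamma>)"
proof -
  interpret connected_gluing \<Gamma> by (rule connected_gluing_monomials[OF assms])
  show ?thesis unfolding flatten_def by (rule someI_ex[OF flattening_exists])
qed

lemma flattening_monomial:
  assumes "decorated_by (monomials S) \<Gamma>" "is_flattening \<Gamma> H"
  shows "H \<in> monomials S (length (outs \<Gamma>)) (length (ins \<Gamma>))"
proof -
  interpret connected_gluing \<Gamma> by (rule connected_gluing_monomials[OF assms(1)])
  obtain f h where H: "H = glue f h" using assms(2) is_flattening_iff_glue by blast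
  have "piece i \<in> monomials S (length (vout i)) (length (vin i))" if "i < size" for i
    using assms(1) vertex_in[OF that] by (auto simp: decorated_by_def)
  then have "\<forall>(g, vo, vi) \<in> set (vertices H). length vo = out_arity S g \<and> length vi = in_arity S g"
    by (fastforce simp: H glue_def monomials_def)
  then show ?thesis
    using flattening_connected[OF assms(2)] by (simp add: monomials_def H glue_def)
qed

lemma flattening_rename_unique:
  assumes "decorated_by (monomials S) \<Gamma>" "is_flattening \<Gamma> H" "is_flattening \<Gamma> H'"
  shows "\<exists>k. inj_on k (edges H) \<and> H' = rename k H"
proof -
  interpret connected_gluing \<Gamma> by (rule connected_gluing_monomials[OF assms(1)])
  show ?thesis by (rule flattening_unique[OF assms(2,3)])
qed

lemma list_all2_concatI: "list_all2 (list_all2 P) xss yss \<Longrightarrow> list_all2 P (concat xss) (concat yss)"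
  by (induction rule: list_all2_induct) (auto intro: list_all2_appendI)

lemma sum_list_concat:
  fixes xss :: "'a::comm_monoid_add list list"
  shows "sum_list (concat xss) = sum_list (map sum_list xss)"
  by (induction xss) auto

lemma concat_concat: "concat (concat xsss) = concat (map concat xsss)"
  by (induction xsss) auto

lemma prod_list_concat:
  fixes xss :: "'a::comm_monoid_mult list list"
  shows "prod_list (concat xss) = prod_list (map prod_list xss)"
  by (induction xss) auto

text \<open>
  The factor by which an assignment of scalars to generators multiplies a graph.
\<close>

definition vertex_prod :: "('g \<Rightarrow> 'a::comm_monoid_mult) \<Rightarrow> 'g dgraph \<Rightarrow> 'a" where
  "vertex_prod c G = prod_list (map (\<lambda>(g, vo, vi). c g) (vertices G))"

lemma vertex_prod_rename [simp]: "vertex_prod c (rename f G) = vertex_prod c G"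
  by (simp add: vertex_prod_def comp_def case_prod_beta')

lemma inserts_vertices:
  assumes "inserts f (G, vo, vi) b"
  shows "map fst b = map fst (vertices G)"
  using assms by (auto simp: inserts_def)

lemma flattening_map_fst:
  assumes "is_flattening \<Gamma> H"
  shows "map fst (vertices H) = concat (map (\<lambda>(G, vo, vi). map fst (vertices G)) (vertices \<Gamma>))"
proof -
  obtain f bs where *: "vertices H = concat bs" "list_all2 (inserts f) (vertices \<Gamma>) bs"
    using assms by (auto simp: is_flattening_iff_inserts)
  from *(2) have "map (map fst) bs = map (\<lambda>(G, vo, vi). map fst (vertices G)) (vertices \<Gamma>)"
    by (induction rule: list_all2_induct) (auto dest: inserts_vertices)
  then show ?thesis using *(1) by (simp add: map_concat)
qed

lemma vertex_prod_flattening: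
  assumes "is_flattening \<Gamma> H"
  shows "vertex_prod c H = vertex_prod (vertex_prod c) \<Gamma>"
proof -
  have "vertex_prod c H = prod_list (map c (map fst (vertices H)))"
    by (simp add: vertex_prod_def comp_def case_prod_beta')
  also have "\<dots> = vertex_prod (vertex_prod c) \<Gamma>"
    unfolding flattening_map_fst[OF assms]
    by (simp add: vertex_prod_def map_concat prod_list_concat comp_def case_prod_beta')
  finally show ?thesis .
qed

lemma graph_degree_flattening:
  assumes "is_flattening \<Gamma> H"
  shows "graph_degree S H = sum_list (map (\<lambda>(G, vo, vi). graph_degree S G) (vertices \<Gamma>))"
proof -
  have "graph_degree S H = sum_list (map (degree S) (map fst (vertices H)))"
    by (simp add: graph_degree_def comp_def case_prod_beta')
  also have "\<dots> = sum_list (map (\<lambda>(G, vo, vi). graph_degree S G) (vertices \<Gamma>))"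
    unfolding flattening_map_fst[OF assms]
    by (simp add: graph_degree_def map_concat sum_list_concat comp_def case_prod_beta')
  finally show ?thesis .
qed

text \<open>
  Inserting \<open>\<sigma>\<close> at the vertices of the inserted graphs and then composing is the same as composing
  first.  The renamings into \<open>H'\<close> restrict to a compatible pair for \<open>\<Delta>\<close>, so by the universal property they
  factor through the composite \<open>H\<close> of \<open>\<Delta>\<close>; the factor \<open>k\<close> exhibits \<open>H'\<close> as a composite over \<open>H\<close>.
\<close>

theorem flattening_assoc:
  fixes \<Delta> :: "'g dgraph dgraph" and \<sigma> :: "'g \<Rightarrow> 'h dgraph"
  assumes \<Delta>: "gluing \<Delta>" and H: "is_flattening \<Delta> H"
    and K: "\<And>G vo vi. (G, vo, vi) \<in> set (vertices \<Delta>) \<Longrightarrow> is_flattening (map_dgraph \<sigma> G) (K G)"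
    and H': "is_flattening (map_dgraph K \<Delta>) H'"
  shows "is_flattening (map_dgraph \<sigma> H) H'"
proof -
  interpret gluing \<Delta> by fact
  obtain f h where c: "compatible f h" and H_eq: "H = glue f h" and wf_H: "wf_dgraph (glue f h)"
    using H unfolding is_flattening_iff_glue by auto
  obtain f' h' where wf': "wf_dgraph H'" and outs': "outs H' = map f' (outs \<Delta>)" and ins': "ins H' = map f' (ins \<Delta>)"
    and vertices': "vertices H' = concat (map (\<lambda>i. vertices (rename (h' i) (K (piece i)))) [0..<size])"
    and legs': "\<And>i. i < size \<Longrightarrow> map (h' i) (outs (K (piece i))) = map f' (vout i) \<and>
      map (h' i) (ins (K (piece i))) = map f' (vin i)"
  proof -
    have *: "vertices (map_dgraph K \<Delta>) ! i = (K (piece i), vout i, vin i)" "fst (vertices (map_dgraph K \<Delta>) ! i) = K (piece i)"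
      if "i < size" for i
      using that by (simp_all add: size_def vertex_eq)
    have len: "length (vertices (map_dgraph K \<Delta>)) = size" by (simp add: size_def)
    have "map (\<lambda>i. vertices (rename (h i) (fst (vertices (map_dgraph K \<Delta>) ! i)))) [0..<size]
       = map (\<lambda>i. vertices (rename (h i) (K (piece i)))) [0..<size]" for h
      by (intro map_cong) (simp_all only: * set_upt atLeastLessThan_iff fst_conv)
    with H' * show ?thesis
      unfolding is_flattening_def len by (auto intro!: that simp del: map_dgraph_simps(1) rename_simps)
  qed
  have "\<exists>\<phi> bs. outs (K (piece i)) = map \<phi> (outs (piece i)) \<and> ins (K (piece i)) = map \<phi> (ins (piece i))
     \<and> vertices (K (piece i)) = concat bs
     \<and> list_all2 (inserts \<phi>) (map (\<lambda>(x, vo, vi). (\<sigma> x, vo, vi)) (vertices (piece i))) bs" if "i < size" for i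
    using K[OF vertex_in[OF that]] by (simp add: is_flattening_iff_inserts)
  then obtain \<phi> bs where \<phi>: "\<And>i. i < size \<Longrightarrow> outs (K (piece i)) = map (\<phi> i) (outs (piece i))"
    "\<And>i. i < size \<Longrightarrow> ins (K (piece i)) = map (\<phi> i) (ins (piece i))"
    "\<And>i. i < size \<Longrightarrow> vertices (K (piece i)) = concat (bs i)"
    "\<And>i. i < size \<Longrightarrow> list_all2 (inserts (\<phi> i)) (map (\<lambda>(x, vo, vi). (\<sigma> x, vo, vi)) (vertices (piece i))) (bs i)"
    by metis
  \<comment> \<open>The edges of an inserted graph reach the second composite through the composite of their images.\<close>
  have "compatible f' (\<lambda>i. h' i \<circ> \<phi> i)"
    using legs' \<phi>(1,2) by (simp add: compatible_def)
  from glue_universal[OF c wf_H this]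
  obtain k where k: "\<And>x. x \<in> ends \<Longrightarrow> glued f' (\<lambda>i. h' i \<circ> \<phi> i) x = k (glued f h x)" by blast
  have kf: "f' e = k (f e)" if "e \<in> edges \<Delta>" for e
    using k[of "(0, e)"] that by (simp add: ends_def glued_def)
  have kh: "h' i (\<phi> i e) = k (h i e)" if "i < size" "e \<in> edges (piece i)" for i e
    using k[of "(Suc i, e)"] that by (simp add: ends_def glued_def)
  let ?r = "\<lambda>g (x, vo, vi). (x, map g vo, map g vi)"
  have blocks: "list_all2 (inserts k) (map (\<lambda>(x, vo, vi). (\<sigma> x, map (h i) vo, map (h i) vi)) (vertices (piece i)))
     (map (map (?r (h' i))) (bs i))" if i: "i < size" for i
  proof -
    have "inserts k (\<sigma> x, map (h i) vo, map (h i) vi) (map (?r (h' i)) b)"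
      if v: "(x, vo, vi) \<in> set (vertices (piece i))" and b: "inserts (\<phi> i) (\<sigma> x, vo, vi) b" for x vo vi b
    proof -
      obtain g where g: "b = vertices (rename g (\<sigma> x))" "map g (outs (\<sigma> x)) = map (\<phi> i) vo"
        "map g (ins (\<sigma> x)) = map (\<phi> i) vi"
        using b by (auto simp: inserts_def)
      have "map (h' i \<circ> g) (outs (\<sigma> x)) = map (h' i) (map (\<phi> i) vo)"
        using g(2) by (metis map_map)
      also have "\<dots> = map k (map (h i) vo)"
        using kh[OF i] edges_vertex(1)[OF v] by auto
      finally have 1: "map (h' i \<circ> g) (outs (\<sigma> x)) = map k (map (h i) vo)" .
      have "map (h' i \<circ> g) (ins (\<sigma> x)) = map (h' i) (map (\<phi> i) vi)"
        using g(3) by (metis map_map)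
      also have "\<dots> = map k (map (h i) vi)"
        using kh[OF i] edges_vertex(2)[OF v] by auto
      finally have 2: "map (h' i \<circ> g) (ins (\<sigma> x)) = map k (map (h i) vi)" .
      have "map (?r (h' i)) b = vertices (rename (h' i \<circ> g) (\<sigma> x))"
        by (simp add: g(1) comp_def case_prod_beta')
      with 1 2 show ?thesis unfolding inserts_def by blast
    qed
    then show ?thesis
      using \<phi>(4)[OF i] by (fastforce simp: list_all2_conv_all_nth case_prod_beta' nth_mem)
  qed
  let ?V = "\<lambda>i. map (\<lambda>(x, vo, vi). (\<sigma> x, map (h i) vo, map (h i) vi)) (vertices (piece i))"
  let ?W = "\<lambda>i. map (map (?r (h' i))) (bs i)"
  have "vertices (map_dgraph \<sigma> H) = concat (map ?V [0..<size])"
    by (simp add: H_eq glue_def map_concat comp_def case_prod_beta')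
  moreover have "list_all2 (inserts k) (concat (map ?V [0..<size])) (concat (map ?W [0..<size]))"
    by (rule list_all2_concatI, rule list_all2_all_nthI) (simp_all add: blocks)
  moreover have "vertices H' = concat (concat (map ?W [0..<size]))"
  proof -
    have "vertices (rename (h' i) (K (piece i))) = concat (?W i)" if "i < size" for i
      using \<phi>(3)[OF that] by (simp add: map_concat)
    then have "map (\<lambda>i. vertices (rename (h' i) (K (piece i)))) [0..<size] = map (\<lambda>i. concat (?W i)) [0..<size]"
      by (intro map_cong) auto
    then show ?thesis by (simp only: vertices' concat_concat map_map comp_def)
  qed
  moreover have "outs H' = map k (outs H)" "ins H' = map k (ins H)"
    using kf edges_outs[of \<Delta>] edges_ins[of \<Delta>] by (auto simp: outs' ins' H_eq glue_def subset_iff)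
  ultimately show ?thesis
    using wf' by (auto simp: is_flattening_iff_inserts simp del: map_dgraph_simps(1))
qed

section \<open>Multilinear extension\<close>

lemma lookup_scale [simp]: "Poly_Mapping.lookup (scale c p) G = c * Poly_Mapping.lookup p G"
  by (simp add: scale_def Poly_Mapping.map.rep_eq when_def)

lemma scale_simps [simp]:
  "scale c 0 = 0" "scale 0 p = 0" "scale 1 p = p" "scale c (scale d p) = scale (c * d) p"
  by (rule poly_mapping_eqI; simp add: mult.assoc)+

lemma scale_add: "scale c (p + q) = scale c p + scale c q"
  and scale_diff: "scale c (p - q) = scale c p - scale c q"
  and add_scale: "scale (c + d) p = scale c p + scale d p"
  and uminus_scale: "scale (- c) p = - scale c p"
  by (rule poly_mapping_eqI; simp add: lookup_add lookup_minus algebra_simps)+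

lemma scale_sum: "scale c (sum f A) = (\<Sum>x\<in>A. scale c (f x))"
  by (induction A rule: infinite_finite_induct) (simp_all add: scale_add)

lemma scale_single: "scale c (Poly_Mapping.single G d) = Poly_Mapping.single G (c * d)"
  by (rule poly_mapping_eqI) (simp add: lookup_single when_def)

lemma single_eq_scale: "Poly_Mapping.single G d = scale d (bvec G)"
  by (simp add: scale_single)

definition lin :: "('g dgraph \<Rightarrow> ('h, 'k::comm_ring_1) lincomb) \<Rightarrow> ('g, 'k) lincomb \<Rightarrow> ('h, 'k) lincomb" where
  "lin T p = (\<Sum>G\<in>Poly_Mapping.keys p. scale (Poly_Mapping.lookup p G) (T G))"

lemma lin_superset:
  assumes "finite A" "Poly_Mapping.keys p \<subseteq> A"
  shows "lin T p = (\<Sum>G\<in>A. scale (Poly_Mapping.lookup p G) (T G))"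
  unfolding lin_def by (rule sum.mono_neutral_left) (use assms in \<open>auto simp: in_keys_iff\<close>)

lemma lin_add: "lin T (p + q) = lin T p + lin T q"
proof -
  let ?A = "Poly_Mapping.keys p \<union> Poly_Mapping.keys q"
  have A: "finite ?A" "Poly_Mapping.keys (p + q) \<subseteq> ?A" using Poly_Mapping.keys_add[of p q] by auto
  then show ?thesis
    by (simp add: lin_superset[of ?A] lookup_add add_scale sum.distrib)
qed

lemma keys_scale: "Poly_Mapping.keys (scale c p) \<subseteq> Poly_Mapping.keys p"
  by (auto simp: in_keys_iff)

lemma lin_scale: "lin T (scale c p) = scale c (lin T p)"
  by (simp add: lin_superset[OF _ keys_scale] scale_sum) (simp add: lin_def scale_sum)

lemma lin_zero [simp]: "lin T 0 = 0"
  by (simp add: lin_def)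

lemma lin_uminus: "lin T (- p) = - lin T p"
  using lin_scale[of T "-1" p] by (simp add: uminus_scale)

lemma lin_diff: "lin T (p - q) = lin T p - lin T q"
  using lin_add[of T p "- q"] by (simp add: lin_uminus)

lemma lin_single: "lin T (Poly_Mapping.single G c) = scale c (T G)"
  by (subst lin_superset[of "{G}"]) (auto simp: lookup_single)

lemma lin_bvec [simp]: "lin T (bvec G) = T G"
  by (simp add: lin_single)

lemma lin_sum: "lin T (sum f A) = (\<Sum>x\<in>A. lin T (f x))"
  by (induction A rule: infinite_finite_induct) (simp_all add: lin_add)

lemma lin_identity: "lin bvec p = p"
  by (rule poly_mapping_eqI) (auto simp: lin_def scale_single lookup_sum lookup_single when_def in_keys_iff)

lemma lin_lin: "lin T (lin U p) = lin (\<lambda>G. lin T (U G)) p"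
  by (simp add: lin_def[of U] lin_sum lin_scale) (simp add: lin_def[of "\<lambda>G. lin T (U G)"])

lemma lin_fun_diff: "lin (\<lambda>G. T G - U G) p = lin T p - lin U p"
  by (simp add: lin_def scale_diff sum_subtractf)

lemma lin_swap: "lin (\<lambda>G. lin (\<lambda>H. T G H) q) p = lin (\<lambda>H. lin (\<lambda>G. T G H) p) q"
  unfolding lin_def scale_sum by (subst sum.swap) (simp add: mult.commute)

text \<open>
  The multilinear extension of a function of lists of graphs.  Peeling off one argument at a time
  reduces its properties to those of linear extension.
\<close>

primrec mlin :: "('g dgraph list \<Rightarrow> ('h, 'k::comm_ring_1) lincomb) \<Rightarrow> ('g, 'k) lincomb list \<Rightarrow> ('h, 'k) lincomb" where
  "mlin T [] = T []"
| "mlin T (p # ps) = lin (\<lambda>G. mlin (\<lambda>Gs. T (G # Gs)) ps) p"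

lemma mlin_lin_fun: "mlin (\<lambda>Gs. lin (\<lambda>H. U H Gs) q) ps = lin (\<lambda>H. mlin (U H) ps) q"
proof (induction ps arbitrary: U)
  case (Cons p ps)
  show ?case
    unfolding mlin.simps Cons by (rule lin_swap)
qed simp

lemma lin_mlin: "lin F (mlin T ps) = mlin (\<lambda>Gs. lin F (T Gs)) ps"
  by (induction ps arbitrary: T) (simp_all add: lin_lin)

text \<open>
  Substituting linear extensions into a multilinear extension.
\<close>

lemma mlin_map_lin: "mlin T (map (lin F) ps) = mlin (\<lambda>Gs. mlin T (map F Gs)) ps"
proof (induction ps arbitrary: T)
  case (Cons p ps)
  have "mlin T (map (lin F) (p # ps)) = lin (\<lambda>H. mlin (\<lambda>Gs. mlin (\<lambda>Hs. T (H # Hs)) (map F Gs)) ps) (lin F p)"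
    by (simp add: Cons)
  also have "\<dots> = lin (\<lambda>G. mlin (\<lambda>Gs. lin (\<lambda>H. mlin (\<lambda>Hs. T (H # Hs)) (map F Gs)) (F G)) ps) p"
    by (simp add: lin_lin mlin_lin_fun)
  finally show ?case by simp
qed simp

lemma mlin_map_scale_bvec:
  "mlin T (map (\<lambda>G. scale (c G) (bvec (F G))) Gs) = scale (prod_list (map c Gs)) (T (map F Gs))"
proof (induction Gs arbitrary: T)
  case (Cons G Gs)
  show ?case by (simp add: lin_scale Cons)
qed simp

lemma mlin_map_bvec: "mlin T (map bvec Gs) = T Gs"
  by (induction Gs arbitrary: T) simp_all

lemma mlin_append_diff:
  "mlin T (ps @ (p - q) # qs) = mlin T (ps @ p # qs) - mlin T (ps @ q # qs)"
proof (induction ps arbitrary: T)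
  case Nil
  show ?case by (simp add: lin_diff)
next
  case (Cons r ps)
  then show ?case by (simp add: lin_fun_diff)
qed

lemma mlin_sum:
  "mlin T ps = (\<Sum>Gs\<in>{Gs. list_all2 (\<lambda>G p. G \<in> Poly_Mapping.keys p) Gs ps}.
     scale (prod_list (map2 Poly_Mapping.lookup ps Gs)) (T Gs))"
proof (induction ps arbitrary: T)
  case (Cons p ps)
  let ?A = "{Gs. list_all2 (\<lambda>G p. G \<in> Poly_Mapping.keys p) Gs ps}"
  have "{Gs. list_all2 (\<lambda>G p. G \<in> Poly_Mapping.keys p) Gs (p # ps)} = (\<lambda>(G, Gs). G # Gs) ` (Poly_Mapping.keys p \<times> ?A)"
    by (auto simp: list_all2_Cons2)
  moreover have "inj_on (\<lambda>(G, Gs). G # Gs) (Poly_Mapping.keys p \<times> ?A)" by (auto simp: inj_on_def)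
  ultimately have "(\<Sum>Gs\<in>{Gs. list_all2 (\<lambda>G p. G \<in> Poly_Mapping.keys p) Gs (p # ps)}.
     scale (prod_list (map2 Poly_Mapping.lookup (p # ps) Gs)) (T Gs))
    = (\<Sum>(G, Gs)\<in>Poly_Mapping.keys p \<times> ?A. scale (prod_list (map2 Poly_Mapping.lookup (p # ps) (G # Gs))) (T (G # Gs)))"
    by (simp add: sum.reindex case_prod_beta')
  also have "\<dots> = mlin T (p # ps)"
    by (simp add: Cons lin_def scale_sum sum.cartesian_product)
  finally show ?case by simp
qed simp

lemma rel_dgraph_zip:
  assumes "length ps = length ls"
  shows "{\<Delta>. rel_dgraph P \<Delta> (DGraph (zip ps ls) bs as)} = (\<lambda>xs. DGraph (zip xs ls) bs as) ` {xs. list_all2 P xs ps}"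
    (is "_ = ?g ` ?A")
proof (intro equalityI subsetI)
  fix \<Delta> assume "\<Delta> \<in> {\<Delta>. rel_dgraph P \<Delta> (DGraph (zip ps ls) bs as)}"
  then obtain vs where \<Delta>: "\<Delta> = DGraph vs bs as"
    and vs: "list_all2 (rel_prod P (=)) vs (zip ps ls)"
    by (cases \<Delta>) (auto simp: list.rel_eq prod.rel_eq)
  have "list_all2 P (map fst vs) (map fst (zip ps ls))"
    using vs by (auto simp: list.rel_map rel_prod_sel elim!: list_all2_mono)
  then have 1: "map fst vs \<in> ?A" using assms by simp
  have "list_all2 (=) (map snd vs) (map snd (zip ps ls))"
    unfolding list.rel_map using vs by (rule list_all2_mono) (auto simp: rel_prod_sel)
  then have "map snd vs = ls" using assms by (simp add: list.rel_eq)
  then have "\<Delta> = ?g (map fst vs)" using \<Delta> zip_map_fst_snd[of vs] by simp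
  with 1 show "\<Delta> \<in> ?g ` ?A" by blast
next
  fix \<Delta> assume "\<Delta> \<in> ?g ` ?A"
  then obtain xs where \<Delta>: "\<Delta> = ?g xs" and xs: "list_all2 P xs ps" by blast
  have "list_all2 (rel_prod P (=)) (zip xs ls) (zip ps ls)"
    using xs assms by (auto simp: list_all2_conv_all_nth)
  then show "\<Delta> \<in> {\<Delta>. rel_dgraph P \<Delta> (DGraph (zip ps ls) bs as)}"
    by (simp add: \<Delta> list.rel_eq prod.rel_eq)
qed

text \<open>
  Separating the decorations from the legs of the vertices makes composition of linear combinations
  an instance of multilinear extension, for a fixed shape of the graph.
\<close>

lemma graph_subst_mlin:
  assumes "length ps = length ls"
  shows "graph_subst (DGraph (zip ps ls) bs as) = mlin (\<lambda>Gs. bvec (flatten (DGraph (zip Gs ls) bs as))) ps"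
proof -
  let ?A = "{Gs. list_all2 (\<lambda>G p. G \<in> Poly_Mapping.keys p) Gs ps}"
  let ?g = "\<lambda>Gs. DGraph (zip Gs ls) bs as"
  note eq = rel_dgraph_zip[OF assms, of "\<lambda>G p. G \<in> Poly_Mapping.keys p" bs as]
  have inj: "inj_on ?g ?A"
  proof (rule inj_onI)
    fix Gs Hs assume "Gs \<in> ?A" "Hs \<in> ?A" and e: "?g Gs = ?g Hs"
    then have "length Gs = length ls" "length Hs = length ls" using assms by (auto dest: list_all2_lengthD)
    then show "Gs = Hs" using e by (metis dgraph.inject map_fst_zip)
  qed
  have "graph_subst (DGraph (zip ps ls) bs as)
     = (\<Sum>Gs\<in>?A. Poly_Mapping.single (flatten (?g Gs))
          (\<Prod>((p, _), (G, _)) \<leftarrow> zip (zip ps ls) (zip Gs ls). Poly_Mapping.lookup p G))"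
    unfolding graph_subst_def eq by (simp add: sum.reindex[OF inj])
  also have "\<dots> = (\<Sum>Gs\<in>?A. scale (prod_list (map2 Poly_Mapping.lookup ps Gs)) (bvec (flatten (?g Gs))))"
  proof (rule sum.cong[OF refl])
    fix Gs assume "Gs \<in> ?A"
    then have len: "length Gs = length ls" using assms by (auto dest: list_all2_lengthD)
    have "(\<Prod>((p, _), (G, _)) \<leftarrow> zip (zip ps ls) (zip Gs ls). Poly_Mapping.lookup p G)
      = prod_list (map2 Poly_Mapping.lookup ps Gs)"
      using assms len
    proof (induction ps ls arbitrary: Gs rule: list_induct2)
      case (Cons p ps l ls)
      then show ?case by (cases Gs) (auto simp: case_prod_beta')
    qed simp
    then show "Poly_Mapping.single (flatten (?g Gs))
          (\<Prod>((p, _), (G, _)) \<leftarrow> zip (zip ps ls) (zip Gs ls). Poly_Mapping.lookup p G)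
       = scale (prod_list (map2 Poly_Mapping.lookup ps Gs)) (bvec (flatten (?g Gs)))"
      by (simp add: single_eq_scale[of _ "prod_list _"])
  qed
  finally show ?thesis by (simp add: mlin_sum)
qed

section \<open>Congruence modulo the ideal of relations\<close>

lemma decorated_by_map:
  assumes "decorated_by V \<Gamma>" "\<And>x m n. x \<in> V m n \<Longrightarrow> f x \<in> W m n"
  shows "decorated_by W (map_dgraph f \<Gamma>)"
  using assms by (auto simp: decorated_by_def)

lemma ideal_uminus: "p \<in> relation_ideal S R \<Longrightarrow> - p \<in> relation_ideal S R"
  using relation_ideal.scale[of p S R "-1"] by (simp add: uminus_scale)

lemma ideal_sym: "p - q \<in> relation_ideal S R \<Longrightarrow> q - p \<in> relation_ideal S R"
  using ideal_uminus by fastforce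

lemma ideal_trans [trans]:
  "p - q \<in> relation_ideal S R \<Longrightarrow> q - r \<in> relation_ideal S R \<Longrightarrow> p - r \<in> relation_ideal S R"
  using relation_ideal.add[of "p - q" S R "q - r"] by simp

lemma ideal_scale_cong: "p - q \<in> relation_ideal S R \<Longrightarrow> scale c p - scale c q \<in> relation_ideal S R"
  using relation_ideal.scale[of "p - q" S R c] by (simp add: scale_diff)

lemma ideal_sum: "(\<And>x. x \<in> A \<Longrightarrow> f x \<in> relation_ideal S R) \<Longrightarrow> sum f A \<in> relation_ideal S R"
  by (induction A rule: infinite_finite_induct) (auto intro: relation_ideal.zero relation_ideal.add)

lemma ideal_lin: "(\<And>G. G \<in> Poly_Mapping.keys p \<Longrightarrow> T G \<in> relation_ideal S R) \<Longrightarrow> lin T p \<in> relation_ideal S R"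
  unfolding lin_def by (intro ideal_sum relation_ideal.scale)

lemma ideal_lin_cong:
  "(\<And>G. G \<in> Poly_Mapping.keys p \<Longrightarrow> T G - U G \<in> relation_ideal S R) \<Longrightarrow> lin T p - lin U p \<in> relation_ideal S R"
  unfolding lin_fun_diff[symmetric] by (rule ideal_lin)

lemma ideal_mlin_cong:
  "(\<And>Gs. list_all2 (\<lambda>G p. G \<in> Poly_Mapping.keys p) Gs ps \<Longrightarrow> T Gs - U Gs \<in> relation_ideal S R)
    \<Longrightarrow> mlin T ps - mlin U ps \<in> relation_ideal S R"
proof (induction ps arbitrary: T U)
  case (Cons p ps)
  show ?case unfolding mlin.simps by (intro ideal_lin_cong Cons) simp
qed simp

lemma ideal_flattenings:
  assumes "decorated_by (monomials S) \<Delta>" "is_flattening \<Delta> H" "is_flattening \<Delta> H'"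
  shows "bvec H - bvec H' \<in> relation_ideal S R"
  using flattening_rename_unique[OF assms] relation_ideal.rename[OF flattening_monomial[OF assms(1,2)]]
  by blast

lemma connected_dag_zip:
  assumes "length xs = length ls"
  shows "connected_dag (DGraph (zip xs ls) bs as) \<longleftrightarrow> connected_dag (DGraph (map (Pair ()) ls) bs as)"
proof -
  have "map (\<lambda>(x, vo, vi). ((), vo, vi)) (zip xs ls) = map (Pair ()) ls"
    using assms by (induction xs ls rule: list_induct2) auto
  then have "map_dgraph (\<lambda>_. ()) (DGraph (zip xs ls) bs as) = DGraph (map (Pair ()) ls) bs as"
    by (simp add: case_prod_beta' map_prod_def)
  then show ?thesis by (metis connected_dag_map_dgraph)
qed

lemma decorated_by_zip:
  assumes "length xs = length ls"
  shows "decorated_by V (DGraph (zip xs ls) bs as) \<longleftrightarrow> connected_dag (DGraph (map (Pair ()) ls) bs as)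
    \<and> list_all2 (\<lambda>x l. x \<in> V (length (fst l)) (length (snd l))) xs ls"
proof -
  have "(\<forall>(x, vo, vi) \<in> set (zip xs ls). x \<in> V (length vo) (length vi)) \<longleftrightarrow>
    list_all2 (\<lambda>x l. x \<in> V (length (fst l)) (length (snd l))) xs ls"
    using assms by (auto simp: list_all2_iff)
  then show ?thesis using assms by (simp add: decorated_by_def connected_dag_zip)
qed

lemma dgraph_zip_cases:
  obtains xs ls bs as where "\<Gamma> = DGraph (zip xs ls) bs as" "length xs = length ls"
proof (cases \<Gamma>)
  case (DGraph vs bs as)
  then show ?thesis using that[of "map fst vs" "map snd vs" bs as] zip_map_fst_snd[of vs] by simp
qed

lemma map_dgraph_zip: "map_dgraph f (DGraph (zip xs ls) bs as) = DGraph (zip (map f xs) ls) bs as"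
  by (simp add: zip_map1 case_prod_beta' map_prod_def)

lemma lincombs_diff: "p \<in> lincombs S m n \<Longrightarrow> q \<in> lincombs S m n \<Longrightarrow> p - q \<in> lincombs S m n"
  using keys_diff[of p q] by (auto simp: lincombs_def)

text \<open>
  Replace the decorations one after the other.  Each replacement changes the composite by a composite
  with a decoration in the ideal.
\<close>

lemma graph_subst_cong:
  assumes "decorated_by (lincombs S) (DGraph (zip ps ls) bs as)" "decorated_by (lincombs S) (DGraph (zip qs ls) bs as)"
    and len: "length ps = length ls" "length qs = length ls"
    and pq: "list_all2 (\<lambda>p q. p - q \<in> relation_ideal S R) ps qs"
  shows "graph_subst (DGraph (zip ps ls) bs as) - graph_subst (DGraph (zip qs ls) bs as) \<in> relation_ideal S R"
proof -
  let ?V = "\<lambda>p l. p \<in> lincombs S (length (fst l)) (length (snd l))"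
  let ?g = "\<lambda>ps. graph_subst (DGraph (zip ps ls) bs as)"
  have shape: "connected_dag (DGraph (map (Pair ()) ls) bs as)"
    and V: "list_all2 ?V ps ls" "list_all2 ?V qs ls"
    using assms(1,2) len by (auto simp: decorated_by_zip)
  have "?g (rs @ ps') - ?g (rs @ qs') \<in> relation_ideal S R"
    if "list_all2 ?V (rs @ ps') ls" "list_all2 ?V (rs @ qs') ls"
      "list_all2 (\<lambda>p q. p - q \<in> relation_ideal S R) ps' qs'" for rs ps' qs'
    using that(3,1,2)
  proof (induction arbitrary: rs rule: list_all2_induct)
    case Nil
    then show ?case by (simp add: relation_ideal.zero)
  next
    case (Cons p ps' q qs')
    let ?T = "\<lambda>Gs. bvec (flatten (DGraph (zip Gs ls) bs as))"
    have len: "length (rs @ p # ps') = length ls" "length (rs @ q # qs') = length ls"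
      using Cons.prems by (auto dest: list_all2_lengthD)
    obtain ls1 l ls2 where ls: "ls = ls1 @ l # ls2" "length ls1 = length rs" "length ls2 = length ps'"
      using Cons.prems(1) by (auto simp: list_all2_append1 list_all2_Cons1 dest: list_all2_lengthD)
    have Vs: "list_all2 ?V rs ls1" "?V p l" "list_all2 ?V ps' ls2" "?V q l" "list_all2 ?V qs' ls2"
      using Cons.prems ls len by (auto simp: list_all2_append)
    have "?g (rs @ (p - q) # ps') \<in> relation_ideal S R"
    proof (rule relation_ideal.comp)
      show "decorated_by (lincombs S) (DGraph (zip (rs @ (p - q) # ps') ls) bs as)"
        using len shape Vs lincombs_diff[OF Vs(2,4)]
        by (subst decorated_by_zip) (auto simp: ls(1) intro: list_all2_appendI)
      show "(p - q, fst l, snd l) \<in> set (vertices (DGraph (zip (rs @ (p - q) # ps') ls) bs as))"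
        using ls by simp
    qed (use Cons.hyps in simp)
    then have 1: "?g (rs @ p # ps') - ?g (rs @ q # ps') \<in> relation_ideal S R"
      using len by (simp add: graph_subst_mlin mlin_append_diff)
    have "?g ((rs @ [q]) @ ps') - ?g ((rs @ [q]) @ qs') \<in> relation_ideal S R"
      by (rule Cons.IH) (use Vs ls in \<open>auto intro!: list_all2_appendI\<close>)
    with 1 show ?case by (auto intro: ideal_trans)
  qed
  from this[of "[]" ps qs] V pq show ?thesis by simp
qed

section \<open>Corollas\<close>

lemma corolla_inserts:
  assumes "length vo = out_arity S g" "length vi = in_arity S g"
  shows "inserts f (corolla S g, vo, vi) [(g, map f vo, map f vi)]"
proof -
  let ?h = "\<lambda>x. f ((vo @ vi) ! x)"
  have "map ?h [0..<out_arity S g] = map f vo"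
    using assms by (intro nth_equalityI) (auto simp: nth_append)
  moreover have "map ?h [out_arity S g..<out_arity S g + in_arity S g] = map f vi"
    using assms by (intro nth_equalityI) (auto simp: nth_append)
  ultimately show ?thesis
    unfolding inserts_def by (auto simp: corolla_def Let_def intro!: exI[of _ ?h])
qed

lemma corolla_monomial:
  assumes "out_arity S g > 0"
  shows "corolla S g \<in> monomials S (out_arity S g) (in_arity S g)"
proof -
  let ?o = "out_arity S g" and ?i = "in_arity S g"
  have "wf_dgraph (corolla S g)"
    by (auto simp: wf_dgraph_def corolla_def Let_def edge_sources_def edge_targets_def)
  moreover have "acyclic (flow (corolla S g))"
  proof -
    have "flow (corolla S g) \<subseteq> {?o..} \<times> {..<?o}" by (auto simp: flow_def corolla_def Let_def)
    moreover have "acyclic ({?o..} \<times> {..<?o})"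
    proof (rule acyclic_subset[of "(measure (\<lambda>x. if x < ?o then 0 else 1))\<inverse>"])
    qed (auto simp: wf_acyclic)
    ultimately show ?thesis using acyclic_subset by blast
  qed
  moreover have "edges (corolla S g) = {0..<?o + ?i}"
    by (auto simp: corolla_def Let_def edges_def edge_sources_def edge_targets_def)
  moreover have "(e, e') \<in> adjacent (corolla S g)" if "e < ?o + ?i" "e' < ?o + ?i" for e e'
    using that by (auto simp: corolla_def Let_def adjacent_def)
  ultimately show ?thesis
    using assms by (auto simp: monomials_def connected_dag_def) (auto simp: corolla_def Let_def upt_conv_Cons)
qed

lemma decorated_corollas:
  assumes "G \<in> monomials S m n"
  shows "decorated_by (monomials S) (map_dgraph (corolla S) G)"
proof -
  have "corolla S g \<in> monomials S (length vo) (length vi)" if "(g, vo, vi) \<in> set (vertices G)" for g vo vi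
  proof -
    have "vo \<noteq> []" "length vo = out_arity S g" "length vi = in_arity S g"
      using assms that by (auto simp: monomials_def connected_dag_def)
    then show ?thesis using corolla_monomial[of S g] by (metis length_greater_0_conv)
  qed
  then show ?thesis using assms by (fastforce simp: decorated_by_def monomials_def)
qed

text \<open>
  A graph is the composite of its corollas.  Allowing a renaming here also shows that renamed
  monomials are monomials, since composites are.
\<close>

lemma flattening_corollas:
  assumes "G \<in> monomials S m n" "inj_on f (edges G)"
  shows "is_flattening (map_dgraph (corolla S) G) (rename f G)"
proof -
  have "wf_dgraph (rename f G)"
    using assms by (simp add: wf_rename_iff monomials_def connected_dag_def)
  moreover have "list_all2 (inserts f) (vertices (map_dgraph (corolla S) G)) (map (\<lambda>v. [v]) (vertices (rename f G)))"
  proof -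
    have "list_all2 (\<lambda>v w. inserts f (case v of (x, vo, vi) \<Rightarrow> (corolla S x, vo, vi))
        [case w of (x, vo, vi) \<Rightarrow> (x, map f vo, map f vi)]) (vertices G) (vertices G)"
      by (rule list.rel_refl_strong) (use assms(1) in \<open>auto simp: monomials_def intro!: corolla_inserts\<close>)
    then show ?thesis by (simp add: list.rel_map)
  qed
  ultimately show ?thesis
    unfolding is_flattening_iff_inserts by (intro conjI exI[of _ f] exI[of _ "map (\<lambda>v. [v]) (vertices (rename f G))"])
      (simp_all add: comp_def)
qed

lemma monomials_rename:
  assumes "G \<in> monomials S m n" "inj_on f (edges G)"
  shows "rename f G \<in> monomials S m n"
  using flattening_monomial[OF decorated_corollas[OF assms(1)] flattening_corollas[OF assms]] assms(1)
  by (simp add: monomials_def)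

lemma flattening_rename:
  assumes "is_flattening \<Gamma> H" "inj_on g (edges \<Gamma>)"
  shows "is_flattening (rename g \<Gamma>) H"
proof -
  obtain f bs where H: "wf_dgraph H" "outs H = map f (outs \<Gamma>)" "ins H = map f (ins \<Gamma>)"
    "vertices H = concat bs" "list_all2 (inserts f) (vertices \<Gamma>) bs"
    using assms(1) by (auto simp: is_flattening_iff_inserts)
  let ?f = "\<lambda>e. f (the_inv_into (edges \<Gamma>) g e)"
  have f: "map ?f (map g es) = map f es" if "set es \<subseteq> edges \<Gamma>" for es
    using that assms(2) by (auto simp: the_inv_into_f_f subset_iff)
  have "inserts ?f (G, map g vo, map g vi) b" if "inserts f (G, vo, vi) b" "(G, vo, vi) \<in> set (vertices \<Gamma>)" for G vo vi b
    using that f[OF edges_vertex(1)[OF that(2)]] f[OF edges_vertex(2)[OF that(2)]]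
    unfolding inserts_def by (auto simp del: map_map)
  then have "list_all2 (inserts ?f) (vertices (rename g \<Gamma>)) bs"
    using H(5) by (fastforce simp: list_all2_conv_all_nth case_prod_beta' nth_mem)
  moreover have "outs H = map ?f (outs (rename g \<Gamma>))" "ins H = map ?f (ins (rename g \<Gamma>))"
    using H(2,3) f[OF edges_outs] f[OF edges_ins] by (simp_all del: map_map)
  ultimately show ?thesis
    using H(1,4) unfolding is_flattening_iff_inserts by blast
qed

lemma map_dgraph_rename: "map_dgraph \<sigma> (rename f G) = rename f (map_dgraph \<sigma> G)"
  by (cases G) (simp add: rename_def case_prod_beta' map_prod_def)

section \<open>Reordering vertices\<close>

lemma mset_concat_map: "mset vs = mset ws \<Longrightarrow> mset (concat (map f vs)) = mset (concat (map f ws))"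
  by (simp add: mset_concat comp_def) (metis mset_map sum_mset_sum_list)

lemma wf_dgraph_perm:
  assumes "mset vs = mset ws"
  shows "wf_dgraph (DGraph vs bs as) \<longleftrightarrow> wf_dgraph (DGraph ws bs as)"
proof -
  have "mset (edge_sources (DGraph vs bs as)) = mset (edge_sources (DGraph ws bs as))"
    "mset (edge_targets (DGraph vs bs as)) = mset (edge_targets (DGraph ws bs as))"
    using mset_concat_map[OF assms] by (auto simp: edge_sources_def edge_targets_def)
  then show ?thesis
    unfolding wf_dgraph_def by (metis mset_eq_imp_distinct_iff mset_eq_setD)
qed

lemma connected_dag_perm:
  assumes "mset vs = mset ws"
  shows "connected_dag (DGraph vs bs as) \<longleftrightarrow> connected_dag (DGraph ws bs as)"
proof -
  have set: "set vs = set ws" using assms mset_eq_setD by blast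
  then have "edges (DGraph vs bs as) = edges (DGraph ws bs as)"
    by (auto simp: edges_def edge_sources_def edge_targets_def)
  then show ?thesis
    using set wf_dgraph_perm[OF assms] by (simp add: connected_dag_def flow_def adjacent_def)
qed

lemma monomials_perm:
  assumes "DGraph vs bs as \<in> monomials S m n" "mset vs = mset ws"
  shows "DGraph ws bs as \<in> monomials S m n"
proof -
  have "set vs = set ws" using assms(2) mset_eq_setD by blast
  then show ?thesis using assms connected_dag_perm[OF assms(2)] by (simp add: monomials_def)
qed

definition vertices_degree :: "'g signature \<Rightarrow> ('g \<times> nat list \<times> nat list) list \<Rightarrow> int" where
  "vertices_degree S vs = (\<Sum>(g, vo, vi) \<leftarrow> vs. degree S g)"

lemma vertices_degree_simps [simp]:
  "vertices_degree S [] = 0"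
  "vertices_degree S ((g, vo, vi) # vs) = degree S g + vertices_degree S vs"
  "vertices_degree S (vs @ ws) = vertices_degree S vs + vertices_degree S ws"
  by (simp_all add: vertices_degree_def)

lemma koszul_sign_simps [simp]:
  "koszul_sign 0 d = 1" "koszul_sign d 0 = 1"
  "koszul_sign (d + e) d' = koszul_sign d d' * koszul_sign e d'"
  "koszul_sign d (d' + e') = koszul_sign d d' * koszul_sign d e'"
  by (auto simp: koszul_sign_def)

lemma ideal_swap_vertex_block:
  assumes "DGraph (vs @ (g, vo, vi) # B @ ws) bs as \<in> monomials S m n"
  shows "bvec (DGraph (vs @ (g, vo, vi) # B @ ws) bs as)
    - scale (koszul_sign (degree S g) (vertices_degree S B)) (bvec (DGraph (vs @ B @ (g, vo, vi) # ws) bs as))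
    \<in> relation_ideal S R"
  using assms
proof (induction B arbitrary: vs)
  case Nil
  then show ?case by (simp add: relation_ideal.zero)
next
  case (Cons v B)
  obtain g' vo' vi' where v: "v = (g', vo', vi')" by (cases v)
  have M: "DGraph ((vs @ [v]) @ (g, vo, vi) # B @ ws) bs as \<in> monomials S m n"
    by (rule monomials_perm[OF Cons.prems]) simp
  have "bvec (DGraph (vs @ (g, vo, vi) # v # B @ ws) bs as)
     - scale (koszul_sign (degree S g) (degree S g')) (bvec (DGraph (vs @ v # (g, vo, vi) # B @ ws) bs as)) \<in> relation_ideal S R"
    using relation_ideal.swap[of vs g vo vi g' vo' vi' "B @ ws" bs as S m n R] Cons.prems by (simp add: v)
  moreover have "scale (koszul_sign (degree S g) (degree S g')) (bvec (DGraph (vs @ v # (g, vo, vi) # B @ ws) bs as))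
     - scale (koszul_sign (degree S g) (degree S g')) (scale (koszul_sign (degree S g) (vertices_degree S B))
         (bvec (DGraph (vs @ v # B @ (g, vo, vi) # ws) bs as))) \<in> relation_ideal S R"
    using ideal_scale_cong[OF Cons.IH[OF M]] by simp
  ultimately show ?case
    using ideal_trans by (fastforce simp: v)
qed

text \<open>
  The Koszul sign is multiplicative in each argument, so whole blocks of vertices can be exchanged
  like single vertices.
\<close>

lemma ideal_swap_blocks:
  assumes "DGraph (vs @ A @ B @ ws) bs as \<in> monomials S m n"
  shows "bvec (DGraph (vs @ A @ B @ ws) bs as)
    - scale (koszul_sign (vertices_degree S A) (vertices_degree S B)) (bvec (DGraph (vs @ B @ A @ ws) bs as))
    \<in> relation_ideal S R"
  using assms
proof (induction A arbitrary: vs)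
  case Nil
  then show ?case by (simp add: relation_ideal.zero)
next
  case (Cons v A)
  obtain g vo vi where v: "v = (g, vo, vi)" by (cases v)
  let ?a = "koszul_sign (vertices_degree S A) (vertices_degree S B)"
  have 1: "bvec (DGraph (vs @ v # A @ B @ ws) bs as) - scale ?a (bvec (DGraph (vs @ v # B @ A @ ws) bs as)) \<in> relation_ideal S R"
    using Cons.IH[of "vs @ [v]"] Cons.prems by simp
  have "DGraph (vs @ (g, vo, vi) # B @ A @ ws) bs as \<in> monomials S m n"
    by (rule monomials_perm[OF Cons.prems]) (simp add: v)
  from ideal_scale_cong[OF ideal_swap_vertex_block[OF this, of R], of ?a] 1
  show ?case using ideal_trans by (fastforce simp: v mult.commute)
qed

section \<open>Maps induced by an assignment of generators\<close>

lemma keys_lin: "Poly_Mapping.keys (lin T p) \<subseteq> (\<Union>G\<in>Poly_Mapping.keys p. Poly_Mapping.keys (T G))"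
proof -
  have "Poly_Mapping.keys (sum f A) \<subseteq> (\<Union>x\<in>A. Poly_Mapping.keys (f x))" for f :: "'c dgraph \<Rightarrow> ('a, 'b) lincomb" and A
  proof (induction A rule: infinite_finite_induct)
    case (insert x A)
    then show ?case using Poly_Mapping.keys_add[of "f x" "sum f A"] by auto
  qed auto
  then show ?thesis unfolding lin_def using keys_scale by fastforce
qed

text \<open>
  Each generator \<open>g\<close> goes to the multiple \<open>\<chi> g\<close> of a single graph \<open>\<sigma> g\<close>.  The relations are parameters in
  order to name the two ideals; what is assumed about them appears in the theorems.
\<close>

locale presentation_map =
  fixes S :: "'g signature" and R :: "('g, 'k::comm_ring_1) lincomb set"
    and S' :: "'h signature" and R' :: "('h, 'k) lincomb set"
    and \<sigma> :: "'g \<Rightarrow> 'h dgraph" and \<chi> :: "'g \<Rightarrow> 'k"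
  assumes image_monomial: "\<And>g. \<sigma> g \<in> monomials S' (out_arity S g) (in_arity S g)"
    and image_degree: "\<And>g. graph_degree S' (\<sigma> g) = degree S g"
begin

definition graph_image :: "'g dgraph \<Rightarrow> 'h dgraph" where
  "graph_image G = flatten (map_dgraph \<sigma> G)"

definition induced :: "('g, 'k) lincomb \<Rightarrow> ('h, 'k) lincomb" where
  "induced = lin (\<lambda>G. scale (vertex_prod \<chi> G) (bvec (graph_image G)))"

lemma induced_linear [simp]:
  "induced 0 = 0" "induced (p + q) = induced p + induced q" "induced (p - q) = induced p - induced q"
  "induced (- p) = - induced p" "induced (scale c p) = scale c (induced p)"
  "induced (bvec G) = scale (vertex_prod \<chi> G) (bvec (graph_image G))"
  by (simp_all add: induced_def lin_add lin_diff lin_scale lin_uminus)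

lemma decorated_image:
  "G \<in> monomials S m n \<Longrightarrow> decorated_by (monomials S') (map_dgraph \<sigma> G)"
  using image_monomial by (fastforce simp: decorated_by_def monomials_def)

lemma graph_image_flattening:
  "G \<in> monomials S m n \<Longrightarrow> is_flattening (map_dgraph \<sigma> G) (graph_image G)"
  unfolding graph_image_def by (rule flatten_is_flattening[OF decorated_image])

lemma graph_image_monomial: "G \<in> monomials S m n \<Longrightarrow> graph_image G \<in> monomials S' m n"
proof -
  assume G: "G \<in> monomials S m n"
  then have "length (outs G) = m" "length (ins G) = n" by (simp_all add: monomials_def)
  then show ?thesis using flattening_monomial[OF decorated_image[OF G] graph_image_flattening[OF G]] by simp
qed

lemma graph_image_degree: "G \<in> monomials S m n \<Longrightarrow> graph_degree S' (graph_image G) = graph_degree S G"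
  using graph_degree_flattening[OF graph_image_flattening, of G m n S']
  by (simp add: comp_def case_prod_beta' image_degree) (simp add: graph_degree_def case_prod_beta')

lemma graph_image_unique:
  assumes "G \<in> monomials S m n" "is_flattening (map_dgraph \<sigma> G) H"
  shows "bvec (graph_image G) - bvec H \<in> relation_ideal S' R'"
  by (rule ideal_flattenings[OF decorated_image[OF assms(1)] graph_image_flattening[OF assms(1)] assms(2)])

lemma induced_lincombs: "p \<in> lincombs S m n \<Longrightarrow> induced p \<in> lincombs S' m n"
proof -
  assume p: "p \<in> lincombs S m n"
  have "Poly_Mapping.keys (induced p) \<subseteq> graph_image ` Poly_Mapping.keys p"
    unfolding induced_def using keys_lin keys_scale by fastforce
  with p show ?thesis using graph_image_monomial unfolding lincombs_def by blast
qed

lemma induced_hom_lincombs: "p \<in> hom_lincombs S m n d \<Longrightarrow> induced p \<in> hom_lincombs S' m n d"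
proof -
  assume p: "p \<in> hom_lincombs S m n d"
  have "Poly_Mapping.keys (induced p) \<subseteq> graph_image ` Poly_Mapping.keys p"
    unfolding induced_def using keys_lin keys_scale by fastforce
  moreover have "graph_image G \<in> {G \<in> monomials S' m n. graph_degree S' G = d}" if "G \<in> Poly_Mapping.keys p" for G
    using p that graph_image_monomial[of G m n] graph_image_degree[of G m n] by (auto simp: hom_lincombs_def)
  ultimately show ?thesis unfolding hom_lincombs_def by blast
qed

text \<open>
  Both sides are multilinear in the decorations, so only monomials matter.  For these the two graphs
  are composites of the same graph of graphs by associativity, hence isomorphic, and the scalars
  multiply.
\<close>

theorem induced_graph_subst:
  assumes "decorated_by (lincombs S) \<Gamma>"
  shows "induced (graph_subst \<Gamma>) - graph_subst (map_dgraph induced \<Gamma>) \<in> relation_ideal S' R'"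
proof -
  obtain ps ls bs as where \<Gamma>: "\<Gamma> = DGraph (zip ps ls) bs as" and len: "length ps = length ls"
    by (rule dgraph_zip_cases)
  let ?Z = "\<lambda>Gs. DGraph (zip Gs ls) bs as" and ?Z' = "\<lambda>Gs. DGraph (zip Gs ls) bs as"
  let ?F = "\<lambda>G. scale (vertex_prod \<chi> G) (bvec (graph_image G))"
  have 1: "induced (graph_subst \<Gamma>) = mlin (\<lambda>Gs. ?F (flatten (?Z Gs))) ps"
    using len by (simp add: \<Gamma> induced_def graph_subst_mlin lin_mlin)
  have "graph_subst (map_dgraph induced \<Gamma>) = mlin (\<lambda>Hs. bvec (flatten (?Z' Hs))) (map induced ps)"
    using len by (simp only: \<Gamma> map_dgraph_zip graph_subst_mlin length_map)
  also have "\<dots> = mlin (\<lambda>Gs. scale (prod_list (map (vertex_prod \<chi>) Gs)) (bvec (flatten (?Z' (map graph_image Gs))))) ps"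
    unfolding induced_def mlin_map_lin mlin_map_scale_bvec ..
  finally have 2: "graph_subst (map_dgraph induced \<Gamma>) = \<dots>" .
  show ?thesis
    unfolding 1 2
  proof (rule ideal_mlin_cong)
    fix Gs assume Gs: "list_all2 (\<lambda>G p. G \<in> Poly_Mapping.keys p) Gs ps"
    then have len': "length Gs = length ls" using len by (auto dest: list_all2_lengthD)
    have dec: "decorated_by (monomials S) (?Z Gs)"
      using assms len len' Gs unfolding \<Gamma> decorated_by_zip[OF len] decorated_by_zip[OF len']
      by (fastforce simp: list_all2_conv_all_nth lincombs_def)
    let ?H = "flatten (?Z Gs)"
    note H = flatten_is_flattening[OF dec]
    have "vertex_prod \<chi> ?H = prod_list (map (vertex_prod \<chi>) Gs)"
    proof -
      have "map (\<lambda>(G, vo, vi). vertex_prod \<chi> G) (zip Gs ls) = map (vertex_prod \<chi>) Gs"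
        using len' by (induction Gs ls rule: list_induct2) auto
      then show ?thesis by (simp add: vertex_prod_flattening[OF H] vertex_prod_def[of "vertex_prod \<chi>"])
    qed
    moreover have "bvec (graph_image ?H) - bvec (flatten (?Z' (map graph_image Gs))) \<in> relation_ideal S' R'"
    proof (rule graph_image_unique[OF flattening_monomial[OF dec H]])
      have "decorated_by (monomials S') (map_dgraph graph_image (?Z Gs))"
        by (rule decorated_by_map[OF dec graph_image_monomial])
      then have H': "is_flattening (map_dgraph graph_image (?Z Gs)) (flatten (?Z' (map graph_image Gs)))"
        using flatten_is_flattening by (simp only: map_dgraph_zip) blast
      interpret connected_gluing "?Z Gs" by (rule connected_gluing_monomials[OF dec])
      show "is_flattening (map_dgraph \<sigma> ?H) (flatten (?Z' (map graph_image Gs)))"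
      proof (rule flattening_assoc[OF gluing_axioms H _ H'])
        fix G vo vi assume "(G, vo, vi) \<in> set (vertices (?Z Gs))"
        with dec have "G \<in> monomials S (length vo) (length vi)" by (auto simp: decorated_by_def)
        then show "is_flattening (map_dgraph \<sigma> G) (graph_image G)" by (rule graph_image_flattening)
      qed
    qed
    ultimately show "?F ?H - scale (prod_list (map (vertex_prod \<chi>) Gs)) (bvec (flatten (?Z' (map graph_image Gs))))
      \<in> relation_ideal S' R'"
      by (simp add: ideal_scale_cong)
  qed
qed

lemma induced_rename:
  assumes "G \<in> monomials S m n" "inj_on f (edges G)"
  shows "induced (bvec G - bvec (rename f G)) \<in> relation_ideal S' R'"
proof -
  have "is_flattening (map_dgraph \<sigma> (rename f G)) (graph_image G)"
    unfolding map_dgraph_rename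
    by (rule flattening_rename[OF graph_image_flattening[OF assms(1)]]) (use assms(2) in simp)
  from graph_image_unique[OF monomials_rename[OF assms] this]
  show ?thesis by (simp add: ideal_scale_cong ideal_sym)
qed

text \<open>
  Exchanging two generators exchanges the blocks of vertices inserted for them, which have the
  same degrees.
\<close>

lemma induced_swap:
  assumes "DGraph (vs @ (g, vo, vi) # (g', vo', vi') # ws) bs as \<in> monomials S m n" (is "?G \<in> _")
  shows "induced (bvec ?G - scale (koszul_sign (degree S g) (degree S g'))
    (bvec (DGraph (vs @ (g', vo', vi') # (g, vo, vi) # ws) bs as))) \<in> relation_ideal S' R'"
    (is "induced (_ - scale ?c (bvec ?G')) \<in> _")
proof -
  have G': "?G' \<in> monomials S m n" by (rule monomials_perm[OF assms]) simp
  let ?m = "map (\<lambda>(x, vo, vi). (\<sigma> x, vo, vi))"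
  have m: "vertices (map_dgraph \<sigma> (DGraph (vs @ (g, vo, vi) # (g', vo', vi') # ws) bs as))
    = ?m vs @ (\<sigma> g, vo, vi) # (\<sigma> g', vo', vi') # ?m ws" for g vo vi g' vo' vi'
    unfolding map_dgraph_simps by simp
  obtain f bl where H: "wf_dgraph (graph_image ?G)" "outs (graph_image ?G) = map f bs" "ins (graph_image ?G) = map f as"
    "vertices (graph_image ?G) = concat bl" "list_all2 (inserts f) (?m vs @ (\<sigma> g, vo, vi) # (\<sigma> g', vo', vi') # ?m ws) bl"
    using graph_image_flattening[OF assms] unfolding is_flattening_iff_inserts m by auto
  then obtain bl1 b b' bl2 where bl: "bl = bl1 @ b # b' # bl2" and
    ins: "list_all2 (inserts f) (?m vs) bl1" "inserts f (\<sigma> g, vo, vi) b" "inserts f (\<sigma> g', vo', vi') b'"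
      "list_all2 (inserts f) (?m ws) bl2"
    by (auto simp: list_all2_append1 list_all2_Cons1)
  let ?H = "DGraph (concat bl1 @ b @ b' @ concat bl2) (map f bs) (map f as)"
  let ?H' = "DGraph (concat bl1 @ b' @ b @ concat bl2) (map f bs) (map f as)"
  have H_eq: "graph_image ?G = ?H" using H bl by (cases "graph_image ?G") auto
  have deg: "vertices_degree S' b = degree S g" if "inserts f (\<sigma> g, vo, vi) b" for g vo vi b
    using that image_degree[of g]
    by (auto simp: inserts_def vertices_degree_def graph_degree_def comp_def case_prod_beta')
  have "wf_dgraph ?H'"
    using H(1) unfolding H_eq by (subst wf_dgraph_perm[of _ "concat bl1 @ b @ b' @ concat bl2"]) simp_all
  then have "is_flattening (map_dgraph \<sigma> ?G') ?H'"
    unfolding is_flattening_iff_inserts m using ins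
    by (intro conjI exI[of _ f] exI[of _ "bl1 @ b' # b # bl2"]) (simp_all add: list_all2_appendI)
  from graph_image_unique[OF G' this]
  have 1: "bvec ?H' - bvec (graph_image ?G') \<in> relation_ideal S' R'" by (rule ideal_sym)
  have "bvec ?H - scale ?c (bvec ?H') \<in> relation_ideal S' R'"
    using ideal_swap_blocks[of "concat bl1" b b' "concat bl2" "map f bs" "map f as" S' m n R']
      graph_image_monomial[OF assms] by (simp add: H_eq deg[OF ins(2)] deg[OF ins(3)])
  then have "bvec ?H - scale ?c (bvec (graph_image ?G')) \<in> relation_ideal S' R'"
    using ideal_scale_cong[OF 1] by (rule ideal_trans)
  moreover have "vertex_prod \<chi> ?G' = vertex_prod \<chi> ?G" by (simp add: vertex_prod_def mult.left_commute)
  ultimately show ?thesis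
    using ideal_scale_cong[of "bvec ?H" "scale ?c (bvec (graph_image ?G'))" S' R' "vertex_prod \<chi> ?G"]
    by (simp add: H_eq mult.commute)
qed

theorem induced_ideal:
  assumes rels: "\<And>r. r \<in> R \<Longrightarrow> induced r \<in> relation_ideal S' R'"
    and p: "p \<in> relation_ideal S R"
  shows "induced p \<in> relation_ideal S' R'"
  using p
proof induction
  case (comp \<Gamma> p vo vi)
  have "graph_subst (map_dgraph induced \<Gamma>) \<in> relation_ideal S' R'"
  proof (rule relation_ideal.comp[OF _ _ comp.IH])
    show "decorated_by (lincombs S') (map_dgraph induced \<Gamma>)"
      by (rule decorated_by_map[OF comp.hyps(1) induced_lincombs])
    show "(induced p, vo, vi) \<in> set (vertices (map_dgraph induced \<Gamma>))"
      using comp.hyps(2) by force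
  qed
  from relation_ideal.add[OF induced_graph_subst[OF comp.hyps(1)] this] show ?case by simp
qed (use rels induced_rename induced_swap in \<open>auto intro: relation_ideal.zero relation_ideal.add relation_ideal.scale
      simp del: induced_linear(3)\<close>)

end

section \<open>Isomorphisms of presented properads\<close>

lemma mem_coset_iff: "x \<in> p +o relation_ideal S R \<longleftrightarrow> x - p \<in> relation_ideal S R"
  by (force simp: elt_set_plus_def)

lemma coset_eq_iff: "p +o relation_ideal S R = q +o relation_ideal S R \<longleftrightarrow> p - q \<in> relation_ideal S R"
proof
  assume e: "p +o relation_ideal S R = q +o relation_ideal S R"
  have "p \<in> p +o relation_ideal S R"
    by (simp add: mem_coset_iff relation_ideal.zero)
  then show "p - q \<in> relation_ideal S R" unfolding e mem_coset_iff .
next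
  have *: "p +o relation_ideal S R \<subseteq> q +o relation_ideal S R" if "p - q \<in> relation_ideal S R" for p q
  proof
    fix x assume "x \<in> p +o relation_ideal S R"
    then obtain y where "y \<in> relation_ideal S R" "x = p + y" by (auto simp: elt_set_plus_def)
    with that show "x \<in> q +o relation_ideal S R"
      by (auto simp: elt_set_plus_def algebra_simps intro!: bexI[of _ "p - q + y"] relation_ideal.add)
  qed
  assume "p - q \<in> relation_ideal S R"
  then show "p +o relation_ideal S R = q +o relation_ideal S R"
    using * ideal_sym by (metis subset_antisym)
qed

lemma coset_add:
  "(p +o relation_ideal S R) + (q +o relation_ideal S R) = (p + q) +o relation_ideal S R"
proof (rule set_eqI)
  fix x
  have "x \<in> (p +o relation_ideal S R) + (q +o relation_ideal S R)
    \<longleftrightarrow> (\<exists>y\<in>relation_ideal S R. \<exists>z\<in>relation_ideal S R. x = (p + y) + (q + z))"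
    by (auto simp: set_plus_def elt_set_plus_def)
  also have "\<dots> \<longleftrightarrow> x - (p + q) \<in> relation_ideal S R"
  proof
    assume "\<exists>y\<in>relation_ideal S R. \<exists>z\<in>relation_ideal S R. x = (p + y) + (q + z)"
    then show "x - (p + q) \<in> relation_ideal S R"
      by (auto simp: algebra_simps intro: relation_ideal.add)
  next
    assume "x - (p + q) \<in> relation_ideal S R"
    then show "\<exists>y\<in>relation_ideal S R. \<exists>z\<in>relation_ideal S R. x = (p + y) + (q + z)"
      by (intro bexI[of _ "x - (p + q)"] bexI[of _ 0]) (simp_all add: relation_ideal.zero)
  qed
  finally show "x \<in> (p +o relation_ideal S R) + (q +o relation_ideal S R) \<longleftrightarrow> x \<in> (p + q) +o relation_ideal S R"
    by (simp add: mem_coset_iff)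
qed

lemma image_coset:
  assumes add: "\<And>p q. f (p + q) = f p + f q" and ideal: "\<And>p. p \<in> relation_ideal S R \<Longrightarrow> f p \<in> relation_ideal S' R'"
  shows "f ` (p +o relation_ideal S R) + relation_ideal S' R' = f p +o relation_ideal S' R'"
proof (rule set_eqI)
  fix x
  have "x \<in> f ` (p +o relation_ideal S R) + relation_ideal S' R' \<longleftrightarrow>
    (\<exists>y\<in>relation_ideal S R. \<exists>z\<in>relation_ideal S' R'. x = f (p + y) + z)"
    by (auto simp: set_plus_def elt_set_plus_def)
  also have "\<dots> \<longleftrightarrow> x - f p \<in> relation_ideal S' R'"
  proof
    assume "\<exists>y\<in>relation_ideal S R. \<exists>z\<in>relation_ideal S' R'. x = f (p + y) + z"
    then show "x - f p \<in> relation_ideal S' R'"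
      by (auto simp: add algebra_simps intro!: relation_ideal.add ideal)
  next
    assume "x - f p \<in> relation_ideal S' R'"
    then show "\<exists>y\<in>relation_ideal S R. \<exists>z\<in>relation_ideal S' R'. x = f (p + y) + z"
      by (intro bexI[of _ 0] bexI[of _ "x - f p"]) (simp_all add: relation_ideal.zero)
  qed
  finally show "x \<in> f ` (p +o relation_ideal S R) + relation_ideal S' R' \<longleftrightarrow> x \<in> f p +o relation_ideal S' R'"
    by (simp add: mem_coset_iff)
qed

lemma scale_coset:
  "scale c ` (p +o relation_ideal S R) + relation_ideal S R = scale c p +o relation_ideal S R"
  by (rule image_coset) (auto simp: scale_add intro: relation_ideal.scale)

text \<open>
  The union over all representatives in the definition of the composite is a single coset, because
  congruent decorations have congruent composites.
\<close>

lemma pcomp_presented: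
  assumes ps: "length ps = length ls" "length As = length ls"
    and dec: "decorated_by (lincombs S) (DGraph (zip ps ls) bs as)"
    and As: "As = map (\<lambda>p. p +o relation_ideal S R) ps"
  shows "pcomp (presented_properad S R) (DGraph (zip As ls) bs as)
    = graph_subst (DGraph (zip ps ls) bs as) +o relation_ideal S R"
proof -
  let ?X = "{\<Gamma>'. rel_dgraph (\<in>) \<Gamma>' (DGraph (zip As ls) bs as) \<and> decorated_by (lincombs S) \<Gamma>'}"
  have self: "p \<in> p +o relation_ideal S R" for p by (simp add: mem_coset_iff relation_ideal.zero)
  have X: "\<Gamma>' \<in> ?X \<longleftrightarrow> (\<exists>qs. \<Gamma>' = DGraph (zip qs ls) bs as \<and> list_all2 (\<in>) qs As \<and> decorated_by (lincombs S) \<Gamma>')" for \<Gamma>'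
    using rel_dgraph_zip[OF ps(2), of "(\<in>)" bs as] by auto
  have "graph_subst \<Gamma>' +o relation_ideal S R = graph_subst (DGraph (zip ps ls) bs as) +o relation_ideal S R"
    if mem: "\<Gamma>' \<in> ?X" for \<Gamma>'
  proof -
    obtain qs where qs: "\<Gamma>' = DGraph (zip qs ls) bs as" "list_all2 (\<in>) qs As" "decorated_by (lincombs S) \<Gamma>'"
      using mem unfolding X by blast
    then have "length qs = length ls" using ps by (auto dest: list_all2_lengthD)
    moreover have "list_all2 (\<lambda>p q. p - q \<in> relation_ideal S R) qs ps"
      using qs(2) by (simp add: As list.rel_map mem_coset_iff)
    ultimately show ?thesis
      unfolding coset_eq_iff qs(1) using qs dec ps by (intro graph_subst_cong) simp_all
  qed
  moreover have "DGraph (zip ps ls) bs as \<in> ?X"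
    unfolding X using dec self by (auto simp: As list.rel_map intro!: list.rel_refl)
  ultimately have "(\<Union>\<Gamma>'\<in>?X. graph_subst \<Gamma>' +o relation_ideal S R)
      = graph_subst (DGraph (zip ps ls) bs as) +o relation_ideal S R"
    by blast
  then show ?thesis
    unfolding presented_properad_def by simp
qed

locale presentation_iso =
  forward: presentation_map S R S' R' \<sigma> \<chi> + backward: presentation_map S' R' S R \<sigma>' \<chi>'
  for S :: "'g signature" and R :: "('g, 'k::comm_ring_1) lincomb set"
    and S' :: "'h signature" and R' :: "('h, 'k) lincomb set"
    and \<sigma> :: "'g \<Rightarrow> 'h dgraph" and \<chi> :: "'g \<Rightarrow> 'k" and \<sigma>' :: "'h \<Rightarrow> 'g dgraph" and \<chi>' :: "'h \<Rightarrow> 'k" +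
  assumes to_rels: "\<And>r. r \<in> R \<Longrightarrow> forward.induced r \<in> relation_ideal S' R'"
    and from_rels: "\<And>r. r \<in> R' \<Longrightarrow> backward.induced r \<in> relation_ideal S R"
    and from_to_generator: "\<And>g. backward.induced (forward.induced (bvec (corolla S g))) - bvec (corolla S g) \<in> relation_ideal S R"
begin

text \<open>
  A graph is the composite of its corollas, and both maps commute with composition.  So it is enough
  that going back and forth fixes each corolla up to the ideal.
\<close>

lemma from_to_graph:
  assumes G: "G \<in> monomials S m n"
  shows "backward.induced (forward.induced (bvec G)) - bvec G \<in> relation_ideal S R"
proof -
  let ?FG = "\<lambda>p. backward.induced (forward.induced p)"
  obtain gs ls bs as where G_eq: "G = DGraph (zip gs ls) bs as" and len: "length gs = length ls"
    by (rule dgraph_zip_cases)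
  let ?cs = "map (\<lambda>g. bvec (corolla S g)) gs :: ('g, 'k) lincomb list"
  let ?Z = "\<lambda>ps :: ('g, 'k) lincomb list. DGraph (zip ps ls) bs as"
  have dec0: "decorated_by (monomials S) (map_dgraph (corolla S) G)" by (rule decorated_corollas[OF G])
  have "decorated_by (lincombs S) (map_dgraph bvec (map_dgraph (corolla S) G) :: ('g, 'k) lincomb dgraph)"
    by (rule decorated_by_map[OF dec0]) (auto simp: lincombs_def)
  then have dec: "decorated_by (lincombs S) (?Z ?cs)"
    by (simp only: G_eq map_dgraph_zip map_map comp_def)
  have dec2: "decorated_by (lincombs S') (map_dgraph forward.induced (?Z ?cs))"
    by (rule decorated_by_map[OF dec forward.induced_lincombs])
  have dec3: "decorated_by (lincombs S) (map_dgraph backward.induced (map_dgraph forward.induced (?Z ?cs)))"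
    by (rule decorated_by_map[OF dec2 backward.induced_lincombs])
  have "graph_subst (?Z ?cs) = bvec (flatten (map_dgraph (corolla S) G))"
    using len mlin_map_bvec[of _ "map (corolla S) gs"] by (simp add: graph_subst_mlin G_eq map_dgraph_zip comp_def del: dgraph.map)
  moreover have "bvec (flatten (map_dgraph (corolla S) G)) - bvec G \<in> relation_ideal S R"
    using flattening_corollas[OF G, of id]
    by (intro ideal_flattenings[OF dec0 flatten_is_flattening[OF dec0]]) (simp add: rename_id)
  ultimately have 1: "graph_subst (?Z ?cs) - bvec G \<in> relation_ideal S R" by simp
  have 2: "?FG (graph_subst (?Z ?cs)) - graph_subst (map_dgraph backward.induced (map_dgraph forward.induced (?Z ?cs))) \<in> relation_ideal S R"
    using backward.induced_ideal[OF from_rels forward.induced_graph_subst[OF dec]] backward.induced_graph_subst[OF dec2]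
    by (auto intro: ideal_trans)
  have "graph_subst (?Z (map (\<lambda>g. ?FG (bvec (corolla S g))) gs)) - graph_subst (?Z ?cs) \<in> relation_ideal S R"
  proof (rule graph_subst_cong)
    show "decorated_by (lincombs S) (?Z (map (\<lambda>g. ?FG (bvec (corolla S g))) gs))"
      using dec3 by (simp only: map_dgraph_zip map_map comp_def)
    show "list_all2 (\<lambda>p q. p - q \<in> relation_ideal S R) (map (\<lambda>g. ?FG (bvec (corolla S g))) gs) ?cs"
      unfolding list.rel_map by (rule list.rel_refl) (rule from_to_generator)
  qed (use dec len in simp_all)
  then have 3: "graph_subst (map_dgraph backward.induced (map_dgraph forward.induced (?Z ?cs))) - graph_subst (?Z ?cs) \<in> relation_ideal S R"
    by (simp only: map_dgraph_zip map_map comp_def)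
  have 4: "?FG (graph_subst (?Z ?cs)) - ?FG (bvec G) \<in> relation_ideal S R"
    using backward.induced_ideal[OF from_rels forward.induced_ideal[OF to_rels 1]] by (simp del: forward.induced_linear(6))
  show ?thesis
    using ideal_trans[OF ideal_sym[OF 4] ideal_trans[OF 2 ideal_trans[OF 3 1]]] .
qed

lemma from_to:
  assumes "p \<in> lincombs S m n"
  shows "backward.induced (forward.induced p) - p \<in> relation_ideal S R"
proof -
  have "backward.induced (forward.induced p) = lin (\<lambda>G. backward.induced (forward.induced (bvec G))) p"
    by (simp add: forward.induced_def backward.induced_def lin_lin)
  then have "backward.induced (forward.induced p) - lin bvec p \<in> relation_ideal S R"
    using assms from_to_graph by (auto intro!: ideal_lin_cong simp: lincombs_def)
  then show ?thesis by (simp add: lin_identity)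
qed

end

text \<open>
  The induced maps descend to cosets since they preserve the ideals.  They are mutually inverse
  there, and compatible with composites because these are computed on representatives.
\<close>

theorem presented_properads_isomorphic:
  assumes "presentation_iso S R S' R' \<sigma> \<chi> \<sigma>' \<chi>'" "presentation_iso S' R' S R \<sigma>' \<chi>' \<sigma> \<chi>"
  shows "properads_isomorphic (presented_properad S R) (presented_properad S' R')"
proof -
  interpret A: presentation_iso S R S' R' \<sigma> \<chi> \<sigma>' \<chi>' by fact
  interpret B: presentation_iso S' R' S R \<sigma>' \<chi>' \<sigma> \<chi> by fact
  let ?P = "presented_properad S R" and ?Q = "presented_properad S' R'"
  let ?I = "relation_ideal S R" and ?J = "relation_ideal S' R'"
  let ?F = "A.forward.induced" and ?G = "A.backward.induced"
  define \<Phi> where "\<Phi> = (\<lambda>A. ?F ` A + ?J)"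
  have FI: "?F p \<in> ?J" if "p \<in> ?I" for p by (rule A.forward.induced_ideal[OF A.to_rels that])
  have GJ: "?G p \<in> ?I" if "p \<in> ?J" for p by (rule A.backward.induced_ideal[OF A.from_rels that])
  have \<Phi>: "\<Phi> (p +o ?I) = ?F p +o ?J" for p
    unfolding \<Phi>_def by (rule image_coset[OF _ FI]) simp_all
  have FG: "?F (?G q) - q \<in> ?J" if "q \<in> lincombs S' m n" for q m n
    by (rule B.from_to[OF that])
  have GF: "?G (?F p) - p \<in> ?I" if "p \<in> lincombs S m n" for p m n
    by (rule A.from_to[OF that])
  have coset_FG: "q +o ?J = \<Phi> (?G q +o ?I)" if "q \<in> lincombs S' m n" for q m n
    using FG[OF that] by (simp add: \<Phi> coset_eq_iff ideal_sym)
  have bij: "bij_betw \<Phi> (pspace ?P m n) (pspace ?Q m n)" for m n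
  proof (rule bij_betwI')
    fix X Y assume "X \<in> pspace ?P m n" "Y \<in> pspace ?P m n"
    then obtain p q where p: "X = p +o ?I" "p \<in> lincombs S m n" and q: "Y = q +o ?I" "q \<in> lincombs S m n"
      by (auto simp: presented_properad_def)
    have "p - q \<in> ?I" if "?F p - ?F q \<in> ?J"
    proof -
      have "?G (?F p) - ?G (?F q) \<in> ?I" using GJ[OF that] by simp
      then show ?thesis
        by (rule ideal_trans[OF ideal_sym[OF GF[OF p(2)]] ideal_trans[OF _ GF[OF q(2)]]])
    qed
    then show "(\<Phi> X = \<Phi> Y) = (X = Y)"
      using FI[of "p - q"] by (auto simp: p q \<Phi> coset_eq_iff)
  next
    fix X assume "X \<in> pspace ?P m n"
    then show "\<Phi> X \<in> pspace ?Q m n"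
      using A.forward.induced_lincombs by (force simp: presented_properad_def \<Phi>)
  next
    fix Y assume "Y \<in> pspace ?Q m n"
    then obtain q where "q \<in> lincombs S' m n" "Y = q +o ?J" by (auto simp: presented_properad_def)
    then show "\<exists>X\<in>pspace ?P m n. Y = \<Phi> X"
      using coset_FG A.backward.induced_lincombs by (auto simp: presented_properad_def)
  qed
  have hom: "\<Phi> ` phom ?P m n d = phom ?Q m n d" for m n d
  proof (intro equalityI subsetI)
    fix Y assume "Y \<in> \<Phi> ` phom ?P m n d"
    then obtain p where "p \<in> hom_lincombs S m n d" "Y = \<Phi> (p +o ?I)" by (auto simp: presented_properad_def)
    then show "Y \<in> phom ?Q m n d"
      using A.forward.induced_hom_lincombs by (auto simp: presented_properad_def \<Phi>)
  next
    fix Y assume "Y \<in> phom ?Q m n d"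
    then obtain q where q: "q \<in> hom_lincombs S' m n d" "Y = q +o ?J" by (auto simp: presented_properad_def)
    then have "q \<in> lincombs S' m n" by (auto simp: hom_lincombs_def lincombs_def)
    then show "Y \<in> \<Phi> ` phom ?P m n d"
      using q coset_FG A.backward.induced_hom_lincombs by (auto simp: presented_properad_def)
  qed
  have comp: "\<Phi> (pcomp ?P \<Gamma>) = pcomp ?Q (map_decoration (\<lambda>m n. \<Phi>) \<Gamma>)"
    if dec: "decorated_by (pspace ?P) \<Gamma>" for \<Gamma>
  proof -
    obtain As ls bs as where \<Gamma>: "\<Gamma> = DGraph (zip As ls) bs as" and len: "length As = length ls"
      by (rule dgraph_zip_cases)
    have shape: "connected_dag (DGraph (map (Pair ()) ls) bs as)"
      and "list_all2 (\<lambda>X l. X \<in> pspace ?P (length (fst l)) (length (snd l))) As ls"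
      using dec len by (auto simp: \<Gamma> decorated_by_zip)
    then have "\<forall>i<length ls. \<exists>p. As ! i = p +o ?I \<and> p \<in> lincombs S (length (fst (ls ! i))) (length (snd (ls ! i)))"
      by (simp add: list_all2_conv_all_nth presented_properad_def image_iff Bex_def conj_commute)
    then obtain pf where pf: "\<And>i. i < length ls \<Longrightarrow> As ! i = pf i +o ?I \<and>
        pf i \<in> lincombs S (length (fst (ls ! i))) (length (snd (ls ! i)))"
      by metis
    let ?ps = "map pf [0..<length ls]"
    have As: "As = map (\<lambda>p. p +o ?I) ?ps"
      by (rule nth_equalityI) (use len pf in auto)
    have decp: "decorated_by (lincombs S) (DGraph (zip ?ps ls) bs as)"
      using shape pf by (subst decorated_by_zip) (auto simp: list_all2_conv_all_nth)
    have "map_decoration (\<lambda>m n. \<Phi>) \<Gamma> = map_dgraph \<Phi> \<Gamma>"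
      by (cases \<Gamma>) (simp add: map_decoration_def case_prod_beta' map_prod_def)
    also have "\<dots> = DGraph (zip (map (\<lambda>p. p +o ?J) (map ?F ?ps)) ls) bs as"
      unfolding \<Gamma> map_dgraph_zip by (simp add: As \<Phi> comp_def)
    finally have "pcomp ?Q (map_decoration (\<lambda>m n. \<Phi>) \<Gamma>) = graph_subst (DGraph (zip (map ?F ?ps) ls) bs as) +o ?J"
      using decorated_by_map[OF decp A.forward.induced_lincombs]
      by (simp only: map_dgraph_zip) (rule pcomp_presented, simp_all)
    also have "\<dots> = ?F (graph_subst (DGraph (zip ?ps ls) bs as)) +o ?J"
      unfolding coset_eq_iff using A.forward.induced_graph_subst[OF decp]
      by (simp only: map_dgraph_zip ideal_sym)
    also have "\<dots> = \<Phi> (pcomp ?P \<Gamma>)"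
      unfolding \<Gamma> using pcomp_presented[OF _ len decp As] by (simp add: \<Phi>)
    finally show ?thesis by simp
  qed
  have "properad_iso ?P ?Q (\<lambda>m n. \<Phi>)"
    unfolding properad_iso_def
  proof (intro conjI allI ballI impI bij hom comp)
    fix m n X Y assume "X \<in> pspace ?P m n" "Y \<in> pspace ?P m n"
    then obtain p q where "X = p +o ?I" "Y = q +o ?I" by (auto simp: presented_properad_def)
    then show "\<Phi> (padd ?P X Y) = padd ?Q (\<Phi> X) (\<Phi> Y)"
      by (simp add: presented_properad_def coset_add \<Phi>)
  next
    fix m n c X assume "X \<in> pspace ?P m n"
    then obtain p where "X = p +o ?I" by (auto simp: presented_properad_def)
    then show "\<Phi> (psmult ?P c X) = psmult ?Q c (\<Phi> X)"
      by (simp add: presented_properad_def scale_coset \<Phi>)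
  qed
  then show ?thesis unfolding properads_isomorphic_def by blast
qed

section \<open>An executable criterion for connected acyclic graphs\<close>

type_synonym legs = "nat list \<times> nat list"

text \<open>
  Repeatedly remove a vertex none of whose outgoing edges enters a remaining vertex.  The number
  bounds the rounds and is instantiated with the number of vertices.
\<close>

fun acyclic_legs :: "nat \<Rightarrow> legs list \<Rightarrow> bool" where
  "acyclic_legs 0 ls \<longleftrightarrow> ls = []"
| "acyclic_legs (Suc n) ls \<longleftrightarrow> ls = [] \<or>
    (case find (\<lambda>(vo, vi). list_all (\<lambda>(wo, wi). list_all (\<lambda>e. e \<notin> set wi) vo) ls) ls of
      None \<Rightarrow> False | Some l \<Rightarrow> acyclic_legs n (remove1 l ls))"

text \<open>
  Grow a set of edges by all legs of a vertex that has a leg in it.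
\<close>

fun component :: "nat \<Rightarrow> nat list \<Rightarrow> legs list \<Rightarrow> nat list" where
  "component 0 es ls = es"
| "component (Suc n) es ls =
    (case find (\<lambda>(vo, vi). list_ex (\<lambda>e. e \<in> set es) (vo @ vi)) ls of
      None \<Rightarrow> es | Some l \<Rightarrow> component n (fst l @ snd l @ es) (remove1 l ls))"

definition connected_dag_legs :: "legs list \<Rightarrow> nat list \<Rightarrow> nat list \<Rightarrow> bool" where
  "connected_dag_legs ls bs as \<longleftrightarrow>
    (case (as @ concat (map fst ls), bs @ concat (map snd ls), length ls) of (srcs, tgts, n) \<Rightarrow>
       distinct srcs \<and> distinct tgts \<and> list_all (\<lambda>e. e \<in> set tgts) srcs \<and> list_all (\<lambda>e. e \<in> set srcs) tgts
       \<and> list_all (\<lambda>l. fst l \<noteq> []) ls \<and> bs \<noteq> [] \<and> acyclic_legs n ls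
       \<and> (case (component n [hd bs] ls, srcs) of (es, es') \<Rightarrow> list_all (\<lambda>e. e \<in> set es) es'))"

text \<open>
  The outgoing edges of the removed vertex are dead ends, so no cycle passes through it.
\<close>

lemma acyclic_legs_sound:
  "acyclic_legs n ls \<Longrightarrow> acyclic {(e, e'). \<exists>(vo, vi)\<in>set ls. e \<in> set vi \<and> e' \<in> set vo}"
proof (induction n arbitrary: ls)
  case 0
  then show ?case by (simp add: acyclic_def)
next
  case (Suc n)
  let ?r = "\<lambda>ls :: legs list. {(e, e'). \<exists>(vo, vi)\<in>set ls. e \<in> set vi \<and> e' \<in> set vo}"
  show ?case
  proof (cases "ls = []")
    case False
    with Suc.prems obtain l where l: "find (\<lambda>(vo, vi). list_all (\<lambda>(wo, wi). list_all (\<lambda>e. e \<notin> set wi) vo) ls) ls = Some l"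
      and IH: "acyclic (?r (remove1 l ls))"
      using Suc.IH by (auto split: option.splits)
    obtain vo vi where vovi: "l = (vo, vi)" by (cases l)
    have mem: "(vo, vi) \<in> set ls" and sink: "\<And>wo wi e. (wo, wi) \<in> set ls \<Longrightarrow> e \<in> set vo \<Longrightarrow> e \<notin> set wi"
      using l by (auto simp: find_Some_iff list_all_iff vovi) (metis nth_mem)
    have sub: "?r ls \<subseteq> ?r (remove1 l ls) \<union> set vi \<times> set vo"
    proof
      fix p assume "p \<in> ?r ls"
      then obtain wo wi where w: "(wo, wi) \<in> set ls" "fst p \<in> set wi" "snd p \<in> set wo" by auto
      show "p \<in> ?r (remove1 l ls) \<union> set vi \<times> set vo"
      proof (cases "(wo, wi) = l")
        case False
        then have "(wo, wi) \<in> set (remove1 l ls)" using w(1) by (simp add: in_set_remove1)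
        then show ?thesis using w by (cases p) auto
      qed (use w vovi in \<open>cases p; auto\<close>)
    qed
    have end_vo: "(a, b) \<notin> ?r ls" if "a \<in> set vo" for a b
      using sink that by auto
    have "acyclic (?r ls)"
    proof (rule acyclicI, rule allI, rule notI)
      fix x assume x: "(x, x) \<in> (?r ls)\<^sup>+"
      \<comment> \<open>A path that uses the removed vertex must end there.\<close>
      have key: "(a, b) \<in> (?r (remove1 l ls))\<^sup>+ \<or> b \<in> set vo" if "(a, b) \<in> (?r ls)\<^sup>+" for a b
        using that
      proof (induction rule: trancl_induct)
        case (base y)
        then show ?case using sub by blast
      next
        case (step y z)
        have "y \<notin> set vo" using end_vo step.hyps(2) by blast
        with step.IH have "(a, y) \<in> (?r (remove1 l ls))\<^sup>+" by blast
        moreover have "(y, z) \<in> ?r (remove1 l ls) \<or> z \<in> set vo" using sub step.hyps(2) by blast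
        ultimately show ?case by (meson trancl.trancl_into_trancl)
      qed
      have "x \<notin> set vo" using x end_vo by (meson tranclD)
      with key[OF x] IH show False by (auto simp: acyclic_def)
    qed
    then show ?thesis .
  qed (simp add: acyclic_def)
qed

lemma component_sound:
  assumes "\<And>l. l \<in> set ls \<Longrightarrow> (set (fst l) \<union> set (snd l)) \<times> (set (fst l) \<union> set (snd l)) \<subseteq> r"
    and "\<And>e. e \<in> set es \<Longrightarrow> (e0, e) \<in> r\<^sup>*" "e \<in> set (component n es ls)"
  shows "(e0, e) \<in> r\<^sup>*"
  using assms
proof (induction n arbitrary: es ls)
  case (Suc n)
  show ?case
  proof (cases "find (\<lambda>(vo, vi). list_ex (\<lambda>e. e \<in> set es) (vo @ vi)) ls")
    case None
    then show ?thesis using Suc.prems by simp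
  next
    case (Some l)
    then have l: "l \<in> set ls" "\<exists>e\<in>set (fst l) \<union> set (snd l). e \<in> set es"
      by (cases l; auto simp: find_Some_iff list_ex_iff; metis nth_mem)+
    then obtain a where a: "a \<in> set (fst l) \<union> set (snd l)" "(e0, a) \<in> r\<^sup>*" using Suc.prems(2) by blast
    have new: "(e0, e) \<in> r\<^sup>*" if "e \<in> set (fst l) \<union> set (snd l)" for e
      using a Suc.prems(1)[OF l(1)] that by (meson SigmaI rtrancl.rtrancl_into_rtrancl subset_iff)
    have "e \<in> set (component n (fst l @ snd l @ es) (remove1 l ls))" using Suc.prems(3) Some by simp
    moreover have "l' \<in> set ls" if "l' \<in> set (remove1 l ls)" for l'
      using that set_remove1_subset by fastforce
    moreover have "(e0, e) \<in> r\<^sup>*" if "e \<in> set (fst l @ snd l @ es)" for e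
      using that new Suc.prems(2) by auto
    ultimately show ?thesis
      using Suc.IH[of "remove1 l ls" "fst l @ snd l @ es"] Suc.prems(1) by metis
  qed
qed simp

lemma connected_dag_legs_sound:
  assumes "connected_dag_legs (map snd vs) bs as"
  shows "connected_dag (DGraph vs bs as)"
proof -
  let ?G = "DGraph vs bs as"
  have src: "edge_sources ?G = as @ concat (map fst (map snd vs))"
    and tgt: "edge_targets ?G = bs @ concat (map snd (map snd vs))"
    by (simp_all add: edge_sources_def edge_targets_def comp_def case_prod_beta')
  have wf: "wf_dgraph ?G" and ne: "\<forall>v\<in>set vs. fst (snd v) \<noteq> []" "bs \<noteq> []"
    and ac: "acyclic_legs (length vs) (map snd vs)"
    and conn: "\<forall>e\<in>set (edge_sources ?G). e \<in> set (component (length vs) [hd bs] (map snd vs))"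
    using assms unfolding connected_dag_legs_def src[symmetric] tgt[symmetric] wf_dgraph_def
    by (auto simp: list_all_iff)
  have "flow ?G = {(e, e'). \<exists>(vo, vi)\<in>set (map snd vs). e \<in> set vi \<and> e' \<in> set vo}"
    by (simp add: flow_def case_prod_beta')
  then have acyclic: "acyclic (flow ?G)" using acyclic_legs_sound[OF ac] by simp
  have sym: "sym ((adjacent ?G)\<^sup>*)"
    by (rule sym_rtrancl) (auto simp: sym_def adjacent_def)
  have reach: "(hd bs, e) \<in> (adjacent ?G)\<^sup>*" if "e \<in> edges ?G" for e
  proof (rule component_sound)
    show "e \<in> set (component (length vs) [hd bs] (map snd vs))"
      using that conn edges_wf(1)[OF wf] by blast
    show "(set (fst l) \<union> set (snd l)) \<times> (set (fst l) \<union> set (snd l)) \<subseteq> adjacent ?G" if "l \<in> set (map snd vs)" for l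
      using that by (force simp: adjacent_def case_prod_beta')
  qed simp
  have "(e, e') \<in> (adjacent ?G)\<^sup>*" if "e \<in> edges ?G" "e' \<in> edges ?G" for e e'
    using reach[OF that(1)] reach[OF that(2)] sym by (meson rtrancl_trans symD)
  moreover have "edges ?G \<noteq> {}" using ne(2) by (auto simp: edges_def edge_targets_def)
  ultimately show ?thesis
    using wf acyclic ne(1) by (auto simp: connected_dag_def)
qed

definition is_monomial :: "'g signature \<Rightarrow> nat \<Rightarrow> nat \<Rightarrow> 'g dgraph \<Rightarrow> bool" where
  "is_monomial S m n G \<longleftrightarrow> connected_dag_legs (map snd (vertices G)) (outs G) (ins G)
    \<and> list_all (\<lambda>(g, vo, vi). length vo = out_arity S g \<and> length vi = in_arity S g) (vertices G)
    \<and> length (outs G) = m \<and> length (ins G) = n"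

lemma is_monomial_sound: "is_monomial S m n G \<Longrightarrow> G \<in> monomials S m n"
  using connected_dag_legs_sound[of "vertices G" "outs G" "ins G"]
  by (auto simp: is_monomial_def monomials_def list_all_iff)

section \<open>Rewriting graphs modulo the relations\<close>

text \<open>
  The sign \<open>c = 0\<close> is allowed and expresses that \<open>G\<close> vanishes; then \<open>H\<close> is arbitrary.
\<close>

definition signed_eq :: "'g signature \<Rightarrow> ('g, 'k::comm_ring_1) lincomb set \<Rightarrow> int \<Rightarrow> 'g dgraph \<Rightarrow> 'g dgraph \<Rightarrow> bool" where
  "signed_eq S R c G H \<longleftrightarrow> bvec G - scale (of_int c) (bvec H) \<in> relation_ideal S R"

lemma signed_eq_refl: "signed_eq S R 1 G G"
  by (simp add: signed_eq_def relation_ideal.zero)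

lemma signed_eq_trans: "signed_eq S R c G H \<Longrightarrow> signed_eq S R d H K \<Longrightarrow> signed_eq S R (c * d) G K"
  using ideal_trans[OF _ ideal_scale_cong[of "bvec H" "scale (of_int d) (bvec K)" S R "of_int c"], of "bvec G"]
  by (simp add: signed_eq_def)

lemma signed_eq_sym:
  fixes R :: "('g, 'k::comm_ring_1) lincomb set"
  assumes GH: "signed_eq S R c G H" and c: "c * c = 1"
  shows "signed_eq S R c H G"
proof -
  have "scale (of_int c) (bvec G) - scale (of_int c) (scale (of_int c) (bvec H)) \<in> relation_ideal S R"
    using GH unfolding signed_eq_def by (rule ideal_scale_cong)
  moreover have "(of_int c * of_int c :: 'k) = 1" using c by (metis of_int_1 of_int_mult)
  ultimately show ?thesis using ideal_sym by (fastforce simp: signed_eq_def)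
qed

lemma signed_eq_isomorphic:
  "G \<in> monomials S m n \<Longrightarrow> inj_on f (edges G) \<Longrightarrow> signed_eq S R 1 G (rename f G)"
  unfolding signed_eq_def using relation_ideal.rename by simp

lemma signed_eq_flattenings:
  "decorated_by (monomials S) \<Delta> \<Longrightarrow> is_flattening \<Delta> H \<Longrightarrow> is_flattening \<Delta> H' \<Longrightarrow> signed_eq S R 1 H H'"
  unfolding signed_eq_def using ideal_flattenings by simp

text \<open>
  The positions are used in turn: each refers to the list in which the vertices pulled before have
  already been moved.
\<close>

fun pull_front :: "'g signature \<Rightarrow> nat list \<Rightarrow> ('g \<times> nat list \<times> nat list) list \<Rightarrow> int \<times> ('g \<times> nat list \<times> nat list) list" where
  "pull_front S [] vs = (1, vs)"
| "pull_front S (k # ks) vs =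
    (case pull_front S ks (vs ! k # take k vs @ drop (Suc k) vs) of
      (c, ws) \<Rightarrow> (koszul_sign (vertices_degree S (take k vs)) (degree S (fst (vs ! k))) * c, ws))"

lemma of_int_koszul_sign: "of_int (koszul_sign d e) = koszul_sign d e"
  by (simp add: koszul_sign_def)

lemma pull_front_sound:
  assumes "pull_front S ks vs = (c, ws)" "list_all (\<lambda>k. k < length vs) ks" "DGraph vs bs as \<in> monomials S m n"
  shows "signed_eq S R c (DGraph vs bs as) (DGraph ws bs as) \<and> DGraph ws bs as \<in> monomials S m n"
  using assms
proof (induction ks arbitrary: vs c)
  case (Cons k ks)
  let ?us = "vs ! k # take k vs @ drop (Suc k) vs"
  obtain d where d: "pull_front S ks ?us = (d, ws)" "c = koszul_sign (vertices_degree S (take k vs)) (degree S (fst (vs ! k))) * d"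
    using Cons.prems(1) by (auto simp: Let_def split: prod.splits)
  have k: "k < length vs" using Cons.prems(2) by simp
  have vs: "vs = take k vs @ [vs ! k] @ drop (Suc k) vs" using id_take_nth_drop[OF k] by simp
  have len: "length ?us = length vs" using k by simp
  have "mset vs = mset ?us" by (subst vs) simp
  then have us: "DGraph ?us bs as \<in> monomials S m n" using monomials_perm[OF Cons.prems(3)] by blast
  have "signed_eq S R (koszul_sign (vertices_degree S (take k vs)) (degree S (fst (vs ! k)))) (DGraph vs bs as) (DGraph ?us bs as)"
    using ideal_swap_blocks[of "[]" "take k vs" "[vs ! k]" "drop (Suc k) vs" bs as S m n R] Cons.prems(3) vs
    by (cases "vs ! k") (simp add: signed_eq_def of_int_koszul_sign)
  moreover have "signed_eq S R d (DGraph ?us bs as) (DGraph ws bs as) \<and> DGraph ws bs as \<in> monomials S m n"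
    by (rule Cons.IH[OF d(1) _ us]) (use Cons.prems(2) len in \<open>simp add: list_all_iff\<close>)
  ultimately show ?case using signed_eq_trans d(2) by blast
qed (simp add: signed_eq_refl)

abbreviation rename_vertices :: "(nat \<Rightarrow> nat) \<Rightarrow> ('g \<times> nat list \<times> nat list) list \<Rightarrow> ('g \<times> nat list \<times> nat list) list" where
  "rename_vertices f \<equiv> map (\<lambda>(x, vo, vi). (x, map f vo, map f vi))"

definition vertex_edges :: "('g \<times> nat list \<times> nat list) list \<Rightarrow> nat list" where
  "vertex_edges vs = concat (map (\<lambda>(x, vo, vi). vo @ vi) vs)"

text \<open>
  Edges outside the table are shifted by \<open>k\<close>.  A large \<open>k\<close> makes their names fresh, and \<open>k = 0\<close> leaves them
  unchanged.
\<close>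

definition edge_map :: "nat list \<Rightarrow> nat list \<Rightarrow> nat \<Rightarrow> nat \<Rightarrow> nat" where
  "edge_map es es' k e = (case map_of (zip es es') e of None \<Rightarrow> k + e | Some e' \<Rightarrow> e')"

text \<open>
  The rule \<open>(L, c, L')\<close> replaces \<open>L\<close> by \<open>c L'\<close>.  A graph \<open>L\<close> that vanishes gives the rule \<open>(L, 0, L)\<close>.
\<close>

type_synonym 'g rule = "'g dgraph \<times> int \<times> 'g dgraph"

definition valid_rule :: "'g signature \<Rightarrow> ('g, 'k::comm_ring_1) lincomb set \<Rightarrow> 'g rule \<Rightarrow> bool" where
  "valid_rule S R = (\<lambda>(L, c, L'). signed_eq S R c L L'
    \<and> (\<exists>m n. L \<in> monomials S m n \<and> L' \<in> monomials S m n))"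

text \<open>
  The left-hand side has to match an initial segment \<open>us\<close> of the vertices.  It occupies one vertex with
  legs \<open>vo\<close> and \<open>vi\<close> of a graph of graphs whose shape must be connected and acyclic; contracting a
  subgraph may create a cycle.  The right-hand side is then inserted at that vertex.  If it is a
  strand, two edges of the context are glued, which is the purpose of \<open>f\<close>; in the other cases \<open>f\<close> is the
  identity.  The intermediate values are bound by \<open>case\<close> and not by \<open>let\<close>, so that evaluation by
  rewriting computes each of them only once.
\<close>

definition rewrite_front :: "'g rule \<Rightarrow> 'g dgraph \<Rightarrow> (int \<times> 'g dgraph) option" where
  "rewrite_front = (\<lambda>(L, c, L') G.
    case (take (length (vertices L)) (vertices G), drop (length (vertices L)) (vertices G)) of (us, post) \<Rightarrow>
    case (edge_map (vertex_edges (vertices L)) (vertex_edges us) 0,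
          Suc (foldr max (outs G @ ins G @ vertex_edges (vertices G)) 0)) of (h, N) \<Rightarrow>
    if rename_vertices h (vertices L) \<noteq> us then None else
    case (map h (outs L), map h (ins L)) of (vo, vi) \<Rightarrow>
    if \<not> connected_dag_legs ((vo, vi) # map snd post) (outs G) (ins G) then None else
    case (edge_map (outs L' @ ins L') (vo @ vi) N,
          edge_map vi (map (edge_map (outs L' @ ins L') (vo @ vi) N) (ins L')) 0) of (h', f) \<Rightarrow>
    if map h' (outs L') \<noteq> map f vo \<or> map h' (ins L') \<noteq> map f vi then None else
    case (c, DGraph (rename_vertices h' (vertices L') @ rename_vertices f post) (map f (outs G)) (map f (ins G))) of (c, H) \<Rightarrow>
    if wf_dgraph H then Some (c, H) else None)"

text \<open>
  Both graphs are composites over the same shape, with the two sides of the rule at the first vertex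
  and corollas at the others.
\<close>

lemma signed_eq_context:
  fixes R :: "('g, 'k::comm_ring_1) lincomb set"
  assumes eq: "signed_eq S R c L L'" and L: "L \<in> monomials S m n" "L' \<in> monomials S m n"
    and vs: "\<And>g wo wi. (g, wo, wi) \<in> set vs \<Longrightarrow> wo \<noteq> [] \<and> length wo = out_arity S g \<and> length wi = in_arity S g"
    and legs: "length vo = m" "length vi = n" and shape: "connected_dag (DGraph (map (Pair ()) ((vo, vi) # map snd vs)) bs as)"
    and G: "is_flattening (DGraph ((L, vo, vi) # map (\<lambda>(g, wo, wi). (corolla S g, wo, wi)) vs) bs as) G"
    and H: "is_flattening (DGraph ((L', vo, vi) # map (\<lambda>(g, wo, wi). (corolla S g, wo, wi)) vs) bs as) H"
  shows "signed_eq S R c G H \<and> H \<in> monomials S (length bs) (length as)"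
proof -
  let ?cs = "map (corolla S \<circ> fst) vs" and ?ls = "(vo, vi) # map snd vs"
  let ?Z = "\<lambda>ps :: ('g, 'k) lincomb list. DGraph (zip ps ?ls) bs as"
  let ?Y = "\<lambda>Gs :: 'g dgraph list. DGraph (zip Gs ?ls) bs as"
  have zip: "DGraph ((K, vo, vi) # map (\<lambda>(g, wo, wi). (corolla S g, wo, wi)) vs) bs as = ?Y (K # ?cs)" for K
    by (simp add: zip_map1 zip_map2 zip_same_conv_map case_prod_beta' comp_def)
  have len: "length (K # ?cs) = length ?ls" for K by simp
  have cs: "list_all2 (\<lambda>x l. x \<in> monomials S (length (fst l)) (length (snd l))) ?cs (map snd vs)"
    unfolding list.rel_map
  proof (rule list.rel_refl_strong)
    fix v assume "v \<in> set vs"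
    then show "(corolla S \<circ> fst) v \<in> monomials S (length (fst (snd v))) (length (snd (snd v)))"
      using vs[of "fst v" "fst (snd v)" "snd (snd v)"] corolla_monomial[of S "fst v"]
      by (simp add: comp_def) (metis length_greater_0_conv)
  qed
  have Y: "decorated_by (monomials S) (?Y (K # ?cs))" if "K \<in> monomials S m n" for K
    using that cs shape legs by (subst decorated_by_zip) simp_all
  have bvecs: "map bvec (K # Ks) = bvec K # map bvec Ks" for K :: "'g dgraph" and Ks by simp
  have Z: "decorated_by (lincombs S) (?Z (scale d (bvec K) # map bvec ?cs))" if "K \<in> monomials S m n" for K d
  proof -
    have "scale d (bvec K) \<in> lincombs S m n" using that keys_scale[of d "bvec K"] by (auto simp: lincombs_def)
    moreover have "list_all2 (\<lambda>x l. x \<in> lincombs S (length (fst l)) (length (snd l))) (map bvec ?cs) (map snd vs)"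
      using cs unfolding list.rel_map by (rule list_all2_mono) (auto simp: lincombs_def)
    ultimately show ?thesis using shape legs by (subst decorated_by_zip) simp_all
  qed
  have subst: "graph_subst (?Z (scale d (bvec K) # map bvec ?cs)) = scale d (bvec (flatten (?Y (K # ?cs))))" for K d
    using mlin_map_bvec[of "\<lambda>Gs. bvec (flatten (?Y (K # Gs))) :: ('g, 'k) lincomb" ?cs]
    by (subst graph_subst_mlin) (simp_all add: lin_scale)
  have "graph_subst (?Z (scale 1 (bvec L) # map bvec ?cs)) - graph_subst (?Z (scale (of_int c) (bvec L') # map bvec ?cs))
    \<in> relation_ideal S R"
  proof (rule graph_subst_cong[OF Z[OF L(1)] Z[OF L(2)]])
    show "list_all2 (\<lambda>p q. p - q \<in> relation_ideal S R) (scale 1 (bvec L) # map bvec ?cs)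
      (scale (of_int c) (bvec L') # map bvec ?cs)"
      using eq by (auto simp: signed_eq_def relation_ideal.zero intro!: list.rel_refl)
  qed simp_all
  then have "signed_eq S R c (flatten (?Y (L # ?cs))) (flatten (?Y (L' # ?cs)))"
    unfolding subst by (simp add: signed_eq_def)
  moreover have "signed_eq S R 1 G (flatten (?Y (L # ?cs)))"
    using signed_eq_flattenings[OF Y[OF L(1)] G[unfolded zip] flatten_is_flattening[OF Y[OF L(1)]]] .
  moreover have "signed_eq S R 1 (flatten (?Y (L' # ?cs))) H"
    using signed_eq_flattenings[OF Y[OF L(2)] flatten_is_flattening[OF Y[OF L(2)]] H[unfolded zip]] .
  ultimately have "signed_eq S R c G H"
    using signed_eq_trans[of S R 1 G "flatten (?Y (L # ?cs))" c "flatten (?Y (L' # ?cs))"]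
      signed_eq_trans[of S R c G "flatten (?Y (L' # ?cs))" 1 H] by simp
  moreover have "H \<in> monomials S (length bs) (length as)"
    using flattening_monomial[OF Y[OF L(2)] H[unfolded zip]] by simp
  ultimately show ?thesis ..
qed

lemma rewrite_front_sound:
  assumes rule: "valid_rule S R r" and G: "G \<in> monomials S m n" and step: "rewrite_front r G = Some (c, H)"
  shows "signed_eq S R c G H \<and> H \<in> monomials S m n"
proof -
  obtain L d L' where r: "r = (L, d, L')" by (cases r)
  obtain vs bs as where G_eq: "G = DGraph vs bs as" by (cases G)
  define us post where "us = take (length (vertices L)) vs" and "post = drop (length (vertices L)) vs"
  define h where "h = edge_map (vertex_edges (vertices L)) (vertex_edges us) 0"
  define vo vi where "vo = map h (outs L)" and "vi = map h (ins L)"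
  define h' where "h' = edge_map (outs L' @ ins L') (vo @ vi) (Suc (foldr max (bs @ as @ vertex_edges vs) 0))"
  define f where "f = edge_map vi (map h' (ins L')) 0"
  have c: "c = d" and H: "H = DGraph (rename_vertices h' (vertices L') @ rename_vertices f post) (map f bs) (map f as)"
    and heads: "rename_vertices h (vertices L) = us"
    and glue': "map h' (outs L') = map f vo" "map h' (ins L') = map f vi"
    and shape: "connected_dag_legs ((vo, vi) # map snd post) bs as" and wf_H: "wf_dgraph H"
    using step unfolding r G_eq rewrite_front_def prod.case dgraph.sel
      us_def[symmetric] post_def[symmetric] h_def[symmetric] vo_def[symmetric] vi_def[symmetric] h'_def[symmetric] f_def[symmetric]
    by (simp_all only: option.inject prod.inject split: if_splits) simp_all
  have vs: "vs = us @ post" by (simp add: us_def post_def)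
  from rule obtain m' n' where L: "signed_eq S R d L L'" "L \<in> monomials S m' n'" "L' \<in> monomials S m' n'"
    by (auto simp: valid_rule_def r)
  have arity: "wo \<noteq> [] \<and> length wo = out_arity S g \<and> length wi = in_arity S g" if "(g, wo, wi) \<in> set post" for g wo wi
  proof -
    have "(g, wo, wi) \<in> set vs" using that by (simp add: vs)
    then show ?thesis using G by (auto simp: G_eq monomials_def connected_dag_def)
  qed
  have concat_single: "concat (map (\<lambda>v. [t v]) ws) = map t ws" for t :: "'a \<times> nat list \<times> nat list \<Rightarrow> 'a \<times> nat list \<times> nat list" and ws
    by (induction ws) auto
  have post: "list_all2 (inserts k) (map (\<lambda>(g, wo, wi). (corolla S g, wo, wi)) post)
     (map (\<lambda>(g, wo, wi). [(g, map k wo, map k wi)]) post)" for k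
    unfolding list.rel_map
    by (rule list.rel_refl_strong) (use arity in \<open>auto intro!: corolla_inserts\<close>)
  have "is_flattening (DGraph ((L, vo, vi) # map (\<lambda>(g, wo, wi). (corolla S g, wo, wi)) post) bs as) G"
    unfolding is_flattening_iff_inserts
  proof (intro conjI exI[of _ id] exI[of _ "us # map (\<lambda>(g, wo, wi). [(g, map id wo, map id wi)]) post"])
    have "inserts id (L, vo, vi) us"
      unfolding inserts_def by (auto simp: heads vo_def vi_def intro!: exI[of _ h])
    then show "list_all2 (inserts id) (vertices (DGraph ((L, vo, vi) # map (\<lambda>(g, wo, wi). (corolla S g, wo, wi)) post) bs as))
      (us # map (\<lambda>(g, wo, wi). [(g, map id wo, map id wi)]) post)"
      using post[of id] by simp
  qed (use G in \<open>simp_all add: G_eq vs monomials_def connected_dag_def case_prod_beta' concat_single\<close>)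
  moreover have "is_flattening (DGraph ((L', vo, vi) # map (\<lambda>(g, wo, wi). (corolla S g, wo, wi)) post) bs as) H"
    unfolding is_flattening_iff_inserts
  proof (intro conjI exI[of _ f] exI[of _ "rename_vertices h' (vertices L') # map (\<lambda>(g, wo, wi). [(g, map f wo, map f wi)]) post"])
    have "inserts f (L', vo, vi) (rename_vertices h' (vertices L'))"
      unfolding inserts_def using glue' by (auto intro!: exI[of _ h'])
    then show "list_all2 (inserts f) (vertices (DGraph ((L', vo, vi) # map (\<lambda>(g, wo, wi). (corolla S g, wo, wi)) post) bs as))
      (rename_vertices h' (vertices L') # map (\<lambda>(g, wo, wi). [(g, map f wo, map f wi)]) post)"
      using post[of f] by simp
  qed (use wf_H in \<open>simp_all add: H case_prod_beta' concat_single\<close>)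
  moreover have "connected_dag (DGraph (map (Pair ()) ((vo, vi) # map snd post)) bs as)"
    by (rule connected_dag_legs_sound) (use shape in \<open>simp add: comp_def\<close>)
  moreover have "length vo = m'" "length vi = n'" using L(2) by (simp_all add: vo_def vi_def monomials_def)
  ultimately have "signed_eq S R d G H \<and> H \<in> monomials S (length bs) (length as)"
    using signed_eq_context[OF L, of post vo vi bs as G H] arity by blast
  then show ?thesis using G c by (simp add: G_eq monomials_def)
qed

fun rewrite_chain :: "'g signature \<Rightarrow> ('g rule \<times> nat list) list \<Rightarrow> 'g dgraph \<Rightarrow> (int \<times> 'g dgraph) option" where
  "rewrite_chain S [] G = Some (1, G)"
| "rewrite_chain S ((r, ks) # steps) G =
    (if list_all (\<lambda>k. k < length (vertices G)) ks then
      (case pull_front S ks (vertices G) of (s, vs) \<Rightarrow>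
       case rewrite_front r (DGraph vs (outs G) (ins G)) of
         None \<Rightarrow> None
       | Some (c, H) \<Rightarrow> (case rewrite_chain S steps H of None \<Rightarrow> None | Some (d, K) \<Rightarrow> Some (s * c * d, K)))
     else None)"

lemma rewrite_chain_sound:
  assumes "rewrite_chain S steps G = Some (c, H)" "\<And>r ks. (r, ks) \<in> set steps \<Longrightarrow> valid_rule S R r" "G \<in> monomials S m n"
  shows "signed_eq S R c G H \<and> H \<in> monomials S m n"
  using assms
proof (induction steps arbitrary: G c)
  case Nil
  then show ?case by (simp add: signed_eq_refl)
next
  case (Cons step steps)
  obtain r ks where step: "step = (r, ks)" by (cases step)
  obtain s vs where pull: "pull_front S ks (vertices G) = (s, vs)" by (cases "pull_front S ks (vertices G)")
  have ks: "list_all (\<lambda>k. k < length (vertices G)) ks"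
    using Cons.prems(1) by (auto simp: step split: if_splits)
  obtain d K e where K: "rewrite_front r (DGraph vs (outs G) (ins G)) = Some (d, K)"
    and e: "rewrite_chain S steps K = Some (e, H)" "c = s * d * e"
    using Cons.prems(1) ks by (auto simp: step pull split: option.splits)
  let ?G = "DGraph vs (outs G) (ins G)"
  have 1: "signed_eq S R s G ?G \<and> ?G \<in> monomials S m n"
    using pull_front_sound[OF pull ks, of "outs G" "ins G" m n R] Cons.prems(3) by simp
  have 2: "signed_eq S R d ?G K \<and> K \<in> monomials S m n"
    by (rule rewrite_front_sound[OF _ _ K]) (use Cons.prems(2)[of r ks] 1 in \<open>auto simp: step\<close>)
  have 3: "signed_eq S R e K H \<and> H \<in> monomials S m n"
    by (rule Cons.IH[OF e(1)]) (use Cons.prems(2) 2 in auto)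
  show ?case using 1 2 3 e(2) signed_eq_trans by metis
qed

text \<open>
  Each rule comes with the positions of the vertices to be pulled to the front before it is applied.
  The list \<open>ks\<close> reorders the vertices of the final graph such that it becomes a renaming of \<open>T\<close>.
\<close>

definition proves_eq :: "'g signature \<Rightarrow> ('g rule \<times> nat list) list \<Rightarrow> nat list \<Rightarrow> int \<Rightarrow> 'g dgraph \<Rightarrow> 'g dgraph \<Rightarrow> bool" where
  "proves_eq S steps ks c G T \<longleftrightarrow> (case rewrite_chain S steps G of None \<Rightarrow> False | Some (d, H) \<Rightarrow>
     d = 0 \<and> c = 0 \<or> list_all (\<lambda>k. k < length (vertices H)) ks \<and>
     (case pull_front S ks (vertices H) of (s, us) \<Rightarrow>
      case (d * s, edge_map (vertex_edges (vertices T) @ outs T) (vertex_edges us @ outs H) 0) of (e, h) \<Rightarrow>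
      e = c \<and> rename_vertices h (vertices T) = us \<and> map h (outs T) = outs H \<and> map h (ins T) = ins H))"

lemma proves_eq_sound:
  assumes check: "proves_eq S steps ks c G T" and rules: "\<And>r ks. (r, ks) \<in> set steps \<Longrightarrow> valid_rule S R r"
    and GT: "G \<in> monomials S m n" "T \<in> monomials S m n"
  shows "signed_eq S R c G T"
proof -
  obtain d H where H: "rewrite_chain S steps G = Some (d, H)"
    using check by (auto simp: proves_eq_def split: option.splits)
  have 1: "signed_eq S R d G H" "H \<in> monomials S m n" using rewrite_chain_sound[OF H rules GT(1)] by auto
  show ?thesis
  proof (cases "d = 0 \<and> c = 0")
    case True
    then show ?thesis using 1(1) by (simp add: signed_eq_def)
  next
    case False
    then have ks: "list_all (\<lambda>k. k < length (vertices H)) ks"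
      using check by (auto simp: proves_eq_def H)
    obtain s us where us: "pull_front S ks (vertices H) = (s, us)" by (cases "pull_front S ks (vertices H)")
    define h where "h = edge_map (vertex_edges (vertices T) @ outs T) (vertex_edges us @ outs H) 0"
    have "c = d * s" and T: "rename_vertices h (vertices T) = us" "map h (outs T) = outs H" "map h (ins T) = ins H"
      using check False by (auto simp: proves_eq_def H us h_def Let_def)
    have 2: "signed_eq S R s H (DGraph us (outs H) (ins H))" "DGraph us (outs H) (ins H) \<in> monomials S m n"
      using pull_front_sound[OF us ks, of "outs H" "ins H" m n R] 1 by auto
    have T_eq: "DGraph us (outs H) (ins H) = rename h T" using T by (simp add: rename_def)
    then have "inj_on h (edges T)"
      using 2 GT(2) wf_rename_iff[of T h] by (simp add: monomials_def connected_dag_def)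
    from signed_eq_isomorphic[OF GT(2) this, of R] have "signed_eq S R 1 (DGraph us (outs H) (ins H)) T"
      unfolding T_eq using signed_eq_sym by fastforce
    then show ?thesis using 1(1) 2(1) signed_eq_trans \<open>c = d * s\<close> by (metis mult.right_neutral)
  qed
qed

section \<open>Explicit images of graphs and relations\<close>

text \<open>
  The composite, written down explicitly: legs of an inserted graph get the names of the edges they
  are glued to, and inner edges of the \<open>i\<close>-th graph are shifted by a multiple of the bound \<open>N\<close>.  This is
  a composite when no inserted graph has an edge that is both an input and an output.
\<close>

definition expand :: "('g \<Rightarrow> 'h dgraph) \<Rightarrow> 'g dgraph \<Rightarrow> 'h dgraph" where
  "expand \<sigma> G = (let vs = vertices G; N = Suc (foldr max (outs G @ ins G @ vertex_edges vs) 0) in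
    DGraph (concat (map (\<lambda>i. case vs ! i of (g, vo, vi) \<Rightarrow>
      rename_vertices (edge_map (outs (\<sigma> g) @ ins (\<sigma> g)) (vo @ vi) (N * Suc i)) (vertices (\<sigma> g))) [0..<length vs]))
     (outs G) (ins G))"

definition expandable :: "('g \<Rightarrow> 'h dgraph) \<Rightarrow> 'g dgraph \<Rightarrow> bool" where
  "expandable \<sigma> G \<longleftrightarrow> wf_dgraph (expand \<sigma> G) \<and> list_all (\<lambda>(g, vo, vi).
     map (edge_map (outs (\<sigma> g) @ ins (\<sigma> g)) (vo @ vi) 0) (outs (\<sigma> g)) = vo \<and>
     map (edge_map (outs (\<sigma> g) @ ins (\<sigma> g)) (vo @ vi) 0) (ins (\<sigma> g)) = vi) (vertices G)"

lemma edge_map_offset: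
  "length es = length es' \<Longrightarrow> e \<in> set es \<Longrightarrow> edge_map es es' k e = edge_map es es' l e"
  using map_of_zip_is_Some[of es es' e] by (auto simp: edge_map_def)

lemma expand_flattening:
  assumes "expandable \<sigma> G"
    and "\<And>g vo vi. (g, vo, vi) \<in> set (vertices G) \<Longrightarrow> length (outs (\<sigma> g)) = length vo \<and> length (ins (\<sigma> g)) = length vi"
  shows "is_flattening (map_dgraph \<sigma> G) (expand \<sigma> G)"
proof -
  define N where "N = Suc (foldr max (outs G @ ins G @ vertex_edges (vertices G)) 0)"
  let ?vs = "vertices G"
  let ?b = "\<lambda>i. case ?vs ! i of (g, vo, vi) \<Rightarrow>
      rename_vertices (edge_map (outs (\<sigma> g) @ ins (\<sigma> g)) (vo @ vi) (N * Suc i)) (vertices (\<sigma> g))"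
  have block: "inserts id (\<sigma> g, vo, vi) (?b i)" if i: "i < length ?vs" "?vs ! i = (g, vo, vi)" for i g vo vi
  proof -
    let ?h = "edge_map (outs (\<sigma> g) @ ins (\<sigma> g)) (vo @ vi)"
    have v: "(g, vo, vi) \<in> set ?vs" using i nth_mem by metis
    have offset: "map (?h k) es = map (?h 0) es" if "set es \<subseteq> set (outs (\<sigma> g) @ ins (\<sigma> g))" for es k
      using that assms(2)[OF v] by (intro map_cong refl edge_map_offset) auto
    have "map (?h 0) (outs (\<sigma> g)) = vo \<and> map (?h 0) (ins (\<sigma> g)) = vi"
      using assms(1) v unfolding expandable_def list_all_iff by fast
    then have "map (?h k) (outs (\<sigma> g)) = vo" "map (?h k) (ins (\<sigma> g)) = vi" for k
      using offset[of "outs (\<sigma> g)" k] offset[of "ins (\<sigma> g)" k] by simp_all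
    then show ?thesis
      unfolding inserts_def by (auto simp: i intro!: exI[of _ "?h (N * Suc i)"])
  qed
  have "list_all2 (inserts id) (vertices (map_dgraph \<sigma> G)) (map ?b [0..<length ?vs])"
  proof (rule list_all2_all_nthI)
    fix i assume "i < length (vertices (map_dgraph \<sigma> G))"
    then have i: "i < length ?vs" by simp
    obtain g vo vi where v: "?vs ! i = (g, vo, vi)" by (cases "?vs ! i")
    then have "vertices (map_dgraph \<sigma> G) ! i = (\<sigma> g, vo, vi)" "map ?b [0..<length ?vs] ! i = ?b i"
      using i by simp_all
    then show "inserts id (vertices (map_dgraph \<sigma> G) ! i) (map ?b [0..<length ?vs] ! i)"
      using block[OF i v] by (simp only:)
  qed simp
  then show ?thesis
    unfolding is_flattening_iff_inserts using assms(1)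
    by (intro conjI exI[of _ id] exI[of _ "map ?b [0..<length ?vs]"])
      (simp_all add: expandable_def expand_def Let_def N_def)
qed


lemma vertex_prod_of_int: "vertex_prod (\<lambda>g. of_int (\<chi> g)) G = (of_int (vertex_prod \<chi> G) :: 'k::comm_ring_1)"
proof -
  have "prod_list (map (\<lambda>(g, vo, vi). of_int (\<chi> g)) vs) = (of_int (prod_list (map (\<lambda>(g, vo, vi). \<chi> g) vs)) :: 'k)"
    for vs :: "('a \<times> nat list \<times> nat list) list"
    by (induction vs) auto
  then show ?thesis by (simp add: vertex_prod_def)
qed

definition rule_monomials :: "'g signature \<Rightarrow> 'g rule \<Rightarrow> bool" where
  "rule_monomials S = (\<lambda>(L, c, L'). is_monomial S (length (outs L)) (length (ins L)) L
     \<and> is_monomial S (length (outs L)) (length (ins L)) L')"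

definition rule_relation :: "'g rule \<Rightarrow> ('g, 'k::comm_ring_1) lincomb" where
  "rule_relation = (\<lambda>(L, c, L'). bvec L - scale (of_int c) (bvec L'))"

lemma valid_ruleI:
  "rule_monomials S r \<Longrightarrow> rule_relation r \<in> relation_ideal S R \<Longrightarrow> valid_rule S R r"
  by (auto simp: rule_monomials_def rule_relation_def valid_rule_def signed_eq_def dest!: is_monomial_sound)

definition reverse_rule :: "'g rule \<Rightarrow> 'g rule" where
  "reverse_rule = (\<lambda>(L, c, L'). (L', c, L))"

lemma valid_reverse_rule: "valid_rule S R r \<Longrightarrow> fst (snd r) * fst (snd r) = 1 \<Longrightarrow> valid_rule S R (reverse_rule r)"
  by (auto simp: valid_rule_def reverse_rule_def signed_eq_sym)

text \<open>
  The image of \<open>X - d Y\<close> is \<open>\<chi>(X) \<sigma>(X) - d \<chi>(Y) \<sigma>(Y)\<close>.  Since \<open>\<chi>(X)\<close> is its own inverse, the image vanishes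
  when \<open>\<sigma>(X) = \<chi>(X) d \<chi>(Y) \<sigma>(Y)\<close>.
\<close>

definition carries_rule :: "'g signature \<Rightarrow> 'h signature \<Rightarrow> ('g \<Rightarrow> 'h dgraph) \<Rightarrow> ('g \<Rightarrow> int) \<Rightarrow> ('h rule \<times> nat list) list
    \<Rightarrow> nat list \<Rightarrow> 'g rule \<Rightarrow> bool" where
  "carries_rule S S' \<sigma> \<chi> steps ks = (\<lambda>(X, d, Y). rule_monomials S (X, d, Y) \<and> expandable \<sigma> X \<and> expandable \<sigma> Y
     \<and> vertex_prod \<chi> X * vertex_prod \<chi> X = 1
     \<and> proves_eq S' steps ks (vertex_prod \<chi> X * d * vertex_prod \<chi> Y) (expand \<sigma> X) (expand \<sigma> Y))"

context presentation_map
begin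

lemma expand_image:
  assumes "G \<in> monomials S m n" "expandable \<sigma> G"
  shows "signed_eq S' R' 1 (graph_image G) (expand \<sigma> G)" "expand \<sigma> G \<in> monomials S' m n"
proof -
  have flat: "is_flattening (map_dgraph \<sigma> G) (expand \<sigma> G)"
  proof (rule expand_flattening[OF assms(2)])
    fix g vo vi assume "(g, vo, vi) \<in> set (vertices G)"
    then have "length vo = out_arity S g" "length vi = in_arity S g"
      using assms(1) by (auto simp: monomials_def)
    then show "length (outs (\<sigma> g)) = length vo \<and> length (ins (\<sigma> g)) = length vi"
      using image_monomial[of g] by (simp add: monomials_def)
  qed
  then show "signed_eq S' R' 1 (graph_image G) (expand \<sigma> G)"
    using graph_image_unique[OF assms(1) flat] by (simp add: signed_eq_def)
  have "length (outs G) = m" "length (ins G) = n" using assms(1) by (auto simp: monomials_def)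
  then show "expand \<sigma> G \<in> monomials S' m n"
    using flattening_monomial[OF decorated_image[OF assms(1)] flat] by simp
qed

lemma induced_rule:
  assumes check: "carries_rule S S' \<sigma> \<chi>' steps ks r" and \<chi>: "\<chi> = (\<lambda>g. of_int (\<chi>' g))"
    and rules: "\<And>r ks. (r, ks) \<in> set steps \<Longrightarrow> valid_rule S' R' r"
  shows "induced (rule_relation r) \<in> relation_ideal S' R'"
proof -
  obtain X d Y where r: "r = (X, d, Y)" by (cases r)
  let ?m = "length (outs X)" and ?n = "length (ins X)"
  let ?a = "vertex_prod \<chi>' X" and ?b = "vertex_prod \<chi>' Y"
  have X: "X \<in> monomials S ?m ?n" and Y: "Y \<in> monomials S ?m ?n" and ex: "expandable \<sigma> X" "expandable \<sigma> Y"
    and a: "?a * ?a = 1" and eq: "proves_eq S' steps ks (?a * d * ?b) (expand \<sigma> X) (expand \<sigma> Y)"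
    using check by (auto simp: carries_rule_def rule_monomials_def r dest!: is_monomial_sound)
  have "signed_eq S' R' (?a * d * ?b) (expand \<sigma> X) (expand \<sigma> Y)"
    by (rule proves_eq_sound[OF eq rules expand_image(2)[OF X ex(1)] expand_image(2)[OF Y ex(2)]])
  with expand_image(1)[OF X ex(1)] have "signed_eq S' R' (?a * d * ?b) (graph_image X) (expand \<sigma> Y)"
    using signed_eq_trans by fastforce
  moreover have "signed_eq S' R' 1 (expand \<sigma> Y) (graph_image Y)"
    using signed_eq_sym[OF expand_image(1)[OF Y ex(2)]] by simp
  ultimately have "signed_eq S' R' (?a * d * ?b) (graph_image X) (graph_image Y)"
    using signed_eq_trans by fastforce
  then have "scale (of_int ?a) (bvec (graph_image X)) - scale (of_int ?a) (scale (of_int (?a * d * ?b)) (bvec (graph_image Y)))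
      \<in> relation_ideal S' R'"
    unfolding signed_eq_def by (rule ideal_scale_cong)
  moreover have "of_int ?a * of_int (?a * d * ?b) = (of_int (d * ?b) :: 'k)"
    using a by (metis mult.assoc mult_1 of_int_mult)
  moreover have "vertex_prod \<chi> G = of_int (vertex_prod \<chi>' G)" for G by (simp add: \<chi> vertex_prod_of_int)
  ultimately show ?thesis
    by (simp add: rule_relation_def r)
qed

text \<open>
  The image graph of a corolla is \<open>\<sigma> g\<close> only up to renaming, because the composite is chosen.
\<close>

lemma induced_generator:
  assumes g: "out_arity S g > 0" and \<chi>: "\<chi> = (\<lambda>g. of_int (\<chi>' g))"
  shows "induced (bvec (corolla S g)) - scale (of_int (\<chi>' g)) (bvec (\<sigma> g)) \<in> relation_ideal S' R'"
proof -
  have M: "corolla S g \<in> monomials S (out_arity S g) (in_arity S g)" by (rule corolla_monomial[OF g])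
  have "is_flattening (map_dgraph \<sigma> (corolla S g)) (\<sigma> g)"
  proof -
    have wf: "wf_dgraph (\<sigma> g)" and len: "length (outs (\<sigma> g)) = out_arity S g" "length (ins (\<sigma> g)) = in_arity S g"
      using image_monomial[of g] by (auto simp: monomials_def connected_dag_def)
    let ?f = "\<lambda>i. (outs (\<sigma> g) @ ins (\<sigma> g)) ! i"
    have "map ?f [0..<out_arity S g] = outs (\<sigma> g)"
      by (rule nth_equalityI) (auto simp: len nth_append)
    moreover have "map ?f [out_arity S g..<out_arity S g + in_arity S g] = ins (\<sigma> g)"
      by (rule nth_equalityI) (auto simp: len nth_append)
    ultimately show ?thesis
      unfolding is_flattening_iff_inserts using wf
      by (intro conjI exI[of _ ?f] exI[of _ "[vertices (\<sigma> g)]"])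
        (auto simp: corolla_def Let_def inserts_def rename_id intro!: exI[of _ id])
  qed
  from graph_image_unique[OF M this]
  have "scale (of_int (\<chi>' g)) (bvec (graph_image (corolla S g))) - scale (of_int (\<chi>' g)) (bvec (\<sigma> g)) \<in> relation_ideal S' R'"
    by (rule ideal_scale_cong)
  moreover have "vertex_prod \<chi> (corolla S g) = of_int (\<chi>' g)"
    by (simp add: vertex_prod_def corolla_def Let_def \<chi>)
  ultimately show ?thesis by simp
qed

end

lemma valid_rule_derived:
  assumes "rule_monomials S (G, c, T)" "proves_eq S steps ks c G T"
    "\<And>r ks. (r, ks) \<in> set steps \<Longrightarrow> valid_rule S R r"
  shows "valid_rule S R (G, c, T)"
proof -
  have "G \<in> monomials S (length (outs G)) (length (ins G))" "T \<in> monomials S (length (outs G)) (length (ins G))"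
    using assms(1) by (auto simp: rule_monomials_def dest!: is_monomial_sound)
  then show ?thesis
    using proves_eq_sound[OF assms(2,3)] by (auto simp: valid_rule_def)
qed

text \<open>
  The inner map sends the generator to \<open>\<chi> g \<sigma> g\<close> modulo relations, which the outer map respects.  So it
  remains to rewrite the explicit image of \<open>\<sigma> g\<close>.
\<close>

lemma inverse_on_generator:
  fixes R :: "('g, 'k::comm_ring_1) lincomb set" and R' :: "('h, 'k) lincomb set"
  assumes "presentation_map S S' \<sigma>" "presentation_map S' S \<sigma>'"
    and rels: "\<And>r. r \<in> R' \<Longrightarrow> presentation_map.induced \<sigma>' (\<lambda>h. of_int (\<chi>' h)) r \<in> relation_ideal S R"
    and g: "out_arity S g > 0" and ex: "expandable \<sigma>' (\<sigma> g)"
    and sign: "(\<chi> g * vertex_prod \<chi>' (\<sigma> g)) * (\<chi> g * vertex_prod \<chi>' (\<sigma> g)) = 1"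
    and eq: "proves_eq S steps ks (\<chi> g * vertex_prod \<chi>' (\<sigma> g)) (expand \<sigma>' (\<sigma> g)) (corolla S g)"
    and rules: "\<And>r ks. (r, ks) \<in> set steps \<Longrightarrow> valid_rule S R r"
  shows "presentation_map.induced \<sigma>' (\<lambda>h. of_int (\<chi>' h)) (presentation_map.induced \<sigma> (\<lambda>g. of_int (\<chi> g)) (bvec (corolla S g)))
    - bvec (corolla S g) \<in> relation_ideal S R"
proof -
  interpret F: presentation_map S R S' R' \<sigma> "\<lambda>g. of_int (\<chi> g)" by fact
  interpret B: presentation_map S' R' S R \<sigma>' "\<lambda>h. of_int (\<chi>' h)" by fact
  let ?c = "vertex_prod \<chi>' (\<sigma> g)"
  note M = F.image_monomial[of g]
  have "F.induced (bvec (corolla S g)) - scale (of_int (\<chi> g)) (bvec (\<sigma> g)) \<in> relation_ideal S' R'"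
    by (rule F.induced_generator[OF g refl])
  from B.induced_ideal[OF rels this]
  have 1: "B.induced (F.induced (bvec (corolla S g))) - scale (of_int (\<chi> g * ?c)) (bvec (B.graph_image (\<sigma> g))) \<in> relation_ideal S R"
    by (simp add: vertex_prod_of_int)
  have "signed_eq S R (\<chi> g * ?c) (expand \<sigma>' (\<sigma> g)) (corolla S g)"
    by (rule proves_eq_sound[OF eq rules B.expand_image(2)[OF M ex] corolla_monomial[OF g]])
  then have "signed_eq S R (\<chi> g * ?c) (B.graph_image (\<sigma> g)) (corolla S g)"
    using signed_eq_trans[OF B.expand_image(1)[OF M ex]] by fastforce
  from signed_eq_sym[OF this sign] have "bvec (corolla S g) - scale (of_int (\<chi> g * ?c)) (bvec (B.graph_image (\<sigma> g))) \<in> relation_ideal S R"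
    by (simp add: signed_eq_def)
  from ideal_trans[OF 1 ideal_sym[OF this]] show ?thesis .
qed

section \<open>The relations of the two properads as rewrite rules\<close>

abbreviation bib_u :: "bib_gen dgraph" where "bib_u \<equiv> corolla bib_sig Unit_BIB"
abbreviation bib_m :: "bib_gen dgraph" where "bib_m \<equiv> corolla bib_sig Mult_BIB"
abbreviation bib_\<Delta> :: "bib_gen dgraph" where "bib_\<Delta> \<equiv> corolla bib_sig Comult_BIB"

definition bib_B :: "bib_gen dgraph" where
  "bib_B = (\<one> \<otimes> bib_m) \<odot> (\<tau> \<otimes> \<one>) \<odot> (\<one> \<otimes> bib_\<Delta>)"

definition bib_D :: "bib_gen dgraph" where
  "bib_D = (bib_m \<otimes> \<one>) \<odot> (\<one> \<otimes> \<tau>) \<odot> (bib_\<Delta> \<otimes> \<one>)"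

definition bib_assoc :: "bib_gen rule" where
  "bib_assoc = (bib_m \<odot> (\<one> \<otimes> bib_m), -1, bib_m \<odot> (bib_m \<otimes> \<one>))"
definition bib_coassoc :: "bib_gen rule" where
  "bib_coassoc = ((\<one> \<otimes> bib_\<Delta>) \<odot> bib_\<Delta>, 1, (bib_\<Delta> \<otimes> \<one>) \<odot> bib_\<Delta>)"
definition bib_left_linear :: "bib_gen rule" where
  "bib_left_linear = ((bib_m \<otimes> \<one>) \<odot> (\<one> \<otimes> bib_\<Delta>), 1, bib_\<Delta> \<odot> bib_m)"
definition bib_right_linear :: "bib_gen rule" where
  "bib_right_linear = ((\<one> \<otimes> bib_m) \<odot> (bib_\<Delta> \<otimes> \<one>), 1, bib_\<Delta> \<odot> bib_m)"
definition bib_antisym :: "bib_gen rule" where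
  "bib_antisym = (bib_B, -1, \<tau> \<odot> bib_B \<odot> \<tau>)"
definition bib_balanced :: "bib_gen rule" where
  "bib_balanced = (bib_B, -1, bib_D \<odot> \<tau>)"
definition bib_loop :: "bib_gen rule" where
  "bib_loop = (bib_m \<odot> bib_\<Delta>, 0, bib_m \<odot> bib_\<Delta>)"
definition bib_twisted_loop :: "bib_gen rule" where
  "bib_twisted_loop = (bib_m \<odot> \<tau> \<odot> bib_\<Delta>, 0, bib_m \<odot> \<tau> \<odot> bib_\<Delta>)"
definition bib_left_unit :: "bib_gen rule" where
  "bib_left_unit = (bib_m \<odot> (bib_u \<otimes> \<one>), -1, \<one>)"
definition bib_right_unit :: "bib_gen rule" where
  "bib_right_unit = (bib_m \<odot> (\<one> \<otimes> bib_u), 1, \<one>)"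

lemmas bib_rule_defs = bib_assoc_def bib_coassoc_def bib_left_linear_def bib_right_linear_def bib_antisym_def
  bib_balanced_def bib_loop_def bib_twisted_loop_def bib_left_unit_def bib_right_unit_def

definition bib_rules :: "bib_gen rule list" where
  "bib_rules = [bib_assoc, bib_coassoc, bib_left_linear, bib_right_linear, bib_antisym, bib_balanced,
    bib_loop, bib_twisted_loop, bib_left_unit, bib_right_unit]"

lemma bib_rels_eq: "(bib_rels :: (bib_gen, 'k::comm_ring_1) lincomb set) = rule_relation ` set bib_rules"
  by (simp add: bib_rels_def bib_rules_def rule_relation_def bib_rule_defs Let_def uminus_scale
      flip: bib_B_def bib_D_def)

lemma bib_rules_monomials: "list_all (rule_monomials bib_sig) bib_rules"
  by code_simp

abbreviation dpois_u :: "dpois_gen dgraph" where "dpois_u \<equiv> corolla dpois_sig Unit_DPois"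
abbreviation dpois_m :: "dpois_gen dgraph" where "dpois_m \<equiv> corolla dpois_sig Mult_DPois"
abbreviation dpois_w :: "dpois_gen dgraph" where "dpois_w \<equiv> corolla dpois_sig Bracket_DPois"

definition dpois_antisym :: "dpois_gen rule" where
  "dpois_antisym = (\<tau> \<odot> dpois_w \<odot> \<tau>, -1, dpois_w)"
definition dpois_assoc :: "dpois_gen rule" where
  "dpois_assoc = (dpois_m \<odot> (\<one> \<otimes> dpois_m), -1, dpois_m \<odot> (dpois_m \<otimes> \<one>))"
definition dpois_left_unit :: "dpois_gen rule" where
  "dpois_left_unit = (dpois_m \<odot> (dpois_u \<otimes> \<one>), -1, \<one>)"
definition dpois_right_unit :: "dpois_gen rule" where
  "dpois_right_unit = (dpois_m \<odot> (\<one> \<otimes> dpois_u), 1, \<one>)"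
definition dpois_left_linear :: "dpois_gen rule" where
  "dpois_left_linear = ((dpois_m \<otimes> \<one>) \<odot> (\<one> \<otimes> dpois_w), -1, dpois_w \<odot> (\<one> \<otimes> dpois_m) \<odot> (\<tau> \<otimes> \<one>))"
definition dpois_right_linear :: "dpois_gen rule" where
  "dpois_right_linear = ((dpois_m \<otimes> \<one>) \<odot> (\<one> \<otimes> \<tau>) \<odot> (dpois_w \<otimes> \<one>), -1, dpois_w \<odot> (dpois_m \<otimes> \<one>) \<odot> (\<one> \<otimes> \<tau>))"
definition dpois_cyclic :: "dpois_gen rule" where
  "dpois_cyclic = ((dpois_w \<otimes> \<one>) \<odot> (\<one> \<otimes> dpois_w), 1,
    cycle3_inv \<odot> ((dpois_w \<otimes> \<one>) \<odot> (\<one> \<otimes> dpois_w)) \<odot> cycle3)"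
definition dpois_mult_bracket :: "dpois_gen rule" where
  "dpois_mult_bracket = (dpois_m \<odot> dpois_w, 0, dpois_m \<odot> dpois_w)"
definition dpois_bracket_bracket :: "dpois_gen rule" where
  "dpois_bracket_bracket = (dpois_w \<odot> dpois_w, 0, dpois_w \<odot> dpois_w)"

lemmas dpois_rule_defs = dpois_antisym_def dpois_assoc_def dpois_left_unit_def dpois_right_unit_def
  dpois_left_linear_def dpois_right_linear_def dpois_cyclic_def dpois_mult_bracket_def dpois_bracket_bracket_def

definition dpois_rules :: "dpois_gen rule list" where
  "dpois_rules = [dpois_antisym, dpois_assoc, dpois_left_unit, dpois_right_unit, dpois_left_linear,
    dpois_right_linear, dpois_cyclic, dpois_mult_bracket, dpois_bracket_bracket]"

lemma dpois_rels_eq: "(dpois_rels :: (dpois_gen, 'k::comm_ring_1) lincomb set) = rule_relation ` set dpois_rules"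
  by (simp add: dpois_rels_def dpois_rules_def rule_relation_def dpois_rule_defs Let_def uminus_scale)

lemma dpois_rules_monomials: "list_all (rule_monomials dpois_sig) dpois_rules"
  by code_simp

lemma bib_rule_valid: "r \<in> set bib_rules \<Longrightarrow> valid_rule bib_sig bib_rels r"
  using bib_rules_monomials by (intro valid_ruleI relation_ideal.rel) (auto simp: list_all_iff bib_rels_eq)

lemma dpois_rule_valid: "r \<in> set dpois_rules \<Longrightarrow> valid_rule dpois_sig dpois_rels r"
  using dpois_rules_monomials by (intro valid_ruleI relation_ideal.rel) (auto simp: list_all_iff dpois_rels_eq)

lemma bib_rules_valid:
  "valid_rule bib_sig bib_rels bib_assoc" "valid_rule bib_sig bib_rels bib_coassoc"
  "valid_rule bib_sig bib_rels bib_left_linear" "valid_rule bib_sig bib_rels bib_right_linear"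
  "valid_rule bib_sig bib_rels bib_antisym" "valid_rule bib_sig bib_rels bib_balanced"
  "valid_rule bib_sig bib_rels bib_loop" "valid_rule bib_sig bib_rels bib_twisted_loop"
  "valid_rule bib_sig bib_rels bib_left_unit" "valid_rule bib_sig bib_rels bib_right_unit"
  by (rule bib_rule_valid; simp add: bib_rules_def)+

lemma bib_reverse_rules_valid:
  "valid_rule bib_sig bib_rels (reverse_rule bib_assoc)" "valid_rule bib_sig bib_rels (reverse_rule bib_coassoc)"
  "valid_rule bib_sig bib_rels (reverse_rule bib_left_linear)"
  "valid_rule bib_sig bib_rels (reverse_rule bib_balanced)"
  by (rule valid_reverse_rule, rule bib_rules_valid, simp add: bib_rule_defs)+

lemma dpois_rules_valid:
  "valid_rule dpois_sig dpois_rels dpois_antisym" "valid_rule dpois_sig dpois_rels dpois_assoc"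
  "valid_rule dpois_sig dpois_rels dpois_left_unit" "valid_rule dpois_sig dpois_rels dpois_right_unit"
  "valid_rule dpois_sig dpois_rels dpois_left_linear" "valid_rule dpois_sig dpois_rels dpois_right_linear"
  "valid_rule dpois_sig dpois_rels dpois_cyclic" "valid_rule dpois_sig dpois_rels dpois_mult_bracket"
  "valid_rule dpois_sig dpois_rels dpois_bracket_bracket"
  by (rule dpois_rule_valid; simp add: dpois_rules_def)+

lemma dpois_reverse_rules_valid: "valid_rule dpois_sig dpois_rels (reverse_rule dpois_cyclic)"
  by (rule valid_reverse_rule, rule dpois_rules_valid, simp add: dpois_rule_defs)

section \<open>The isomorphism of generators and relations\<close>

fun to_bib :: "dpois_gen \<Rightarrow> bib_gen dgraph" where
  "to_bib Unit_DPois = bib_u" | "to_bib Mult_DPois = bib_m" | "to_bib Bracket_DPois = bib_B"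

fun to_dpois :: "bib_gen \<Rightarrow> dpois_gen dgraph" where
  "to_dpois Unit_BIB = dpois_u" | "to_dpois Mult_BIB = dpois_m"
| "to_dpois Comult_BIB = dpois_w \<odot> (dpois_u \<otimes> \<one>)"

definition bib_sign :: "dpois_gen \<Rightarrow> int" where "bib_sign g = 1"

fun dpois_sign :: "bib_gen \<Rightarrow> int" where
  "dpois_sign Comult_BIB = -1" | "dpois_sign Unit_BIB = 1" | "dpois_sign Mult_BIB = 1"

lemma presentation_map_to_bib: "presentation_map dpois_sig bib_sig to_bib"
proof
  fix g
  have "is_monomial bib_sig (out_arity dpois_sig g) (in_arity dpois_sig g) (to_bib g)"
    by (cases g; hypsubst; code_simp)
  then show "to_bib g \<in> monomials bib_sig (out_arity dpois_sig g) (in_arity dpois_sig g)"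
    by (rule is_monomial_sound)
  show "graph_degree bib_sig (to_bib g) = degree dpois_sig g"
    by (cases g; hypsubst; code_simp)
qed

lemma presentation_map_to_dpois: "presentation_map bib_sig dpois_sig to_dpois"
proof
  fix g
  have "is_monomial dpois_sig (out_arity bib_sig g) (in_arity bib_sig g) (to_dpois g)"
    by (cases g; hypsubst; code_simp)
  then show "to_dpois g \<in> monomials dpois_sig (out_arity bib_sig g) (in_arity bib_sig g)"
    by (rule is_monomial_sound)
  show "graph_degree dpois_sig (to_dpois g) = degree bib_sig g"
    by (cases g; hypsubst; code_simp)
qed

text \<open>
  The image of \<open>B\<close> is \<open>- B\<close> with \<open>w(u \<otimes> id)\<close> in place of \<open>\<Delta>\<close>, which is \<open>w\<close>; and \<open>D \<tau>\<close> goes to \<open>- w\<close>.  These two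
  equations shorten the derivations of the other relations.
\<close>

definition dpois_B :: "dpois_gen rule" where
  "dpois_B = (expand to_dpois bib_B, -1, dpois_w)"
definition dpois_D :: "dpois_gen rule" where
  "dpois_D = (expand to_dpois (bib_D \<odot> \<tau>), 1, dpois_w)"

text \<open>
  After a twist of the bracket, linearity moves the product from an output to an input, where it
  meets the unit and disappears.  The second twist restores the order of the strands.
\<close>

lemma dpois_B_valid: "valid_rule dpois_sig dpois_rels dpois_B"
proof -
  have "rule_monomials dpois_sig dpois_B" by code_simp
  moreover have "proves_eq dpois_sig [(dpois_antisym, [1]), (dpois_left_linear, [0, 1]), (dpois_right_unit, [2, 2]), (dpois_antisym, [0])]
    [] (-1) (expand to_dpois bib_B) dpois_w"
    by code_simp
  ultimately show ?thesis
    unfolding dpois_B_def by (rule valid_rule_derived) (auto simp: dpois_rules_valid)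
qed

lemma dpois_D_valid: "valid_rule dpois_sig dpois_rels dpois_D"
proof -
  have "rule_monomials dpois_sig dpois_D" by code_simp
  moreover have "proves_eq dpois_sig [(dpois_right_linear, [1, 1]), (dpois_left_unit, [2, 2])]
    [] 1 (expand to_dpois (bib_D \<odot> \<tau>)) dpois_w"
    by code_simp
  ultimately show ?thesis
    unfolding dpois_D_def by (rule valid_rule_derived) (auto simp: dpois_rules_valid)
qed

lemma dpois_derived_valid:
  "valid_rule dpois_sig dpois_rels dpois_B" "valid_rule dpois_sig dpois_rels (reverse_rule dpois_B)"
  "valid_rule dpois_sig dpois_rels (reverse_rule dpois_D)"
  using dpois_B_valid dpois_D_valid by (auto intro!: valid_reverse_rule simp: dpois_B_def dpois_D_def)

abbreviation "bib_carries \<equiv> carries_rule dpois_sig bib_sig to_bib bib_sign"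
abbreviation "dpois_carries \<equiv> carries_rule bib_sig dpois_sig to_dpois dpois_sign"

text \<open>
  Antisymmetry of \<open>w\<close> is antisymmetry of \<open>B\<close>.  The first linearity relation follows from the linearity
  of \<open>\<Delta>\<close>, the second one, with \<open>B = - D \<tau>\<close>, from associativity.  The cyclic relation is
  coassociativity, after one more use of linearity and antisymmetry.  In \<open>m w\<close> and \<open>w w\<close> the
  two legs of one coproduct can be multiplied in reversed order, which gives zero.
\<close>

lemma bib_carries:
  "bib_carries [(bib_antisym, [1, 1])] [] dpois_antisym"
  "bib_carries [(bib_assoc, [1, 1])] [] dpois_assoc"
  "bib_carries [(bib_left_unit, [1, 1])] [] dpois_left_unit"
  "bib_carries [(bib_right_unit, [1, 1])] [] dpois_right_unit"
  "bib_carries [(bib_left_linear, [2, 1])] [1, 1, 2] dpois_left_linear"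
  "bib_carries [(reverse_rule bib_balanced, [2, 1]), (bib_assoc, [0, 2])] [1, 2, 2] dpois_right_linear"
  "bib_carries [(reverse_rule bib_coassoc, [3, 2]), (bib_left_linear, [0, 2]), (bib_antisym, [2, 2])] [1, 1, 2, 3] dpois_cyclic"
  "bib_carries [(bib_antisym, [2, 2]), (reverse_rule bib_assoc, [0, 2]), (bib_twisted_loop, [2, 2])] [] dpois_mult_bracket"
  "bib_carries [(reverse_rule bib_left_linear, [2, 2]), (bib_antisym, [1, 2]), (reverse_rule bib_coassoc, [3, 2]), (bib_twisted_loop, [0, 2])]
    [] dpois_bracket_bracket"
  by code_simp+

text \<open>
  Coassociativity is the cyclic relation with two units inserted, and linearity of \<open>\<Delta>\<close> is linearity
  of \<open>w\<close>, in both cases up to twisting brackets.  The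
  relations between \<open>B\<close>, \<open>\<tau> B \<tau>\<close> and \<open>D \<tau>\<close> hold because all three are \<open>w\<close> up to sign, and the two
  loops come from \<open>m w = 0\<close>.
\<close>

lemma dpois_carries:
  "dpois_carries [(dpois_assoc, [1, 1])] [] bib_assoc"
  "dpois_carries [(dpois_antisym, [2]), (reverse_rule dpois_cyclic, [0, 1])] [2, 2, 3, 3] bib_coassoc"
  "dpois_carries [(dpois_left_linear, [1, 1])] [1, 2, 2] bib_left_linear"
  "dpois_carries [(dpois_antisym, [1]), (dpois_right_linear, [0, 1]), (dpois_antisym, [0])] [1, 2, 2] bib_right_linear"
  "dpois_carries [(dpois_B, [2, 2, 2]), (dpois_antisym, [0]), (reverse_rule dpois_B, [0])] [] bib_antisym"
  "dpois_carries [(dpois_B, [2, 2, 2]), (reverse_rule dpois_D, [0])] [] bib_balanced"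
  "dpois_carries [(dpois_mult_bracket, [1, 1])] [] bib_loop"
  "dpois_carries [(dpois_antisym, [1]), (dpois_mult_bracket, [0, 1])] [] bib_twisted_loop"
  "dpois_carries [(dpois_left_unit, [1, 1])] [] bib_left_unit"
  "dpois_carries [(dpois_right_unit, [1, 1])] [] bib_right_unit"
  by code_simp+

lemma to_bib_rels:
  assumes "r \<in> dpois_rels"
  shows "presentation_map.induced to_bib (\<lambda>g. of_int (bib_sign g)) r \<in> relation_ideal bib_sig bib_rels"
proof -
  interpret presentation_map dpois_sig dpois_rels bib_sig bib_rels to_bib "\<lambda>g. of_int (bib_sign g)"
    by (rule presentation_map_to_bib)
  show ?thesis
    using assms unfolding dpois_rels_eq dpois_rules_def list.set image_insert image_empty insert_iff empty_iff simp_thms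
    by - (elim disjE; hypsubst; rule bib_carries[THEN induced_rule, OF refl];
        auto simp: bib_rules_valid bib_reverse_rules_valid)
qed

lemma to_dpois_rels:
  assumes "r \<in> bib_rels"
  shows "presentation_map.induced to_dpois (\<lambda>g. of_int (dpois_sign g)) r \<in> relation_ideal dpois_sig dpois_rels"
proof -
  interpret presentation_map bib_sig bib_rels dpois_sig dpois_rels to_dpois "\<lambda>g. of_int (dpois_sign g)"
    by (rule presentation_map_to_dpois)
  show ?thesis
    using assms unfolding bib_rels_eq bib_rules_def list.set image_insert image_empty insert_iff empty_iff simp_thms
    by - (elim disjE; hypsubst; rule dpois_carries[THEN induced_rule, OF refl];
        auto simp: dpois_rules_valid dpois_reverse_rules_valid dpois_derived_valid)
qed

lemma presentation_iso_dpois_bib: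
  "presentation_iso dpois_sig (dpois_rels :: (dpois_gen, 'k::comm_ring_1) lincomb set) bib_sig bib_rels
    to_bib (\<lambda>g. of_int (bib_sign g)) to_dpois (\<lambda>g. of_int (dpois_sign g))"
proof (intro presentation_iso.intro presentation_iso_axioms.intro presentation_map_to_bib presentation_map_to_dpois
    to_bib_rels to_dpois_rels)
  fix g
  show "presentation_map.induced to_dpois (\<lambda>g. of_int (dpois_sign g))
     (presentation_map.induced to_bib (\<lambda>g. of_int (bib_sign g)) (bvec (corolla dpois_sig g) :: (dpois_gen, 'k) lincomb))
    - bvec (corolla dpois_sig g) \<in> relation_ideal dpois_sig dpois_rels"
  proof (rule inverse_on_generator[OF presentation_map_to_bib presentation_map_to_dpois to_dpois_rels])
    show "0 < out_arity dpois_sig g" by (cases g; hypsubst; code_simp)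
    show "expandable to_dpois (to_bib g)" by (cases g; hypsubst; code_simp)
    show "bib_sign g * vertex_prod dpois_sign (to_bib g) * (bib_sign g * vertex_prod dpois_sign (to_bib g)) = 1"
      by (cases g; hypsubst; code_simp)
    show "proves_eq dpois_sig (case g of Bracket_DPois \<Rightarrow> [(dpois_B, [2, 2, 2])] | _ \<Rightarrow> []) []
      (bib_sign g * vertex_prod dpois_sign (to_bib g)) (expand to_dpois (to_bib g)) (corolla dpois_sig g)"
      by (cases g; hypsubst; code_simp)
  qed (auto simp: dpois_derived_valid split: dpois_gen.splits)
qed

lemma presentation_iso_bib_dpois:
  "presentation_iso bib_sig (bib_rels :: (bib_gen, 'k::comm_ring_1) lincomb set) dpois_sig dpois_rels
    to_dpois (\<lambda>g. of_int (dpois_sign g)) to_bib (\<lambda>g. of_int (bib_sign g))"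
proof (intro presentation_iso.intro presentation_iso_axioms.intro presentation_map_to_bib presentation_map_to_dpois
    to_bib_rels to_dpois_rels)
  fix g
  show "presentation_map.induced to_bib (\<lambda>g. of_int (bib_sign g))
     (presentation_map.induced to_dpois (\<lambda>g. of_int (dpois_sign g)) (bvec (corolla bib_sig g) :: (bib_gen, 'k) lincomb))
    - bvec (corolla bib_sig g) \<in> relation_ideal bib_sig bib_rels"
  proof (rule inverse_on_generator[OF presentation_map_to_dpois presentation_map_to_bib to_bib_rels])
    show "0 < out_arity bib_sig g" by (cases g; hypsubst; code_simp)
    show "expandable to_bib (to_dpois g)" by (cases g; hypsubst; code_simp)
    show "dpois_sign g * vertex_prod bib_sign (to_dpois g) * (dpois_sign g * vertex_prod bib_sign (to_dpois g)) = 1"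
      by (cases g; hypsubst; code_simp)
    show "proves_eq bib_sig (case g of Comult_BIB \<Rightarrow> [(bib_left_unit, [2, 1])] | _ \<Rightarrow> []) []
      (dpois_sign g * vertex_prod bib_sign (to_dpois g)) (expand to_bib (to_dpois g)) (corolla bib_sig g)"
      by (cases g; hypsubst; code_simp)
  qed (auto simp: bib_rules_valid split: bib_gen.splits)
qed

theorem theorem12:
  shows "properads_isomorphic
    (uDPois :: ((dpois_gen, 'k::field_char_0) lincomb set, 'k) properad)
    (uBIB :: ((bib_gen, 'k) lincomb set, 'k) properad)"
  unfolding uDPois_def uBIB_def
  by (rule presented_properads_isomorphic[OF presentation_iso_dpois_bib presentation_iso_bib_dpois])

end
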